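(* Let $\mathcal{X}$ be a Hilbert module over a pro-$C^*$-algebra $\mathcal{A}$, let $K\in Hom^*_{\mathcal{A}}(\mathcal{X})$ be uniformly bounded with $Ran(K)$ dense in $\mathcal{X}$, let $\{\xi_i\}_{i\in I}$ be a $K$-frame for $\mathcal{X}$, and let $T\in Hom^*_{\mathcal{A}}(\mathcal{X})$ be uniformly bounded with closed range. If $\{T\xi_i\}_{i\in I}$ and $\{T^*\xi_i\}_{i\in I}$ are $K$-frames for $\mathcal{X}$, then $T$ is invertible.
   Context: A pro-$C^*$-algebra $\mathcal{A}$ is a complete Hausdorff topological $*$-algebra whose topology is given by its continuous $C^*$-seminorms $S(\mathcal{A})$. A Hilbert $\mathcal{A}$-module $\mathcal{X}$ is a left $\mathcal{A}$-module with an $\mathcal{A}$-valued inner product, complete for $\bar p_{\mathcal{X}}(\xi)=\sqrt{p(\langle\xi,\xi\rangle)}$. $Hom^*_{\mathcal{A}}(\mathcal{X})$ denotes adjointable bounded $\mathcal{A}$-module maps; $T$ is uniformly bounded if there is a single $C>0$ with $\bar p_{\mathcal{X}}(T\xi)\le C\bar p_{\mathcal{X}}(\xi)$ for all $p,\xi$. A sequence $\{\xi_i\}_{i\in I}$ ($I$ countable) is a $K$-frame for $\mathcal{X}$ if $\sum_i\langle\xi,\xi_i\rangle\langle\xi_i,\xi\rangle$ converges in $\mathcal{A}$ and there are $A,B>0$ with $A\langle K^*\xi,K^*\xi\rangle\le\sum_i\langle\xi,\xi_i\rangle\langle\xi_i,\xi\rangle\le B\langle\xi,\xi\rangle$ for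 all $\xi\in\mathcal{X}$. *)

theory Defs
  imports "HOL-Analysis.Analysis"
begin

definition star_algebra :: "(complex \<Rightarrow> 'a::ring \<Rightarrow> 'a) \<Rightarrow> ('a \<Rightarrow> 'a) \<Rightarrow> bool" where
  "star_algebra sm st \<longleftrightarrow>
     vector_space sm \<and>
     (\<forall>c a b. sm c (a * b) = sm c a * b \<and> sm c (a * b) = a * sm c b) \<and>
     (\<forall>a. st (st a) = a) \<and>
     (\<forall>a b. st (a + b) = st a + st b) \<and>
     (\<forall>c a. st (sm c a) = sm (cnj c) (st a)) \<and>
     (\<forall>a b. st (a * b) = st b * st a)"

definition cstar_seminorm ::
  "(complex \<Rightarrow> 'a::ring \<Rightarrow> 'a) \<Rightarrow> ('a \<Rightarrow> 'a) \<Rightarrow> ('a \<Rightarrow> real) \<Rightarrow> bool" where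
  "cstar_seminorm sm st p \<longleftrightarrow>
     (\<forall>a. 0 \<le> p a) \<and>
     (\<forall>a b. p (a + b) \<le> p a + p b) \<and>
     (\<forall>c a. p (sm c a) = cmod c * p a) \<and>
     (\<forall>a b. p (a * b) \<le> p a * p b) \<and>
     (\<forall>a. p (st a) = p a) \<and>
     (\<forall>a. p (st a * a) = (p a)\<^sup>2)"

definition seminorm_continuous :: "('v \<Rightarrow> real) set \<Rightarrow> ('v \<Rightarrow> real) \<Rightarrow> bool" where
  "seminorm_continuous S q \<longleftrightarrow>
     (\<exists>F C. finite F \<and> F \<subseteq> S \<and> (\<forall>a. q a \<le> C * (\<Sum>p\<in>F. p a)))"

definition sn_cauchy :: "('v::ab_group_add \<Rightarrow> real) set \<Rightarrow> 'v filter \<Rightarrow> bool" where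
  "sn_cauchy S F \<longleftrightarrow> (\<forall>p\<in>S. \<forall>e>0. eventually (\<lambda>(x, y). p (x - y) < e) (F \<times>\<^sub>F F))"

definition sn_converges :: "('v::ab_group_add \<Rightarrow> real) set \<Rightarrow> 'v filter \<Rightarrow> 'v \<Rightarrow> bool" where
  "sn_converges S F l \<longleftrightarrow> (\<forall>p\<in>S. \<forall>e>0. eventually (\<lambda>x. p (x - l) < e) F)"

definition sn_complete :: "('v::ab_group_add \<Rightarrow> real) set \<Rightarrow> bool" where
  "sn_complete S \<longleftrightarrow> (\<forall>F. F \<noteq> bot \<and> sn_cauchy S F \<longrightarrow> (\<exists>l. sn_converges S F l))"

definition sn_closure :: "('v::ab_group_add \<Rightarrow> real) set \<Rightarrow> 'v set \<Rightarrow> 'v set" where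
  "sn_closure N M = {x. \<forall>F. finite F \<and> F \<subseteq> N \<longrightarrow>
                        (\<forall>e>0. \<exists>y\<in>M. \<forall>q\<in>F. q (x - y) < e)}"

definition sn_has_sum :: "('v::ab_group_add \<Rightarrow> real) set \<Rightarrow> ('i \<Rightarrow> 'v) \<Rightarrow> 'i set \<Rightarrow> 'v \<Rightarrow> bool" where
  "sn_has_sum S f I s \<longleftrightarrow>
     (\<forall>p\<in>S. \<forall>e>0. eventually (\<lambda>F. p (sum f F - s) < e) (finite_subsets_at_top I))"

text \<open>\<open>S\<close> is the family \<open>S(A)\<close> of all continuous C*-seminorms; the topology of \<open>A\<close> is the one
it generates. We require: all members are C*-seminorms, every C*-seminorm continuous for the
generated topology belongs to \<open>S\<close>, Hausdorff, complete.\<close>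
definition pro_cstar_algebra ::
  "(complex \<Rightarrow> 'a::ring \<Rightarrow> 'a) \<Rightarrow> ('a \<Rightarrow> 'a) \<Rightarrow> ('a \<Rightarrow> real) set \<Rightarrow> bool" where
  "pro_cstar_algebra sm st S \<longleftrightarrow>
     star_algebra sm st \<and>
     (\<forall>p\<in>S. cstar_seminorm sm st p) \<and>
     (\<forall>q. cstar_seminorm sm st q \<and> seminorm_continuous S q \<longrightarrow> q \<in> S) \<and>
     (\<forall>a. a \<noteq> 0 \<longrightarrow> (\<exists>p\<in>S. p a \<noteq> 0)) \<and>
     sn_complete S"

definition positive :: "('a::ring \<Rightarrow> 'a) \<Rightarrow> 'a \<Rightarrow> bool" where
  "positive st a \<longleftrightarrow> (\<exists>b. a = st b * b)"

definition cle :: "('a::ring \<Rightarrow> 'a) \<Rightarrow> 'a \<Rightarrow> 'a \<Rightarrow> bool" where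
  "cle st a b \<longleftrightarrow> positive st (b - a)"

definition hnorm :: "('a \<Rightarrow> real) \<Rightarrow> ('x \<Rightarrow> 'x \<Rightarrow> 'a) \<Rightarrow> 'x \<Rightarrow> real" where
  "hnorm p ip x = sqrt (p (ip x x))"

definition hnorms :: "('a \<Rightarrow> real) set \<Rightarrow> ('x \<Rightarrow> 'x \<Rightarrow> 'a) \<Rightarrow> ('x \<Rightarrow> real) set" where
  "hnorms S ip = (\<lambda>p. hnorm p ip) ` S"

definition hilbert_module ::
  "(complex \<Rightarrow> 'a::ring \<Rightarrow> 'a) \<Rightarrow> ('a \<Rightarrow> 'a) \<Rightarrow> ('a \<Rightarrow> real) set \<Rightarrow>
   (complex \<Rightarrow> 'x::ab_group_add \<Rightarrow> 'x) \<Rightarrow> ('a \<Rightarrow> 'x \<Rightarrow> 'x) \<Rightarrow> ('x \<Rightarrow> 'x \<Rightarrow> 'a) \<Rightarrow> bool" where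
  "hilbert_module sm st S smx act ip \<longleftrightarrow>
     pro_cstar_algebra sm st S \<and>
     vector_space smx \<and>
     (\<forall>a b x. act (a * b) x = act a (act b x)) \<and>
     (\<forall>a b x. act (a + b) x = act a x + act b x) \<and>
     (\<forall>a x y. act a (x + y) = act a x + act a y) \<and>
     (\<forall>c a x. smx c (act a x) = act (sm c a) x \<and> smx c (act a x) = act a (smx c x)) \<and>
     (\<forall>x y z. ip (x + y) z = ip x z + ip y z) \<and>
     (\<forall>c x y. ip (smx c x) y = sm c (ip x y)) \<and>
     (\<forall>a x y. ip (act a x) y = a * ip x y) \<and>
     (\<forall>x y. st (ip x y) = ip y x) \<and>
     (\<forall>x. positive st (ip x x)) \<and>
     (\<forall>x. ip x x = 0 \<longrightarrow> x = 0) \<and>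
     sn_complete (hnorms S ip)"

definition module_map ::
  "(complex \<Rightarrow> 'x::ab_group_add \<Rightarrow> 'x) \<Rightarrow> ('a \<Rightarrow> 'x \<Rightarrow> 'x) \<Rightarrow> ('x \<Rightarrow> 'x) \<Rightarrow> bool" where
  "module_map smx act T \<longleftrightarrow>
     (\<forall>x y. T (x + y) = T x + T y) \<and>
     (\<forall>c x. T (smx c x) = smx c (T x)) \<and>
     (\<forall>a x. T (act a x) = act a (T x))"

definition bounded_op :: "('a \<Rightarrow> real) set \<Rightarrow> ('x \<Rightarrow> 'x \<Rightarrow> 'a) \<Rightarrow> ('x \<Rightarrow> 'x) \<Rightarrow> bool" where
  "bounded_op S ip T \<longleftrightarrow>
     (\<forall>p\<in>S. \<exists>C. \<forall>x. hnorm p ip (T x) \<le> C * hnorm p ip x)"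

definition adjointable :: "('x \<Rightarrow> 'x \<Rightarrow> 'a) \<Rightarrow> ('x \<Rightarrow> 'x) \<Rightarrow> bool" where
  "adjointable ip T \<longleftrightarrow> (\<exists>T'. \<forall>x y. ip (T x) y = ip x (T' y))"

text \<open>The adjoint (unique, since the inner product is definite).\<close>
definition adj :: "('x \<Rightarrow> 'x \<Rightarrow> 'a) \<Rightarrow> ('x \<Rightarrow> 'x) \<Rightarrow> ('x \<Rightarrow> 'x)" where
  "adj ip T = (THE T'. \<forall>x y. ip (T x) y = ip x (T' y))"

definition hom_star ::
  "('a \<Rightarrow> real) set \<Rightarrow> (complex \<Rightarrow> 'x::ab_group_add \<Rightarrow> 'x) \<Rightarrow> ('a \<Rightarrow> 'x \<Rightarrow> 'x) \<Rightarrow>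
   ('x \<Rightarrow> 'x \<Rightarrow> 'a) \<Rightarrow> ('x \<Rightarrow> 'x) \<Rightarrow> bool" where
  "hom_star S smx act ip T \<longleftrightarrow>
     module_map smx act T \<and> bounded_op S ip T \<and> adjointable ip T"

definition unif_bounded :: "('a \<Rightarrow> real) set \<Rightarrow> ('x \<Rightarrow> 'x \<Rightarrow> 'a) \<Rightarrow> ('x \<Rightarrow> 'x) \<Rightarrow> bool" where
  "unif_bounded S ip T \<longleftrightarrow>
     (\<exists>C>0. \<forall>p\<in>S. \<forall>x. hnorm p ip (T x) \<le> C * hnorm p ip x)"

definition invertible_hom ::
  "('a \<Rightarrow> real) set \<Rightarrow> (complex \<Rightarrow> 'x::ab_group_add \<Rightarrow> 'x) \<Rightarrow> ('a \<Rightarrow> 'x \<Rightarrow> 'x) \<Rightarrow>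
   ('x \<Rightarrow> 'x \<Rightarrow> 'a) \<Rightarrow> ('x \<Rightarrow> 'x) \<Rightarrow> bool" where
  "invertible_hom S smx act ip T \<longleftrightarrow>
     (\<exists>R. hom_star S smx act ip R \<and> (\<forall>x. R (T x) = x) \<and> (\<forall>x. T (R x) = x))"

definition kframe ::
  "(complex \<Rightarrow> 'a::ring \<Rightarrow> 'a) \<Rightarrow> ('a \<Rightarrow> 'a) \<Rightarrow> ('a \<Rightarrow> real) set \<Rightarrow>
   ('x \<Rightarrow> 'x \<Rightarrow> 'a) \<Rightarrow> ('x \<Rightarrow> 'x) \<Rightarrow> 'i set \<Rightarrow> ('i \<Rightarrow> 'x) \<Rightarrow> bool" where
  "kframe sm st S ip K I f \<longleftrightarrow>
     countable I \<and>
     (\<exists>A B. A > 0 \<and> B > 0 \<and>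
        (\<forall>x. \<exists>s. sn_has_sum S (\<lambda>i. ip x (f i) * ip (f i) x) I s \<and>
               cle st (sm (complex_of_real A) (ip (adj ip K x) (adj ip K x))) s \<and>
               cle st s (sm (complex_of_real B) (ip x x))))"

end

theory Submission
  imports Defs "HOL-Computational_Algebra.Polynomial" "HOL-Real_Asymp.Real_Asymp"
begin

text \<open>
  The lower frame bounds and the density of \<open>Ran K\<close> make \<open>T\<close> and \<open>T\<^sup>*\<close> injective, since
  \<open>\<langle>K\<^sup>* x, K\<^sup>* x\<rangle> \<le> 0\<close> forces \<open>K\<^sup>* x = 0\<close>. Let \<open>h = T\<^sup>* T\<close>. If the spectrum of \<open>h\<close> accumulated at \<open>0\<close> in some
  seminorm, a gliding hump would produce an element in the closure of \<open>Ran T\<close> outside \<open>Ran T\<close>; hence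
  \<open>0\<close> is at most isolated there, and then \<open>(1 - h\<^sup>2 / r\<^sup>2)\<^sup>n\<close> converges to a projection onto \<open>ker h = 0\<close>. So
  \<open>h\<close> is bounded below and onto, and injectivity of \<open>T\<^sup>*\<close> gives \<open>Ran T = X\<close>. The open mapping theorem is not
  available because the topology need not be metrizable.

  The order of a pro-C*-algebra is accessed one seminorm at a time and without completing: a
  C*-seminorm induces one on the polynomials in a selfadjoint element, where Chebyshev expansions
  and the identity \<open>\<parallel>f\<parallel>\<^sup>n = \<parallel>f\<^sup>n\<parallel>\<close> give von Neumann's inequality.
\<close>

section \<open>C*-seminorms on polynomials\<close>

text \<open>Closedness of the range is a statement about all seminorms at once, while the failure of
  a spectral gap is seen by a single seminorm and yields vectors that may be huge in the others. The
  bridge is the module action: with \<open>a = \<delta> \<langle>x, x\<rangle>\<close> and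
  \<open>c = a (1 + a)^-1\<close>, the vector \<open>(1 - c) x\<close> is bounded by one constant in
  every seminorm, and this truncation commutes with every module map, in particular with
  \<open>T\<^sup>* T\<close>. This is what calls for order theory in the algebra:
  \<open>1 + a\<close> has to be inverted without a unit at hand, for \<open>a\<close> positive in
  the sense \<open>b\<^sup>* b\<close>, and that such an \<open>a\<close> has no negative spectrum
  is Kaplansky's theorem. The uniform bound on \<open>T\<close> supplies the second uniformity, a
  single interval \<open>[-r, r]\<close> on which the same polynomials in \<open>T\<^sup>* T\<close>
  are controlled in all seminorms simultaneously.\<close>

lemma power_growth_imp_le:
  fixes a b :: real
  assumes "0 \<le> a" "0 < b" and le: "\<And>j. a ^ (2 ^ j) \<le> (\<alpha> + \<beta> * 2 ^ j) * b ^ (2 ^ j)"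
  shows "a \<le> b"
proof (rule ccontr)
  assume "\<not> a \<le> b"
  define x where "x = a / b"
  have x: "x > 1" using \<open>\<not> a \<le> b\<close> assms by (simp add: x_def)
  have "x ^ (2 ^ j) \<le> \<alpha> + \<beta> * 2 ^ j" for j
    using le[of j] assms(2) by (simp add: x_def power_divide field_simps)
  moreover have "LIM j sequentially. (x ^ (2 ^ j) - (\<alpha> + \<beta> * 2 ^ j)) :> at_top"
  proof -
    have 1: "LIM n sequentially. (x ^ n - (\<alpha> + \<beta> * real n)) :> at_top"
      using x by real_asymp
    have 2: "filterlim (\<lambda>j. 2 ^ j :: nat) sequentially sequentially"
      by (rule filterlim_subseq) (simp add: strict_mono_def)
    show ?thesis using filterlim_compose[OF 1 2] by simp
  qed
  then have "eventually (\<lambda>j. 0 < x ^ (2 ^ j) - (\<alpha> + \<beta> * 2 ^ j)) sequentially"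
    by (simp only: filterlim_at_top_dense)
  ultimately show False
    by (auto simp: not_less[symmetric] dest: eventually_happens)
qed

text \<open>The last condition is the C*-identity for \<open>f + \<i> g\<close> without complex
  coefficients: it combines \<open>||f + \<i> g||^2 = ||f^2 + g^2||\<close> with the fact that
  \<open>f\<close> is the mean of \<open>f + \<i> g\<close> and \<open>f - \<i> g\<close>.\<close>

locale poly_cstar =
  fixes N :: "real poly \<Rightarrow> real"
  assumes N_nonneg: "0 \<le> N f"
    and N_add: "N (f + g) \<le> N f + N g"
    and N_smult: "N (smult c f) \<le> \<bar>c\<bar> * N f"
    and N_mult: "N (f * g) \<le> N f * N g"
    and N_one: "N 1 \<le> 1"
    and N_sumsq: "(N f)\<^sup>2 \<le> N (f\<^sup>2 + g\<^sup>2)"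
begin

lemma N_zero [simp]: "N 0 = 0"
  using N_smult[of 0 0] N_nonneg[of 0] by simp

lemma N_minus [simp]: "N (- f) = N f"
  using N_smult[of "-1" f] N_smult[of "-1" "-f"] by simp

lemma N_diff: "N (f - g) \<le> N f + N g"
  using N_add[of f "-g"] by simp

lemma N_power: "N (f ^ n) \<le> N f ^ n"
proof (induction n)
  case (Suc n)
  then show ?case using N_mult[of f "f ^ n"] mult_left_mono[OF Suc N_nonneg[of f]] by simp
qed (simp add: N_one)

lemma N_sum: "N (sum f A) \<le> (\<Sum>i\<in>A. N (f i))"
proof (induction A rule: infinite_finite_induct)
  case (insert x F)
  then show ?case using N_add[of "f x" "sum f F"] by simp
qed auto

lemma N_const: "N [:c:] \<le> \<bar>c\<bar>"
proof -
  have "N [:c:] \<le> \<bar>c\<bar> * N 1" using N_smult[of c 1] by (simp add: one_pCons)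
  also have "\<dots> \<le> \<bar>c\<bar> * 1" by (intro mult_left_mono N_one) auto
  finally show ?thesis by simp
qed

lemma N_le_sumsq: "N f \<le> sqrt (N (f\<^sup>2 + g\<^sup>2))"
  using N_sumsq by (simp add: real_le_rsqrt)

lemma N_pow2: "N f ^ (2 ^ j) \<le> N (f ^ (2 ^ j))"
proof (induction j)
  case (Suc j)
  have "N f ^ (2 ^ Suc j) = (N f ^ (2 ^ j))\<^sup>2" by (simp add: power_mult[symmetric] mult.commute)
  also have "\<dots> \<le> (N (f ^ 2 ^ j))\<^sup>2" by (intro power_mono Suc) (simp add: N_nonneg)
  also have "\<dots> \<le> N ((f ^ 2 ^ j)\<^sup>2)" using N_sumsq[of "f ^ 2 ^ j" 0] by simp
  also have "(f ^ 2 ^ j)\<^sup>2 = f ^ (2 ^ Suc j)" by (simp add: power_mult[symmetric] mult.commute)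
  finally show ?case .
qed simp

text \<open>The iteration \<open>w \<mapsto> (y + w\<^sup>2) / 2\<close> contracts to \<open>1 - \<surd>(1 - y)\<close>.\<close>
lemma sqrt_one_minus_approx:
  assumes y: "N y < 1" and e: "e > 0"
  shows "\<exists>w. N (w\<^sup>2 - (1 - y)) \<le> e"
proof -
  define W where "W = rec_nat 0 (\<lambda>_ w. smult (1/2) (y + w\<^sup>2))"
  have W0: "W 0 = 0" and WS: "W (Suc k) = smult (1/2) (y + (W k)\<^sup>2)" for k
    by (simp_all add: W_def)
  \<comment> \<open>The smaller root of \<open>s = (N y + s^2) / 2\<close>. It bounds all iterates
    and, being below \<open>1\<close>, is also the contraction factor, since the sum of two iterates
    has norm at most \<open>2 s\<close>.\<close>
  define s where "s = 1 - sqrt (1 - N y)"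
  have s: "0 \<le> s" "s < 1" "N y + s\<^sup>2 = 2 * s"
    using y N_nonneg[of y] by (auto simp: s_def power2_diff)
  have Wb: "N (W k) \<le> s" for k
  proof (induction k)
    case (Suc k)
    have "N (W (Suc k)) \<le> 1/2 * N (y + (W k)\<^sup>2)" unfolding WS using N_smult[of "1/2"] by simp
    also have "\<dots> \<le> 1/2 * (N y + N (W k) ^ 2)" using N_add[of y] N_power[of "W k" 2] by (meson add_left_mono mult_left_mono order_trans zero_le_divide_1_iff zero_le_numeral)
    also have "\<dots> \<le> 1/2 * (N y + s ^ 2)"
      using power_mono[OF Suc N_nonneg, of 2] by simp
    finally show ?case using s by simp
  qed (simp add: W0 s)
  have D: "N (W (Suc k) - W k) \<le> s ^ k * N (W 1 - W 0)" for k
  proof (induction k)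
    case (Suc k)
    have "W (Suc (Suc k)) - W (Suc k) = smult (1/2) ((W (Suc k) - W k) * (W (Suc k) + W k))"
      by (simp only: WS[of "Suc k"] WS[of k] smult_diff_right[symmetric]) (simp add: WS power2_eq_square algebra_simps)
    then have "N (W (Suc (Suc k)) - W (Suc k)) \<le> 1/2 * N ((W (Suc k) - W k) * (W (Suc k) + W k))"
      using N_smult[of "1/2"] by simp
    also have "\<dots> \<le> 1/2 * (N (W (Suc k) - W k) * N (W (Suc k) + W k))"
      using N_mult by simp
    also have "\<dots> \<le> 1/2 * (N (W (Suc k) - W k) * (2 * s))"
      using N_add[of "W (Suc k)" "W k"] Wb[of k] Wb[of "Suc k"] N_nonneg
      by (intro mult_left_mono) (auto simp: N_nonneg)
    also have "\<dots> \<le> s * (s ^ k * N (W 1 - W 0))"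
      using mult_left_mono[OF Suc s(1)] by (simp add: mult.commute)
    finally show ?case by simp
  qed simp
  have "(\<lambda>k. 2 * (s ^ k * N (W 1 - W 0))) \<longlonglongrightarrow> 2 * (0 * N (W 1 - W 0))"
    using s by (intro tendsto_intros LIMSEQ_power_zero) auto
  then have "eventually (\<lambda>k. 2 * (s ^ k * N (W 1 - W 0)) < e) sequentially"
    using e by (intro order_tendstoD) auto
  then obtain k where k: "2 * (s ^ k * N (W 1 - W 0)) < e"
    by (auto simp: eventually_sequentially)
  \<comment> \<open>The residual of the square root is twice the increment of the iteration, so a
    late iterate suffices and no limit is taken.\<close>
  have "(1 - W k)\<^sup>2 - (1 - y) = smult 2 (W (Suc k) - W k)"
  proof -
    have 2: "smult 2 (W k) = 2 * W k" by (simp add: numeral_poly)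
    show ?thesis by (simp add: WS smult_diff_right 2 power2_eq_square algebra_simps)
  qed
  then have "N ((1 - W k)\<^sup>2 - (1 - y)) \<le> 2 * N (W (Suc k) - W k)"
    using N_smult[of 2] by simp
  with D[of k] k show ?thesis by (intro exI[of _ "1 - W k"]) linarith
qed

end

section \<open>Chebyshev polynomials under a C*-seminorm\<close>

fun cheb :: "nat \<Rightarrow> real poly" where
  "cheb 0 = 1"
| "cheb (Suc 0) = [:0, 1:]"
| "cheb (Suc (Suc k)) = [:0, 2:] * cheb (Suc k) - cheb k"

lemma poly_cheb_cos: "poly (cheb k) (cos t) = cos (real k * t)"
proof (induction k rule: cheb.induct)
  case (3 k)
  have "cos (real (Suc (Suc k)) * t) + cos (real k * t) = 2 * cos t * cos (real (Suc k) * t)"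
    using cos_plus_cos[of "real (Suc (Suc k)) * t" "real k * t"]
    by (simp add: algebra_simps add_divide_distrib)
  with 3 show ?case by simp
qed auto

text \<open>\<open>cheb_re w k\<close> and \<open>cheb_im w k\<close> are the real and imaginary parts of \<open>(x + \<i> w)\<^sup>k\<close>.\<close>
fun cheb_re cheb_im :: "real poly \<Rightarrow> nat \<Rightarrow> real poly" where
  "cheb_re w 0 = 1"
| "cheb_re w (Suc k) = [:0, 1:] * cheb_re w k - w * cheb_im w k"
| "cheb_im w 0 = 0"
| "cheb_im w (Suc k) = w * cheb_re w k + [:0, 1:] * cheb_im w k"

lemma cheb_re_im_sumsq: "(cheb_re w k)\<^sup>2 + (cheb_im w k)\<^sup>2 = ([:0, 1:]\<^sup>2 + w\<^sup>2) ^ k"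
proof (induction k)
  case (Suc k)
  define x :: "real poly" where "x = [:0, 1:]"
  have "(x * a - w * b)\<^sup>2 + (w * a + x * b)\<^sup>2 = (x\<^sup>2 + w\<^sup>2) * (a\<^sup>2 + b\<^sup>2)" for a b
    by (simp add: power2_eq_square algebra_simps)
  then show ?case using Suc by (simp flip: x_def)
qed simp

lemma cheb_re_rec:
  "cheb_re w (Suc (Suc k)) = [:0, 2:] * cheb_re w (Suc k) - ([:0, 1:]\<^sup>2 + w\<^sup>2) * cheb_re w k"
proof -
  define x :: "real poly" where "x = [:0, 1:]"
  have 2: "[:0, 2:] = 2 * x" by (simp add: x_def numeral_poly)
  show ?thesis unfolding cheb_re.simps cheb_im.simps 2 x_def[symmetric]
    by (simp add: power2_eq_square algebra_simps)
qed

context poly_cstar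
begin

text \<open>\<open>cheb k\<close> is the real part of \<open>(x + \<i> sqrt (1 - x^2))^k\<close>.
  With a polynomial \<open>w\<close> in place of the root, \<open>E = x^2 + w^2\<close> is within
  \<open>e\<close> of \<open>1\<close>, and \<open>N_sumsq\<close> bounds the real part by
  \<open>sqrt (N (E ^ k))\<close>. For fixed \<open>k\<close>, the error of replacing the root is of
  order \<open>e\<close>.\<close>

lemma N_cheb:
  assumes X: "N [:0, 1:] < 1"
  shows "N (cheb k) \<le> 1"
proof -
  let ?X = "[:0, 1:] :: real poly"
  have NX2: "N [:0, 2:] \<le> 2" using N_smult[of 2 ?X] X by simp
  have *: "N (cheb k) \<le> sqrt ((1 + e) ^ k) + e * 8 ^ k" if e: "0 < e" "e \<le> 1" for e
  proof -
    have "N (?X\<^sup>2) < 1"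
      using N_power[of ?X 2] power_strict_mono[OF X N_nonneg, of 2] by simp
    then obtain w where w: "N (w\<^sup>2 - (1 - ?X\<^sup>2)) \<le> e"
      using sqrt_one_minus_approx e by blast
    define E where "E = ?X\<^sup>2 + w\<^sup>2"
    have E1: "N (E - 1) \<le> e" using w by (simp add: E_def algebra_simps)
    have E: "N E \<le> 1 + e" using N_add[of "E - 1" 1] E1 N_one by simp
    have C: "N (cheb_re w k) \<le> sqrt ((1 + e) ^ k)" for k
    proof -
      have "N (cheb_re w k) \<le> sqrt (N (E ^ k))"
        using N_le_sumsq[of "cheb_re w k" "cheb_im w k"] by (simp add: cheb_re_im_sumsq E_def)
      also have "N (E ^ k) \<le> (1 + e) ^ k"
        using N_power[of E k] power_mono[OF E N_nonneg, of k] by simp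
      finally show ?thesis by simp
    qed
    have C2: "N (cheb_re w k) \<le> 2 ^ k" for k
    proof -
      have "sqrt ((1 + e) ^ k) \<le> sqrt ((2\<^sup>2) ^ k)"
        using e by (intro real_sqrt_le_mono power_mono) auto
      also have "\<dots> = 2 ^ k" by (simp add: real_sqrt_power)
      finally show ?thesis using C[of k] by simp
    qed
    \<comment> \<open>The two recursions differ only by \<open>(E - 1) * cheb_re w k\<close>. The
      base \<open>8\<close> is generous: the induction needs
      \<open>2 * 8 + 1 + 1 \<le> 8^2\<close>.\<close>
    have D: "N (cheb_re w k - cheb k) \<le> e * 8 ^ k" for k
    proof (induction k rule: cheb.induct)
      case (3 k)
      have "cheb_re w (Suc (Suc k)) - cheb (Suc (Suc k)) =
        [:0, 2:] * (cheb_re w (Suc k) - cheb (Suc k)) - (cheb_re w k - cheb k) - (E - 1) * cheb_re w k"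
        unfolding cheb_re_rec E_def[symmetric] by (simp add: algebra_simps del: mult_pCons_left mult_pCons_right smult_diff_right)
      then have "N (cheb_re w (Suc (Suc k)) - cheb (Suc (Suc k))) \<le>
         N [:0, 2:] * N (cheb_re w (Suc k) - cheb (Suc k)) + N (cheb_re w k - cheb k) + N (E - 1) * N (cheb_re w k)"
        by (simp only: order_trans[OF N_diff add_mono[OF order_trans[OF N_diff add_mono[OF N_mult order_refl]] N_mult]])
      also have "\<dots> \<le> 2 * (e * 8 ^ Suc k) + e * 8 ^ k + e * 2 ^ k"
        using 3 NX2 E1 C2 e by (intro add_mono mult_mono) (auto simp: N_nonneg)
      also have "\<dots> \<le> 2 * (e * 8 ^ Suc k) + e * 8 ^ k + e * 8 ^ k"
        using e by (intro add_mono mult_left_mono power_mono) auto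
      also have "\<dots> \<le> e * 8 ^ Suc (Suc k)" using e by simp
      finally show ?case .
    qed (use e in auto)
    show ?thesis using N_diff[of "cheb_re w k" "cheb_re w k - cheb k"] C[of k] D[of k] by simp
  qed
  have "((\<lambda>e. sqrt ((1 + e) ^ k) + e * 8 ^ k) \<longlongrightarrow> sqrt ((1 + 0) ^ k) + 0 * 8 ^ k) (at_right 0)"
    by (intro tendsto_intros)
  moreover have "eventually (\<lambda>e. N (cheb k) \<le> sqrt ((1 + e) ^ k) + e * 8 ^ k) (at_right 0)"
    unfolding eventually_at_right[OF zero_less_one] using * by (intro exI[of _ 1]) auto
  ultimately have "N (cheb k) \<le> sqrt ((1 + 0) ^ k) + 0 * 8 ^ k"
    by (intro tendsto_lowerbound) (auto simp: trivial_limit_at_right_real)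
  then show ?thesis by simp
qed

end

section \<open>Chebyshev coefficients and the supremum on the interval\<close>

lemma sum_cos_multiples:
  fixes m :: int and n :: nat
  assumes n: "n > 0"
  shows "(\<Sum>j<n. cos (of_int m * (2 * pi * real j / real n))) = (if int n dvd m then real n else 0)"
proof -
  define z where "z = cis (of_int m * (2 * pi / real n))"
  have zj: "z ^ j = cis (of_int m * (2 * pi * real j / real n))" for j
    unfolding z_def Complex.DeMoivre by (rule arg_cong[where f = cis]) (simp add: mult_ac)
  have sum: "(\<Sum>j<n. cos (of_int m * (2 * pi * real j / real n))) = Re (\<Sum>j<n. z ^ j)"
    by (simp add: zj)
  show ?thesis
  proof (cases "int n dvd m")
    case True
    then obtain l where "m = int n * l" by auto
    then have "z = cis (2 * pi * of_int l)" using n by (simp add: z_def mult_ac)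
    then have "z = 1" by (simp add: complex_eq_iff)
    then show ?thesis using True sum by simp
  next
    case False
    have zn: "z ^ n = 1" using n unfolding zj by (simp add: complex_eq_iff mult.commute[of _ "2 * pi"])
    have "z \<noteq> 1"
    proof
      assume "z = 1"
      then have "cos (of_int m * (2 * pi / real n)) = 1" by (simp add: z_def complex_eq_iff)
      then obtain l :: int where "of_int m * (2 * pi / real n) = of_int l * 2 * pi"
        by (auto simp: cos_one_2pi_int)
      then have "real_of_int m = of_int (l * int n)" using n by (simp add: field_simps)
      then have "m = l * int n" by linarith
      with False show False by simp
    qed
    then have "(\<Sum>j<n. z ^ j) = 0" using geometric_sum[of z n] zn by simp
    then show ?thesis using False sum by simp
  qed
qed

lemma cheb_span: "\<exists>a. q = (\<Sum>k\<le>degree q. smult (a k) (cheb k))"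
proof -
  have deg: "degree (cheb k) = k \<and> lead_coeff (cheb k) > 0" for k
  proof (induction k rule: cheb.induct)
    case (3 k)
    have nz: "cheb (Suc k) \<noteq> 0" using 3 by force
    have d: "degree ([:0, 2:] * cheb (Suc k)) = Suc (Suc k)"
      using 3 nz by (subst degree_mult_eq) auto
    then have dd: "degree (cheb (Suc (Suc k))) = Suc (Suc k)"
      unfolding cheb.simps diff_conv_add_uminus using 3 by (subst degree_add_eq_left) auto
    have "coeff (cheb (Suc (Suc k))) (Suc (Suc k)) = 2 * coeff (cheb (Suc k)) (Suc k)"
      using 3 by (simp add: coeff_eq_0)
    then show ?case using 3 dd by auto
  qed auto
  have "degree q \<le> n \<Longrightarrow> \<exists>a. q = (\<Sum>k\<le>n. smult (a k) (cheb k))" for n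
  proof (induction n arbitrary: q)
    case 0
    then obtain c where "q = [:c:]" by (auto dest: degree_eq_zeroE)
    then show ?case by (intro exI[of _ "\<lambda>_. c"]) (simp add: one_pCons)
  next
    case (Suc n)
    define c where "c = coeff q (Suc n) / lead_coeff (cheb (Suc n))"
    have "degree (q - smult c (cheb (Suc n))) \<le> n"
    proof (rule degree_le, intro allI impI)
      fix i assume i: "n < i"
      show "coeff (q - smult c (cheb (Suc n))) i = 0"
      proof (cases "i = Suc n")
        case True
        then show ?thesis using deg[of "Suc n"] by (auto simp: c_def)
      next
        case False
        then have "i > Suc n" using i by simp
        then show ?thesis using Suc.prems deg[of "Suc n"] by (simp add: coeff_eq_0)
      qed
    qed
    then obtain a where a: "q - smult c (cheb (Suc n)) = (\<Sum>k\<le>n. smult (a k) (cheb k))"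
      using Suc.IH by blast
    have "(\<Sum>k\<le>n. smult ((a(Suc n := c)) k) (cheb k)) = (\<Sum>k\<le>n. smult (a k) (cheb k))"
      by (rule sum.cong) auto
    then have "q = (\<Sum>k\<le>Suc n. smult ((a(Suc n := c)) k) (cheb k))"
      using a by (simp add: algebra_simps)
    then show ?case by blast
  qed
  then show ?thesis by blast
qed

text \<open>Discrete orthogonality of the cosines at the \<open>n\<close>-th roots of unity, \<open>n > 2 d\<close>.\<close>
lemma cheb_coeff_bound:
  assumes q: "q = (\<Sum>k\<le>d. smult (a k) (cheb k))" and l: "l \<le> d"
    and M: "\<And>x. \<bar>x\<bar> \<le> 1 \<Longrightarrow> \<bar>poly q x\<bar> \<le> M"
  shows "\<bar>a l\<bar> \<le> 2 * M"
proof -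
  define n where "n = 2 * d + 1"
  define t where "t j = 2 * pi * real j / real n" for j
  have n: "n > 0" by (simp add: n_def)
  have ort: "(\<Sum>j<n. cos (real k * t j) * cos (real l * t j)) =
      (if k = l then (if l = 0 then real n else real n / 2) else 0)" if k: "k \<le> d" for k
  proof -
    have "(\<Sum>j<n. cos (real k * t j) * cos (real l * t j)) =
       (\<Sum>j<n. (cos (of_int (int k - int l) * t j) + cos (of_int (int k + int l) * t j)) / 2)"
      by (simp add: cos_times_cos algebra_simps)
    also have "\<dots> = ((\<Sum>j<n. cos (of_int (int k - int l) * t j)) + (\<Sum>j<n. cos (of_int (int k + int l) * t j))) / 2"
      by (simp only: sum_divide_distrib[symmetric] sum.distrib)
    also have "\<dots> = ((if int n dvd int k - int l then real n else 0) + (if int n dvd int k + int l then real n else 0)) / 2"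
      unfolding t_def sum_cos_multiples[OF n] ..
    also have "int n dvd int k - int l \<longleftrightarrow> k = l"
    proof
      assume "int n dvd int k - int l"
      then have "int k - int l = 0 \<or> int n \<le> \<bar>int k - int l\<bar>"
        using zdvd_imp_le[of "int n" "\<bar>int k - int l\<bar>"] by fastforce
      then show "k = l" using k l by (auto simp: n_def)
    qed auto
    also have "int n dvd int k + int l \<longleftrightarrow> k = 0 \<and> l = 0"
    proof
      assume "int n dvd int k + int l"
      then have "int k + int l = 0 \<or> int n \<le> int k + int l"
        using zdvd_imp_le[of "int n" "int k + int l"] by fastforce
      then show "k = 0 \<and> l = 0" using k l by (auto simp: n_def)
    qed auto
    finally show ?thesis by auto
  qed
  have "(\<Sum>j<n. poly q (cos (t j)) * cos (real l * t j)) =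
      (\<Sum>j<n. \<Sum>k\<le>d. a k * (cos (real k * t j) * cos (real l * t j)))"
    by (simp add: q poly_sum poly_cheb_cos sum_distrib_right mult.assoc)
  also have "\<dots> = (\<Sum>k\<le>d. a k * (\<Sum>j<n. cos (real k * t j) * cos (real l * t j)))"
    by (subst sum.swap) (simp add: sum_distrib_left)
  also have "\<dots> = (\<Sum>k\<le>d. a k * (if k = l then (if l = 0 then real n else real n / 2) else 0))"
    using ort by (intro sum.cong) auto
  also have "\<dots> = a l * (if l = 0 then real n else real n / 2)"
    using l by (simp add: if_distrib cong: if_cong)
  finally have eq: "a l * (if l = 0 then real n else real n / 2) = (\<Sum>j<n. poly q (cos (t j)) * cos (real l * t j))"
    by simp
  have "\<bar>\<Sum>j<n. poly q (cos (t j)) * cos (real l * t j)\<bar> \<le> (\<Sum>j<n. \<bar>poly q (cos (t j)) * cos (real l * t j)\<bar>)"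
    by (rule sum_abs)
  also have "\<dots> \<le> (\<Sum>j<n. M * 1)"
    unfolding abs_mult using M by (intro sum_mono mult_mono) (auto intro: order_trans[OF abs_ge_zero M[of 0]])
  finally have "\<bar>a l\<bar> * (if l = 0 then real n else real n / 2) \<le> real n * M"
    unfolding eq[symmetric] by (simp add: abs_mult)
  moreover have "\<bar>a l\<bar> * (real n / 2) \<le> \<bar>a l\<bar> * (if l = 0 then real n else real n / 2)"
    by (intro mult_left_mono) auto
  ultimately have "\<bar>a l\<bar> * (real n / 2) \<le> real n * M" by (rule order_trans[rotated])
  then have "\<bar>a l\<bar> * (real n / 2) \<le> (2 * M) * (real n / 2)" by (simp add: mult.commute)
  then show ?thesis using n by (simp add: mult_le_cancel_right)
qed

text \<open>Weierstrass approximation of \<open>sqrt (poly F x)\<close>. It turns nonnegativity on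
  an interval into being a square up to \<open>e\<close>, which is the form in which
  \<open>N_sumsq\<close> and positivity in the algebra can use it.\<close>

lemma poly_sqrt_approx:
  fixes F :: "real poly"
  assumes F: "\<And>x. \<bar>x\<bar> \<le> r \<Longrightarrow> 0 \<le> poly F x" and e: "e > 0"
  shows "\<exists>g. \<forall>x. \<bar>x\<bar> \<le> r \<longrightarrow> \<bar>(poly g x)\<^sup>2 - poly F x\<bar> \<le> e"
proof -
  let ?I = "{-r..r}"
  have cont: "continuous_on ?I (\<lambda>x. sqrt (poly F x))" by (intro continuous_intros)
  have "compact ((\<lambda>x. sqrt (poly F x)) ` ?I)" by (rule compact_continuous_image[OF cont]) simp
  then obtain B where "\<And>x. x \<in> ?I \<Longrightarrow> norm (sqrt (poly F x)) \<le> B"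
    by (metis compact_imp_bounded bounded_iff image_eqI)
  then have B: "\<And>x. x \<in> ?I \<Longrightarrow> sqrt (poly F x) \<le> \<bar>B\<bar>" by fastforce
  define d where "d = min 1 (e / (2 * \<bar>B\<bar> + 1))"
  have d: "d > 0" "d \<le> 1" "d \<le> e / (2 * \<bar>B\<bar> + 1)" using e by (auto simp: d_def)
  have dB: "d * (2 * \<bar>B\<bar> + 1) \<le> e" using d(3) by (subst (asm) pos_le_divide_eq) auto
  obtain g0 where g0: "real_polynomial_function g0" "\<And>x. x \<in> ?I \<Longrightarrow> \<bar>sqrt (poly F x) - g0 x\<bar> < d"
    using Stone_Weierstrass_real_polynomial_function[OF _ cont d(1)] by auto
  obtain a n where g0eq: "g0 = (\<lambda>x. \<Sum>i\<le>n. a i * x ^ i)"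
    using g0(1) unfolding real_polynomial_function_iff_sum by blast
  define g where "g = (\<Sum>i\<le>n. monom (a i) i)"
  have g: "poly g x = g0 x" for x by (simp add: g_def g0eq poly_sum poly_monom)
  have "\<bar>(poly g x)\<^sup>2 - poly F x\<bar> \<le> e" if x: "\<bar>x\<bar> \<le> r" for x
  proof -
    define s where "s = sqrt (poly F x)"
    have s: "s\<^sup>2 = poly F x" "0 \<le> s" "s \<le> \<bar>B\<bar>" using F[OF x] B[of x] x by (auto simp: s_def abs_le_iff)
    have gd: "\<bar>poly g x - s\<bar> \<le> d" using g0(2)[of x] x unfolding g s_def by (subst abs_minus_commute) (simp add: abs_le_iff[of x] less_imp_le)
    have "(poly g x)\<^sup>2 - poly F x = (poly g x - s) * (poly g x + s)"
      by (simp add: s(1)[symmetric] power2_eq_square algebra_simps)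
    then have "\<bar>(poly g x)\<^sup>2 - poly F x\<bar> = \<bar>poly g x - s\<bar> * \<bar>poly g x + s\<bar>" by (simp add: abs_mult)
    also have "\<dots> \<le> d * (2 * \<bar>B\<bar> + 1)" using gd s d by (intro mult_mono) auto
    finally show ?thesis using dB by simp
  qed
  then show ?thesis by blast
qed

section \<open>Von Neumann's inequality and order estimates\<close>

context poly_cstar
begin

text \<open>The Chebyshev expansion loses a factor linear in the degree. Applied to
  \<open>q ^ (2 ^ j)\<close>, whose degree is linear in \<open>2 ^ j\<close>, this factor disappears
  on taking roots.\<close>

lemma N_le_sup_unit:
  assumes X: "N [:0, 1:] < 1" and M: "\<And>x. \<bar>x\<bar> \<le> 1 \<Longrightarrow> \<bar>poly q x\<bar> \<le> M"
  shows "N q \<le> M"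
proof -
  have lin: "N f \<le> (1 + real (degree f)) * (2 * L)" if "\<And>x. \<bar>x\<bar> \<le> 1 \<Longrightarrow> \<bar>poly f x\<bar> \<le> L" for f L
  proof -
    obtain a where a: "f = (\<Sum>k\<le>degree f. smult (a k) (cheb k))" using cheb_span by blast
    have "N f \<le> (\<Sum>k\<le>degree f. N (smult (a k) (cheb k)))" by (subst a) (rule N_sum)
    also have "\<dots> \<le> (\<Sum>k\<le>degree f. 2 * L)"
    proof (rule sum_mono)
      fix k assume k: "k \<in> {..degree f}"
      have "N (smult (a k) (cheb k)) \<le> \<bar>a k\<bar> * N (cheb k)" by (rule N_smult)
      also have "\<dots> \<le> \<bar>a k\<bar> * 1" by (intro mult_left_mono N_cheb X) auto
      also have "\<dots> \<le> 2 * L" using cheb_coeff_bound[OF a _ that, of k] k by simp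
      finally show "N (smult (a k) (cheb k)) \<le> 2 * L" .
    qed
    finally show ?thesis by simp
  qed
  \<comment> \<open>\<open>M\<close> may be \<open>0\<close>, whereas the comparison of growth rates
    needs a positive base.\<close>
  have "N q \<le> M + e" if "e > 0" for e
  proof (rule power_growth_imp_le[OF N_nonneg, where \<alpha> = 2 and \<beta> = "2 * real (degree q)"])
    have M0: "0 \<le> M" using M[of 0] by linarith
    then show "0 < M + e" using that by simp
    fix j :: nat
    have "N q ^ (2 ^ j) \<le> N (q ^ (2 ^ j))" by (rule N_pow2)
    also have "\<dots> \<le> (1 + real (degree (q ^ (2 ^ j)))) * (2 * M ^ (2 ^ j))"
      using M by (intro lin) (auto simp: power_abs intro: power_mono)
    also have "\<dots> \<le> (1 + real (degree q * 2 ^ j)) * (2 * (M + e) ^ (2 ^ j))"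
      using M0 that by (intro mult_mono add_mono power_mono) (auto simp: degree_power_le simp flip: of_nat_mult of_nat_power intro!: of_nat_mono)
    finally show "N q ^ (2 ^ j) \<le> (2 + 2 * real (degree q) * 2 ^ j) * (M + e) ^ (2 ^ j)"
      by (simp add: algebra_simps)
  qed
  then show ?thesis by (rule field_le_epsilon)
qed

theorem von_neumann_inequality:
  assumes r: "N [:0, 1:] < r" and M: "\<And>x. \<bar>x\<bar> \<le> r \<Longrightarrow> \<bar>poly q x\<bar> \<le> M"
  shows "N q \<le> M"
proof -
  have r0: "r > 0" using r N_nonneg[of "[:0, 1:]"] by linarith
  \<comment> \<open>Substituting \<open>x / r\<close> for \<open>x\<close> makes the generator of
    norm below \<open>1\<close>, which is the case already settled.\<close>
  interpret R: poly_cstar "\<lambda>f. N (pcompose f [:0, 1 / r:])"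
    by unfold_locales
      (simp_all only: pcompose_add pcompose_smult pcompose_mult power2_eq_square pcompose_1 N_nonneg N_add N_smult N_mult N_one N_sumsq[unfolded power2_eq_square])
  have "N [:0, 1 / r:] \<le> 1 / r * N [:0, 1:]" using N_smult[of "1 / r" "[:0, 1:]"] r0 by simp
  also have "\<dots> < 1" using r r0 by (simp add: field_simps)
  finally have X: "N (pcompose [:0, 1:] [:0, 1 / r:]) < 1" by (simp add: pcompose_pCons)
  have "N (pcompose (pcompose q [:0, r:]) [:0, 1 / r:]) \<le> M"
  proof (rule R.N_le_sup_unit[OF X])
    fix x :: real assume "\<bar>x\<bar> \<le> 1"
    then have "\<bar>x * r\<bar> \<le> r" using r0 by (simp add: abs_mult)
    then show "\<bar>poly (pcompose q [:0, r:]) x\<bar> \<le> M" using M by (simp add: poly_pcompose)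
  qed
  moreover have "pcompose [:0, r:] [:0, 1 / r:] = [:0, 1:]"
    using r0 by (simp add: pcompose_pCons)
  then have "pcompose (pcompose q [:0, r:]) [:0, 1 / r:] = q"
    by (simp only: pcompose_assoc[symmetric] pcompose_idR)
  ultimately show ?thesis by simp
qed

text \<open>\<open>w^2 - u^2\<close> is nonnegative on the interval, hence nearly a square
  \<open>g^2\<close>, and \<open>N_sumsq\<close> compares \<open>u^2\<close> with
  \<open>u^2 + g^2\<close>, which is nearly \<open>w^2\<close>. Von Neumann's inequality measures
  the error.\<close>

lemma N_mono:
  assumes r: "N [:0, 1:] < r" and le: "\<And>x. \<bar>x\<bar> \<le> r \<Longrightarrow> \<bar>poly u x\<bar> \<le> \<bar>poly w x\<bar>"
  shows "N u \<le> N w"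
proof -
  have "(N u)\<^sup>2 \<le> (N w)\<^sup>2 + e" if e: "e > 0" for e
  proof -
    have "0 \<le> poly (w\<^sup>2 - u\<^sup>2) x" if "\<bar>x\<bar> \<le> r" for x
      using power_mono[OF le[OF that], of 2] by simp
    then obtain g where g: "\<And>x. \<bar>x\<bar> \<le> r \<Longrightarrow> \<bar>(poly g x)\<^sup>2 - poly (w\<^sup>2 - u\<^sup>2) x\<bar> \<le> e"
      using poly_sqrt_approx[of r "w\<^sup>2 - u\<^sup>2" e] e by auto
    have "(N u)\<^sup>2 \<le> N (u\<^sup>2 + g\<^sup>2)" by (rule N_sumsq)
    also have "\<dots> \<le> N (w\<^sup>2) + N (u\<^sup>2 + g\<^sup>2 - w\<^sup>2)" using N_add[of "w\<^sup>2" "u\<^sup>2 + g\<^sup>2 - w\<^sup>2"] by simp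
    also have "N (w\<^sup>2) \<le> (N w)\<^sup>2" by (rule N_power)
    also have "N (u\<^sup>2 + g\<^sup>2 - w\<^sup>2) \<le> e"
      using g by (intro von_neumann_inequality[OF r]) (force simp: algebra_simps)
    finally show ?thesis by simp
  qed
  then have "(N u)\<^sup>2 \<le> (N w)\<^sup>2" by (rule field_le_epsilon)
  then show ?thesis using N_nonneg by (simp add: power2_le_iff_abs_le)
qed

text \<open>Bernoulli's inequality bounds the negative part of \<open>u\<close> by \<open>(t - u)\<^sup>n / (n t\<^sup>n\<^sup>-\<^sup>1)\<close>.\<close>
lemma negative_part_negligible:
  assumes t: "t > 0" and u: "N ([:t:] - u) \<le> t" and e: "e > 0"
  obtains s where "N s \<le> e" "\<And>x. max 0 (- poly u x) \<le> poly s x"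
proof -
  have "(\<lambda>m. t / real (2 * Suc m)) \<longlonglongrightarrow> 0" by real_asymp
  then have "eventually (\<lambda>m. t / real (2 * Suc m) < e) sequentially"
    using e by (intro order_tendstoD) auto
  then obtain m where "t / real (2 * Suc m) < e"
    by (auto simp: eventually_sequentially)
  \<comment> \<open>An even exponent keeps the bounding power nonnegative also where
    \<open>u\<close> exceeds \<open>t\<close>.\<close>
  then obtain n where n: "even n" "n > 0" "t / real n < e"
    by (meson dvd_triv_left mult_pos_pos zero_less_Suc zero_less_numeral)
  define s where "s = smult (1 / (real n * t ^ (n - 1))) (([:t:] - u) ^ n)"
  have "N s \<le> 1 / (real n * t ^ (n - 1)) * N (([:t:] - u) ^ n)"
    unfolding s_def using N_smult[of "1 / (real n * t ^ (n - 1))"] t by simp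
  also have "\<dots> \<le> 1 / (real n * t ^ (n - 1)) * t ^ n"
    using t N_power[of "[:t:] - u" n] power_mono[OF u N_nonneg, of n]
    by (intro mult_left_mono) auto
  also have "\<dots> = t / real n" using n t by (cases n) auto
  finally have s: "N s \<le> e" using n by simp
  have "max 0 (- poly u x) \<le> poly s x" for x
  proof -
    define y where "y = poly u x"
    have "max 0 (- y) * (real n * t ^ (n - 1)) \<le> (t - y) ^ n"
    proof (cases "y \<ge> 0")
      case True
      then show ?thesis using n by (simp add: zero_le_even_power)
    next
      case False
      have "1 + real n * (- y / t) \<le> (1 + - y / t) ^ n"
        by (rule Bernoulli_inequality) (use False t in \<open>auto simp: field_simps\<close>)
      then have "t ^ n * (1 + real n * (- y / t)) \<le> t ^ n * (1 + - y / t) ^ n" using t by simp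
      also have "\<dots> = (t - y) ^ n" using t by (simp add: power_mult_distrib[symmetric] field_simps)
      also have "t ^ n * (1 + real n * (- y / t)) = t ^ n + (- y) * (real n * t ^ (n - 1))"
        using n t by (cases n) (auto simp: field_simps)
      finally show ?thesis using False t by (smt (verit) zero_less_power)
    qed
    then have "max 0 (- y) \<le> (t - y) ^ n / (real n * t ^ (n - 1))"
      using n t by (subst pos_le_divide_eq) auto
    then show ?thesis by (simp add: s_def y_def)
  qed
  with s show ?thesis using that by blast
qed

end

section \<open>Polynomial calculus for selfadjoint operators\<close>

text \<open>A polynomial is evaluated as an operator on vectors, so constant terms make sense for
  left multiplications in an algebra without unit.\<close>

definition peval :: "(complex \<Rightarrow> 'v \<Rightarrow> 'v) \<Rightarrow> ('v \<Rightarrow> 'v) \<Rightarrow> real poly \<Rightarrow> 'v \<Rightarrow> 'v::ab_group_add" where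
  "peval sm H q v = (\<Sum>i\<le>degree q. sm (complex_of_real (coeff q i)) ((H ^^ i) v))"

locale linear_operator = vector_space sm
  for sm :: "complex \<Rightarrow> 'v::ab_group_add \<Rightarrow> 'v" +
  fixes H :: "'v \<Rightarrow> 'v"
  assumes H_add: "H (v + w) = H v + H w"
    and H_scale: "H (sm c v) = sm c (H v)"
begin

abbreviation ev :: "real poly \<Rightarrow> 'v \<Rightarrow> 'v" where "ev \<equiv> peval sm H"

lemma H_zero [simp]: "H 0 = 0"
  using H_add[of 0 0] by simp

lemma H_diff: "H (v - w) = H v - H w"
  using H_add[of "v - w" w] by (simp add: algebra_simps)

lemma H_sum: "H (sum f A) = (\<Sum>i\<in>A. H (f i))"
  by (induction A rule: infinite_finite_induct) (auto simp: H_add)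

lemma ev_eq_sum:
  assumes "degree q \<le> n"
  shows "ev q v = (\<Sum>i\<le>n. sm (of_real (coeff q i)) ((H ^^ i) v))"
  unfolding peval_def using assms
  by (intro sum.mono_neutral_left) (auto simp: coeff_eq_0)

lemma ev_add: "ev (f + g) v = ev f v + ev g v"
proof -
  let ?n = "max (degree f) (degree g)"
  have "degree (f + g) \<le> ?n" by (rule degree_add_le_max)
  then show ?thesis
    by (simp add: ev_eq_sum[of _ ?n] scale_left_distrib sum.distrib)
qed

lemma ev_smult: "ev (smult c f) v = sm (of_real c) (ev f v)"
  by (simp add: ev_eq_sum[of _ "degree f"] degree_smult_le scale_sum_right)

lemma ev_0 [simp]: "ev 0 v = 0"
  by (simp add: peval_def)

lemma ev_uminus: "ev (- f) v = - ev f v"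
  using ev_add[of f "-f" v] by (simp add: eq_neg_iff_add_eq_0 add.commute)

lemma ev_minus: "ev (f - g) v = ev f v - ev g v"
  using ev_add[of f "-g" v] by (simp add: ev_uminus)

lemma ev_pCons: "ev (pCons a f) v = sm (of_real a) v + H (ev f v)"
proof -
  have "ev (pCons a f) v = (\<Sum>i\<le>Suc (degree f). sm (of_real (coeff (pCons a f) i)) ((H ^^ i) v))"
    by (rule ev_eq_sum) (simp add: degree_pCons_le)
  also have "\<dots> = sm (of_real a) v + (\<Sum>i\<le>degree f. sm (of_real (coeff f i)) (H ((H ^^ i) v)))"
    by (subst sum.atMost_Suc_shift) simp
  finally show ?thesis by (simp add: peval_def H_sum H_scale)
qed

lemma ev_const [simp]: "ev [:c:] v = sm (of_real c) v"
  by (simp add: ev_pCons)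

lemma ev_1 [simp]: "ev 1 v = v"
  by (simp add: one_pCons)

lemma ev_X [simp]: "ev [:0, 1:] v = H v"
  by (simp add: ev_pCons)

lemma ev_mult: "ev (f * g) v = ev f (ev g v)"
  by (induction f) (auto simp: ev_pCons ev_add ev_smult)

lemma ev_H: "ev f (H v) = H (ev f v)"
  using ev_mult[of f "[:0, 1:]" v] ev_mult[of "[:0, 1:]" f v] by (simp only: mult.commute ev_X)

lemma ev_vadd: "ev f (v + w) = ev f v + ev f w"
  by (induction f) (auto simp: ev_pCons H_add scale_right_distrib)

lemma ev_vscale: "ev f (sm c v) = sm c (ev f v)"
  by (induction f) (auto simp: ev_pCons H_scale scale_right_distrib mult.commute)

lemma ev_vzero [simp]: "ev f 0 = 0"
  using ev_vadd[of f 0 0] by simp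

lemma ev_vdiff: "ev f (v - w) = ev f v - ev f w"
  using ev_vadd[of f "v - w" w] by (simp add: algebra_simps)

end

text \<open>Two instances are intended: left multiplication by a selfadjoint element, with
  \<open>B v w = st v * w\<close>, and \<open>T\<^sup>* T\<close> on the module, with
  \<open>B = ip\<close>. The former is linear in the second argument and the latter in the first;
  \<open>B_scale\<close> is phrased to cover both.\<close>

locale selfadjoint_operator = linear_operator sm H
  for sm :: "complex \<Rightarrow> 'v::ab_group_add \<Rightarrow> 'v" and H :: "'v \<Rightarrow> 'v" +
  fixes P :: "'v \<Rightarrow> real" and B :: "'v \<Rightarrow> 'v \<Rightarrow> 'b::ab_group_add" and p :: "'b \<Rightarrow> real"
    and r0 :: real
  assumes P_nonneg: "0 \<le> P v"
    and P_add: "P (v + w) \<le> P v + P w"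
    and P_scale: "P (sm c v) = cmod c * P v"
    and B_add: "B (v + v') w = B v w + B v' w" "B v (w + w') = B v w + B v w'"
    and B_scale: "B (sm c v) w = B v (sm (cnj c) w)"
    and B_diag: "p (B v v) = (P v)\<^sup>2"
    and B_bound: "p (B v w) \<le> P v * P w"
    and H_selfadj: "B (H v) w = B v (H w)"
    and H_bound: "P (H v) \<le> r0 * P v"
    and r0: "0 \<le> r0"
begin

definition opnorm :: "real poly \<Rightarrow> real" where
  "opnorm q = Inf {M. 0 \<le> M \<and> (\<forall>v. P (ev q v) \<le> M * P v)}"

lemma P_zero [simp]: "P 0 = 0"
  using P_scale[of 0 0] by simp

lemma ev_bounded: "\<exists>M\<ge>0. \<forall>v. P (ev q v) \<le> M * P v"
proof (induction q)
  case (pCons a q)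
  then obtain M where M: "M \<ge> 0" "\<And>v. P (ev q v) \<le> M * P v" by blast
  have "P (ev (pCons a q) v) \<le> (\<bar>a\<bar> + r0 * M) * P v" for v
  proof -
    have "P (ev (pCons a q) v) \<le> P (sm (of_real a) v) + P (H (ev q v))"
      unfolding ev_pCons by (rule P_add)
    also have "\<dots> \<le> \<bar>a\<bar> * P v + r0 * (M * P v)"
      using H_bound[of "ev q v"] mult_left_mono[OF M(2)[of v] r0] by (simp add: P_scale)
    finally show ?thesis by (simp add: algebra_simps)
  qed
  moreover have "0 \<le> \<bar>a\<bar> + r0 * M" using M r0 by simp
  ultimately show ?case by blast
qed auto

lemma opnorm_le:
  assumes "0 \<le> M" "\<And>v. P (ev q v) \<le> M * P v"
  shows "opnorm q \<le> M"
  unfolding opnorm_def using assms by (intro cInf_lower) (auto intro!: bdd_belowI[of _ 0])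

lemma opnorm_nonneg: "0 \<le> opnorm q"
  unfolding opnorm_def using ev_bounded[of q] by (intro cInf_greatest) auto

lemma opnorm_bound: "P (ev q v) \<le> opnorm q * P v"
proof (cases "P v = 0")
  case True
  then show ?thesis using ev_bounded[of q] by (metis mult_zero_right)
next
  case False
  then have Pv: "P v > 0" using P_nonneg[of v] by simp
  have "P (ev q v) / P v \<le> opnorm q"
    unfolding opnorm_def using ev_bounded[of q] Pv
    by (intro cInf_greatest) (auto simp: divide_le_eq)
  then show ?thesis using Pv by (simp add: divide_le_eq)
qed

lemma B_zero [simp]: "B v 0 = 0"
  using B_add(2)[of v 0 0] by simp

lemma B_ev: "B (ev f v) w = B v (ev f w)"
proof (induction f arbitrary: w)
  case 0
  show ?case using B_add(1)[of 0 0 w] by simp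
next
  case (pCons a f)
  then show ?case by (simp add: ev_pCons B_add B_scale H_selfadj ev_H)
qed

text \<open>The adjoint of \<open>f + s \<i> g\<close> is \<open>f - s \<i> g\<close>, and their
  product is \<open>f^2 + g^2\<close> for either sign \<open>s\<close>. The diagonal identity for
  \<open>B\<close> then plays the part of the C*-identity.\<close>

lemma P_ev_complex:
  fixes s :: real
  assumes s: "s\<^sup>2 = 1"
  shows "(P (ev f v + sm (s * \<i>) (ev g v)))\<^sup>2 \<le> opnorm (f\<^sup>2 + g\<^sup>2) * (P v)\<^sup>2"
proof -
  define w where "w = ev f v + sm (s * \<i>) (ev g v)"
  have "B w w = B (ev f v) w + B (sm (s * \<i>) (ev g v)) w" unfolding w_def by (rule B_add)
  also have "\<dots> = B v (ev f w) + B v (ev g (sm (- (s * \<i>)) w))"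
    by (simp add: B_ev B_scale)
  also have "\<dots> = B v (ev f w + sm (- (s * \<i>)) (ev g w))" by (simp only: B_add(2) ev_vscale)
  also have "ev f w + sm (- (s * \<i>)) (ev g w) = ev (f\<^sup>2 + g\<^sup>2) v"
  proof -
    have ss: "complex_of_real s * complex_of_real s = 1"
      using s by (simp add: power2_eq_square of_real_mult[symmetric] del: of_real_mult)
    have "(- (s * \<i>)) * (s * \<i>) = 1" using ss by (simp add: algebra_simps)
    then have 1: "sm (- (s * \<i>)) (sm (s * \<i>) x) = x" for x by simp
    have 2: "sm (- (s * \<i>)) x = - sm (s * \<i>) x" for x by (rule scale_minus_left)
    have 3: "ev g (ev f v) = ev f (ev g v)" by (simp add: ev_mult[symmetric] mult.commute)
    have "ev f w + sm (- (s * \<i>)) (ev g w) = ev f (ev f v) + sm (s * \<i>) (ev f (ev g v))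
       + (- sm (s * \<i>) (ev f (ev g v)) + ev g (ev g v))"
      by (simp only: w_def ev_vadd ev_vscale scale_right_distrib 1 3) (simp only: 2)
    then show ?thesis by (simp add: ev_add ev_mult power2_eq_square)
  qed
  finally have "(P w)\<^sup>2 = p (B v (ev (f\<^sup>2 + g\<^sup>2) v))" by (simp add: B_diag[symmetric])
  also have "\<dots> \<le> P v * P (ev (f\<^sup>2 + g\<^sup>2) v)" by (rule B_bound)
  also have "\<dots> \<le> P v * (opnorm (f\<^sup>2 + g\<^sup>2) * P v)" by (intro mult_left_mono opnorm_bound P_nonneg)
  finally show ?thesis by (simp add: w_def power2_eq_square mult_ac)
qed

sublocale poly_cstar opnorm
proof
  fix f g :: "real poly" and c :: real
  show "0 \<le> opnorm f" by (rule opnorm_nonneg)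
  show "opnorm (f + g) \<le> opnorm f + opnorm g"
  proof (rule opnorm_le)
    fix v
    have "P (ev (f + g) v) \<le> P (ev f v) + P (ev g v)" unfolding ev_add by (rule P_add)
    also have "\<dots> \<le> opnorm f * P v + opnorm g * P v" by (intro add_mono opnorm_bound)
    finally show "P (ev (f + g) v) \<le> (opnorm f + opnorm g) * P v" by (simp add: algebra_simps)
  qed (simp add: opnorm_nonneg)
  show "opnorm (smult c f) \<le> \<bar>c\<bar> * opnorm f"
    using mult_left_mono[OF opnorm_bound[of f], of "\<bar>c\<bar>"]
    by (intro opnorm_le) (auto simp: ev_smult P_scale opnorm_nonneg mult.assoc)
  show "opnorm (f * g) \<le> opnorm f * opnorm g"
  proof (rule opnorm_le)
    fix v
    have "P (ev (f * g) v) \<le> opnorm f * P (ev g v)" unfolding ev_mult by (rule opnorm_bound)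
    also have "\<dots> \<le> opnorm f * (opnorm g * P v)" by (intro mult_left_mono opnorm_bound opnorm_nonneg)
    finally show "P (ev (f * g) v) \<le> opnorm f * opnorm g * P v" by (simp add: algebra_simps)
  qed (simp add: opnorm_nonneg)
  show "opnorm 1 \<le> 1" by (rule opnorm_le) auto
  have "opnorm f \<le> sqrt (opnorm (f\<^sup>2 + g\<^sup>2))"
  proof (rule opnorm_le)
    fix v
    define m where "m = sqrt (opnorm (f\<^sup>2 + g\<^sup>2)) * P v"
    have m: "0 \<le> m" "m\<^sup>2 = opnorm (f\<^sup>2 + g\<^sup>2) * (P v)\<^sup>2"
      by (auto simp: m_def P_nonneg opnorm_nonneg power_mult_distrib)
    have 1: "P (ev f v + sm (complex_of_real s * \<i>) (ev g v)) \<le> m" if "s\<^sup>2 = 1" for s :: real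
      using P_ev_complex[OF that, of f v g] m by (metis power2_le_imp_le)
    \<comment> \<open>The real part is the mean of the two conjugate combinations, each of which is
      bounded by \<open>m\<close>.\<close>
    have "sm (1/2) (ev f v + sm (complex_of_real 1 * \<i>) (ev g v)) + sm (1/2) (ev f v + sm (complex_of_real (-1) * \<i>) (ev g v)) = ev f v"
    proof -
      have "sm (1/2) (a + b) + sm (1/2) (a - b) = a" for a b :: 'v
        by (simp only: scale_right_distrib[symmetric]) (simp add: scale_right_distrib scale_left_distrib[symmetric])
      then show ?thesis by simp
    qed
    then have "P (ev f v) \<le> P (sm (1/2) (ev f v + sm (complex_of_real 1 * \<i>) (ev g v))) + P (sm (1/2) (ev f v + sm (complex_of_real (-1) * \<i>) (ev g v)))"
      using P_add by metis
    also have "\<dots> \<le> 1/2 * m + 1/2 * m"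
      using 1[of 1] 1[of "-1"] by (auto simp: P_scale norm_divide)
    finally show "P (ev f v) \<le> sqrt (opnorm (f\<^sup>2 + g\<^sup>2)) * P v" by (simp add: m_def mult.commute)
  qed (simp add: opnorm_nonneg)
  then show "(opnorm f)\<^sup>2 \<le> opnorm (f\<^sup>2 + g\<^sup>2)"
    using opnorm_nonneg by (metis power_mono real_sqrt_pow2)
qed

lemma opnorm_X_le: "opnorm [:0, 1:] \<le> r0"
  using r0 H_bound by (intro opnorm_le) auto

lemma ev_le_sup:
  assumes "r0 < r" "\<And>x. \<bar>x\<bar> \<le> r \<Longrightarrow> \<bar>poly q x\<bar> \<le> M"
  shows "P (ev q v) \<le> M * P v"
proof -
  have "opnorm q \<le> M" using von_neumann_inequality[of r q M] opnorm_X_le assms by simp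
  then show ?thesis using opnorm_bound[of q v] mult_right_mono[OF _ P_nonneg[of v]] by (metis order_trans)
qed

end

section \<open>Positivity in a *-algebra with a C*-seminorm\<close>

lemma mult_power_one_minus_le:
  fixes y :: real
  assumes "0 \<le> y" "y \<le> 1" "n > 0"
  shows "y * (1 - y) ^ n \<le> 1 / real n"
proof -
  have "(1 - y) ^ n * (1 + real n * y) \<le> (1 - y) ^ n * (1 + y) ^ n"
    using assms by (intro mult_left_mono Bernoulli_inequality) auto
  also have "\<dots> = (1 - y\<^sup>2) ^ n"
    by (simp add: power_mult_distrib[symmetric] power2_eq_square algebra_simps)
  also have "\<dots> \<le> 1" using assms by (intro power_le_one) (auto simp: power_le_one)
  finally have "(1 - y) ^ n + real n * (y * (1 - y) ^ n) \<le> 1" by (simp add: algebra_simps)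
  moreover have "0 \<le> (1 - y) ^ n" using assms by simp
  ultimately have "real n * (y * (1 - y) ^ n) \<le> 1" by linarith
  then show ?thesis using assms by (simp add: field_simps)
qed

locale star_alg = vector_space sm
  for sm :: "complex \<Rightarrow> 'a::ring \<Rightarrow> 'a" +
  fixes st :: "'a \<Rightarrow> 'a"
  assumes star_algebra: "star_algebra sm st"
begin

lemma mult_scale [simp]: "sm c a * b = sm c (a * b)" "a * sm c b = sm c (a * b)"
  using star_algebra unfolding star_algebra_def by metis+

lemma st_st [simp]: "st (st a) = a"
  and st_add [simp]: "st (a + b) = st a + st b"
  and st_scale [simp]: "st (sm c a) = sm (cnj c) (st a)"
  and st_mult [simp]: "st (a * b) = st b * st a"
  using star_algebra unfolding star_algebra_def by auto

lemma st_0 [simp]: "st 0 = 0"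
  using st_add[of 0 0] by simp

lemma st_minus [simp]: "st (- a) = - st a"
  using st_add[of a "- a"] by (simp add: eq_neg_iff_add_eq_0 add.commute)

lemma st_diff [simp]: "st (a - b) = st a - st b"
  using st_add[of a "- b"] by simp

lemma linear_mult_left: "linear_operator sm ((*) z)"
  by unfold_locales (simp_all add: distrib_left)

lemma ev_mult_right: "peval sm ((*) z) f (d * e) = peval sm ((*) z) f d * e"
proof -
  interpret linear_operator sm "(*) z" by (rule linear_mult_left)
  show ?thesis by (induction f) (auto simp: ev_pCons distrib_right mult.assoc)
qed

lemma ev_self_commute: "peval sm ((*) z) f z * z = z * peval sm ((*) z) f z"
proof -
  interpret linear_operator sm "(*) z" by (rule linear_mult_left)
  show ?thesis using ev_H[of f z] by (simp add: ev_mult_right)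
qed

lemma st_ev_self:
  assumes "st z = z"
  shows "st (peval sm ((*) z) f z) = peval sm ((*) z) f z"
proof -
  interpret linear_operator sm "(*) z" by (rule linear_mult_left)
  show ?thesis by (induction f) (auto simp: ev_pCons assms ev_self_commute)
qed

lemma intertwine:
  "st e * peval sm ((*) (e * st e)) f d = peval sm ((*) (st e * e)) f (st e * d)"
proof -
  interpret U: linear_operator sm "(*) (e * st e)" by (rule linear_mult_left)
  interpret V: linear_operator sm "(*) (st e * e)" by (rule linear_mult_left)
  show ?thesis 
  proof (induction f)
    case (pCons a f)
    have "st e * (e * st e * U.ev f d) = st e * e * (st e * U.ev f d)" by (simp only: mult.assoc)
    then show ?case by (simp add: U.ev_pCons V.ev_pCons distrib_left pCons.IH)
  qed simp
qed

end

locale cstar_sn = star_alg sm st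
  for sm :: "complex \<Rightarrow> 'a::ring \<Rightarrow> 'a" and st +
  fixes p :: "'a \<Rightarrow> real"
  assumes cstar_seminorm: "cstar_seminorm sm st p"
begin

lemma p_nonneg [simp]: "0 \<le> p a"
  and p_add: "p (a + b) \<le> p a + p b"
  and p_scale [simp]: "p (sm c a) = cmod c * p a"
  and p_mult: "p (a * b) \<le> p a * p b"
  and p_st [simp]: "p (st a) = p a"
  and p_cstar: "p (st a * a) = (p a)\<^sup>2"
  using cstar_seminorm unfolding cstar_seminorm_def by blast+

lemma p_cstar': "p (a * st a) = (p a)\<^sup>2"
  using p_cstar[of "st a"] by simp

lemma p_0 [simp]: "p 0 = 0"
  using p_scale[of 0 0] by simp

lemma p_minus [simp]: "p (- a) = p a"
  using p_scale[of "-1" a] by simp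

lemma p_diff: "p (a - b) \<le> p a + p b"
  using p_add[of a "- b"] by simp

lemma selfadjoint_mult_left:
  assumes "st z = z"
  shows "selfadjoint_operator sm ((*) z) p (\<lambda>v w. st v * w) p (p z)"
proof -
  interpret linear_operator sm "(*) z" by (rule linear_mult_left)
  show ?thesis
  proof unfold_locales
    fix v w
    show "p (st v * w) \<le> p v * p w" using p_mult[of "st v" w] by simp
  qed (auto simp: p_add p_mult p_cstar assms distrib_left distrib_right mult.assoc)
qed

text \<open>This is \<open>||t - a|| \<le> M\<close> read as an operator bound, so that the scalar
  \<open>t\<close> needs no unit. With \<open>M\<close> equal to \<open>t\<close> or slightly larger
  it expresses that the spectrum of \<open>a\<close> is nonnegative, exactly or nearly.\<close>

definition left_bound :: "real \<Rightarrow> 'a \<Rightarrow> real \<Rightarrow> bool" where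
  "left_bound t a M \<longleftrightarrow> (\<forall>d. p (sm (of_real t) d - a * d) \<le> M * p d)"

lemma left_bound_add:
  assumes "left_bound t a M" "left_bound t' a' M'"
  shows "left_bound (t + t') (a + a') (M + M')"
  unfolding left_bound_def
proof
  fix d
  have "sm (of_real (t + t')) d - (a + a') * d = (sm (of_real t) d - a * d) + (sm (of_real t') d - a' * d)"
    by (simp add: scale_left_distrib distrib_right)
  then show "p (sm (of_real (t + t')) d - (a + a') * d) \<le> (M + M') * p d"
    using p_add[of "sm (of_real t) d - a * d" "sm (of_real t') d - a' * d"] assms
    unfolding left_bound_def by (smt (verit) distrib_right)
qed

text \<open>On \<open>[-r, r]\<close> with \<open>r = p h + 1\<close>, the polynomial
  \<open>r^2 - x^2 / 2\<close> takes values between \<open>0\<close> and \<open>r^2\<close>. The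
  factor \<open>1/2\<close> anticipates that \<open>h^2 + k^2\<close> is twice
  \<open>e * st e + st e * e\<close> for the two selfadjoint parts of \<open>e\<close> used
  below.\<close>

lemma left_bound_half_square:
  assumes h: "st h = h"
  shows "left_bound ((p h + 1)\<^sup>2) (sm (1/2) (h * h)) ((p h + 1)\<^sup>2)"
  unfolding left_bound_def
proof
  fix d
  interpret selfadjoint_operator sm "(*) h" p "\<lambda>v w. st v * w" p "p h"
    by (rule selfadjoint_mult_left[OF h])
  let ?r = "p h + 1"
  have "p (ev [:?r\<^sup>2, 0, - (1/2):] d) \<le> ?r\<^sup>2 * p d"
  proof (rule ev_le_sup[of ?r])
    fix x :: real assume "\<bar>x\<bar> \<le> ?r"
    then have "x\<^sup>2 \<le> ?r\<^sup>2" by (metis abs_ge_zero power2_abs power_mono)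
    moreover have "0 \<le> x\<^sup>2" by simp
    moreover have "poly [:?r\<^sup>2, 0, - (1/2):] x = ?r\<^sup>2 - x\<^sup>2 / 2"
      by (simp add: power2_eq_square)
    ultimately show "\<bar>poly [:?r\<^sup>2, 0, - (1/2):] x\<bar> \<le> ?r\<^sup>2" by linarith
  qed simp
  moreover have "ev [:?r\<^sup>2, 0, - (1/2):] d = sm (of_real (?r\<^sup>2)) d - sm (1/2) (h * h) * d"
    by (simp add: ev_pCons mult.assoc)
  ultimately show "p (sm (of_real (?r\<^sup>2)) d - sm (1/2) (h * h) * d) \<le> ?r\<^sup>2 * p d" by simp
qed

text \<open>The counterpart of \<open>\<sigma>(a a\<^sup>*) \<union> {0} = \<sigma>(a\<^sup>* a) \<union> {0}\<close>.\<close>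
lemma left_bound_swap:
  assumes M: "0 \<le> t" "t \<le> M" "0 < M" and lb: "left_bound t (st e * e) M"
  shows "left_bound t (e * st e) M"
proof -
  define W where "W = e * st e"
  define W' where "W' = st e * e"
  interpret W: selfadjoint_operator sm "(*) W" p "\<lambda>v w. st v * w" p "p W"
    by (rule selfadjoint_mult_left) (simp add: W_def)
  interpret W': linear_operator sm "(*) W'" by (rule linear_mult_left)
  define q where "q = [:t, -1:]"
  have qW: "W.ev q v = sm (of_real t) v - W * v" for v by (simp add: q_def W.ev_pCons)
  have qW': "W'.ev q v = sm (of_real t) v - W' * v" for v by (simp add: q_def W'.ev_pCons)
  have n': "p (W'.ev (q ^ n) v) \<le> M ^ n * p v" for n v
  proof (induction n)
    case (Suc n)
    have "p (W'.ev (q ^ Suc n) v) = p (W'.ev q (W'.ev (q ^ n) v))" by (simp only: power_Suc W'.ev_mult)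
    also have "\<dots> \<le> M * p (W'.ev (q ^ n) v)" unfolding qW' using lb by (simp add: left_bound_def W'_def)
    also have "\<dots> \<le> M * (M ^ n * p v)" using Suc M by (intro mult_left_mono) auto
    finally show ?case by (simp add: mult.assoc)
  qed simp
  define C where "C = (p e)\<^sup>2 / M"
  have C: "(p e)\<^sup>2 = C * M" "0 \<le> C" using M by (auto simp: C_def)
  \<comment> \<open>In \<open>(t - W)^(n+1) v\<close> the last factor is split into \<open>t\<close>
    and \<open>e * st e\<close>, and \<open>st e\<close> is moved past the power, turning
    \<open>W\<close> into \<open>W'\<close>, where \<open>n'\<close> applies. The constants add up
    to a factor linear in \<open>n\<close>, which roots remove.\<close>
  have n: "p (W.ev (q ^ n) v) \<le> (1 + C * real n) * M ^ n * p v" for n v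
  proof (induction n)
    case (Suc n)
    let ?w = "W.ev (q ^ n) v"
    have "p (W.ev (q ^ Suc n) v) = p (sm (of_real t) ?w - e * (st e * ?w))"
      unfolding power_Suc W.ev_mult qW by (simp add: W_def mult.assoc)
    also have "\<dots> \<le> t * p ?w + p (e * (st e * ?w))"
      using p_diff[of "sm (of_real t) ?w" "e * (st e * ?w)"] M by simp
    also have "st e * ?w = W'.ev (q ^ n) (st e * v)"
      unfolding W_def W'_def by (rule intertwine)
    also have "p (e * W'.ev (q ^ n) (st e * v)) \<le> p e * (M ^ n * (p e * p v))"
    proof -
      have "p (W'.ev (q ^ n) (st e * v)) \<le> M ^ n * (p e * p v)"
        using n'[of n "st e * v"] p_mult[of "st e" v] M
        by (smt (verit) mult_left_mono p_st zero_le_power)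
      then show ?thesis using p_mult[of e "W'.ev (q ^ n) (st e * v)"]
        by (smt (verit) mult_left_mono p_nonneg)
    qed
    also have "t * p ?w \<le> M * ((1 + C * real n) * M ^ n * p v)"
      using M Suc by (intro mult_mono) auto
    also have "M * ((1 + C * real n) * M ^ n * p v) + p e * (M ^ n * (p e * p v)) =
        M * ((1 + C * real n) * M ^ n * p v) + (p e)\<^sup>2 * M ^ n * p v"
      by (simp add: power2_eq_square algebra_simps)
    also have "\<dots> = (1 + C * real (Suc n)) * M ^ Suc n * p v"
      unfolding C by (simp add: algebra_simps)
    finally show ?case by simp
  qed simp
  have "W.opnorm q \<le> M"
  proof (rule power_growth_imp_le[OF W.opnorm_nonneg M(3), where \<alpha> = 1 and \<beta> = C])
    fix j :: nat
    have "W.opnorm q ^ (2 ^ j) \<le> W.opnorm (q ^ (2 ^ j))" by (rule W.N_pow2)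
    also have "\<dots> \<le> (1 + C * real (2 ^ j)) * M ^ (2 ^ j)"
      using n[of "2 ^ j"] C M by (intro W.opnorm_le) simp_all
    finally show "W.opnorm q ^ (2 ^ j) \<le> (1 + C * 2 ^ j) * M ^ (2 ^ j)" by simp
  qed
  then show ?thesis unfolding left_bound_def W_def[symmetric] qW[symmetric]
    by (meson W.opnorm_bound mult_right_mono order_trans p_nonneg)
qed

text \<open>Kaplansky's argument: for \<open>z = b\<^sup>* b\<close> and a polynomial \<open>f\<close> concentrated on the negative axis,
  \<open>c = b f(z)\<close> has \<open>c\<^sup>* c = z f(z)\<^sup>2 \<le> 0\<close>, while \<open>c c\<^sup>* + c\<^sup>* c\<close> is a sum of squares.\<close>
lemma left_bound_positive:
  assumes t: "t \<ge> p (st b * b) + 1"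
  shows "left_bound t (st b * b) t"
proof -
  define z where "z = st b * b"
  have stz: "st z = z" by (simp add: z_def)
  interpret selfadjoint_operator sm "(*) z" p "\<lambda>v w. st v * w" p "p z"
    by (rule selfadjoint_mult_left[OF stz])
  define r where "r = p z + 1"
  have r: "r > p z" "r > 0" "opnorm [:0, 1:] < r" using opnorm_X_le p_nonneg[of z] by (auto simp: r_def simp del: p_nonneg)
  have main: "opnorm [:t, -1:] \<le> t + 2 * \<delta>" if \<delta>: "\<delta> > 0" for \<delta>
  proof -
    obtain m :: nat where "m > r / (2 * \<delta>)" using reals_Archimedean2 by blast
    moreover have "r / (2 * \<delta>) > 0" using r \<delta> by simp
    ultimately have m0: "real m > 0" by linarith
    then have m: "m > 0" "r / real (2 * m) \<le> \<delta>"
      using \<delta> \<open>m > r / (2 * \<delta>)\<close> by (auto simp: field_simps)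
    define f where "f = [:1, - (1 / r):] ^ m"
    have f2: "(poly f x)\<^sup>2 = (1 - x / r) ^ (2 * m)" for x
      by (simp add: f_def power_mult[symmetric] mult.commute)
    have fpos: "x * (poly f x)\<^sup>2 \<le> \<delta>" if "0 \<le> x" "x \<le> r" for x
    proof -
      have "x / r * (1 - x / r) ^ (2 * m) \<le> 1 / real (2 * m)"
        using that r m by (intro mult_power_one_minus_le) auto
      then have "x * (1 - x / r) ^ (2 * m) \<le> r / real (2 * m)" using r by (simp add: field_simps)
      then show ?thesis using m f2 by simp
    qed
    have fneg: "(poly f x)\<^sup>2 \<ge> 1" if "x \<le> 0" for x
      unfolding f2 using that r by (intro one_le_power) (auto simp: field_simps)
    define t3 where "t3 = r * 4 ^ m"
    have t3: "t3 > 0" using r by (simp add: t3_def)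
    have f3: "- t3 \<le> x * (poly f x)\<^sup>2" if "- r \<le> x" "x \<le> 0" for x
    proof -
      have "(1 - x / r) ^ (2 * m) \<le> 2 ^ (2 * m)"
        using that r by (intro power_mono) (auto simp: field_simps)
      then have "(poly f x)\<^sup>2 \<le> 4 ^ m" unfolding f2 by (simp add: power_mult)
      then have "(- x) * (poly f x)\<^sup>2 \<le> r * 4 ^ m" using that r by (intro mult_mono) auto
      then show ?thesis by (simp add: t3_def)
    qed
    \<comment> \<open>Here \<open>st e\<close> is the element \<open>c = b f(z)\<close>, so
      \<open>W\<close> is \<open>c\<^sup>* c\<close> and \<open>st e * e\<close> is
      \<open>c c\<^sup>*\<close>.\<close>
    define e where "e = ev f (st b)"
    define W where "W = e * st e"
    have eb: "e * b = ev f z" by (simp add: e_def z_def ev_mult_right)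
    have "W = ev f (st b * st e)" by (simp add: W_def e_def ev_mult_right)
    also have "st b * st e = st (e * b)" by simp
    also have "\<dots> = ev f z" unfolding eb by (rule st_ev_self[OF stz])
    finally have W: "W = ev (f * f) z" by (simp add: ev_mult)
    have Wd: "W * d = ev ([:0, 1:] * f\<^sup>2) d" for d
    proof -
      have "W * d = ev (f * f) (z * d)" by (simp add: W ev_mult_right)
      also have "\<dots> = ev (f * f * [:0, 1:]) d" by (simp only: ev_mult ev_X)
      finally show ?thesis by (simp only: mult.commute power2_eq_square)
    qed
    have lb3: "left_bound t3 (- W) (t3 + \<delta>)"
      unfolding left_bound_def
    proof
      fix d
      have "p (ev ([:t3:] + [:0, 1:] * f\<^sup>2) d) \<le> (t3 + \<delta>) * p d"
      proof (rule ev_le_sup[of r])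
        fix x :: real assume "\<bar>x\<bar> \<le> r"
        then show "\<bar>poly ([:t3:] + [:0, 1:] * f\<^sup>2) x\<bar> \<le> t3 + \<delta>"
          using fpos[of x] f3[of x] \<delta> t3 mult_nonneg_nonneg[of x "(poly f x)\<^sup>2"] mult_nonpos_nonneg[of x "(poly f x)\<^sup>2"]
          by (cases "x \<ge> 0") (auto simp: abs_le_iff)
      qed (use r in simp)
      moreover have "ev ([:t3:] + [:0, 1:] * f\<^sup>2) d = sm (of_real t3) d - (- W) * d"
        by (simp only: ev_add ev_const Wd[symmetric]) simp
      ultimately show "p (sm (of_real t3) d - (- W) * d) \<le> (t3 + \<delta>) * p d" by simp
    qed
    define h where "h = e + st e"
    define k where "k = sm \<i> (st e - e)"
    have sth: "st h = h" and stk: "st k = k"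
      by (simp_all add: h_def k_def add.commute scale_right_diff_distrib)
    \<comment> \<open>\<open>c c\<^sup>*\<close> becomes a sum of two selfadjoint squares and
      \<open>- W\<close>, where \<open>- W\<close> is bounded below by \<open>- \<delta>\<close>.
      Swapping the factors carries the resulting bound over to \<open>W\<close> itself, which is
      thus nearly positive and nearly negative.\<close>
    have hk: "sm (1/2) (h * h) + sm (1/2) (k * k) + - W = st e * e"
    proof -
      have "h * h + k * k = sm 2 (e * st e + st e * e)"
      proof -
        have "k * k = - ((st e - e) * (st e - e))" by (simp add: k_def)
        moreover have "sm 2 x = x + x" for x
          using scale_left_distrib[of 1 1 x] by simp
        ultimately show ?thesis by (simp add: h_def algebra_simps)
      qed
      then have "sm (1/2) (h * h) + sm (1/2) (k * k) = e * st e + st e * e"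
        by (simp add: scale_right_distrib[symmetric])
      then show ?thesis by (simp add: W_def)
    qed
    define \<tau> where "\<tau> = (p h + 1)\<^sup>2 + (p k + 1)\<^sup>2 + t3"
    have \<tau>: "\<tau> > 0" using t3 by (simp add: \<tau>_def add_nonneg_pos)
    have "left_bound \<tau> (st e * e) (\<tau> + \<delta>)"
      using left_bound_add[OF left_bound_add[OF left_bound_half_square[OF sth] left_bound_half_square[OF stk]] lb3]
      unfolding hk \<tau>_def by (simp add: add.assoc)
    then have "left_bound \<tau> W (\<tau> + \<delta>)"
      unfolding W_def using \<tau> \<delta> by (intro left_bound_swap) auto
    then have "opnorm ([:\<tau>:] - [:0, 1:] * f\<^sup>2) \<le> \<tau> + \<delta>"
      using \<tau> \<delta> unfolding left_bound_def
      by (intro opnorm_le) (simp, simp only: ev_minus ev_const Wd)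
    then have "opnorm ([:\<tau> + \<delta>:] - ([:0, 1:] * f\<^sup>2 + [:\<delta>:])) \<le> \<tau> + \<delta>"
      by (simp add: algebra_simps)
    then obtain s where s: "opnorm s \<le> \<delta>" "\<And>x. max 0 (- poly ([:0, 1:] * f\<^sup>2 + [:\<delta>:]) x) \<le> poly s x"
      by (rule negative_part_negligible[OF add_pos_pos[OF \<tau> \<delta>] _ \<delta>]) blast
    \<comment> \<open>For \<open>x < 0\<close> one has
      \<open>- x \<le> - x f(x)^2 \<le> s(x) + \<delta>\<close>, because \<open>f^2 \<ge> 1\<close>
      there. So the negligible \<open>s\<close> dominates the whole negative part of
      \<open>z\<close>.\<close>
    have "opnorm [:t, -1:] \<le> opnorm ([:t + \<delta>:] + s)"
    proof (rule N_mono[OF r(3)])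
      fix x :: real assume x: "\<bar>x\<bar> \<le> r"
      have s': "0 \<le> poly s x" "- (x * (poly f x)\<^sup>2) - \<delta> \<le> poly s x"
        using s(2)[of x] by (simp_all add: power2_eq_square)
      have t': "r \<le> t" using t by (simp add: r_def z_def)
      have "\<bar>t - x\<bar> \<le> t + \<delta> + poly s x"
      proof (cases "x \<ge> 0")
        case True
        then show ?thesis using x s' \<delta> t' by linarith
      next
        case False
        then have "- x * 1 \<le> - x * (poly f x)\<^sup>2" by (intro mult_left_mono fneg) auto
        then show ?thesis using x s' \<delta> t' False by linarith
      qed
      then show "\<bar>poly [:t, -1:] x\<bar> \<le> \<bar>poly ([:t + \<delta>:] + s) x\<bar>" by simp
    qed
    also have "\<dots> \<le> \<bar>t + \<delta>\<bar> + \<delta>"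
      using N_add[of "[:t + \<delta>:]" s] N_const[of "t + \<delta>"] s(1) by linarith
    finally show ?thesis using t \<delta> p_nonneg[of "st b * b"] by linarith
  qed
  have "opnorm [:t, -1:] \<le> t + \<delta>" if "\<delta> > 0" for \<delta> using main[of "\<delta> / 2"] that by simp
  then have "opnorm [:t, -1:] \<le> t" by (rule field_le_epsilon)
  moreover have "ev [:t, -1:] d = sm (of_real t) d - z * d" for d by (simp add: ev_pCons)
  ultimately show ?thesis unfolding left_bound_def z_def[symmetric]
    by (metis opnorm_bound mult_right_mono order_trans p_nonneg)
qed

text \<open>Positivity after Kelley and Vaught, \<open>\<parallel>t - a\<parallel> \<le> t\<close>, phrased with left multiplications because there is
  no unit.\<close>
definition kvpos :: "'a \<Rightarrow> bool" where
  "kvpos a \<longleftrightarrow> (\<exists>t0. \<forall>t\<ge>t0. left_bound t a t)"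

lemma kvpos_positive: "positive st a \<Longrightarrow> kvpos a"
  unfolding positive_def kvpos_def using left_bound_positive by blast

lemma kvpos_add:
  assumes "kvpos a" "kvpos b"
  shows "kvpos (a + b)"
proof -
  obtain s t where "\<And>x. x \<ge> s \<Longrightarrow> left_bound x a x" "\<And>x. x \<ge> t \<Longrightarrow> left_bound x b x"
    using assms unfolding kvpos_def by blast
  then have "left_bound x (a + b) x" if "x \<ge> s + t" for x
    using left_bound_add[of s a s "x - s" b "x - s"] that by simp
  then show ?thesis unfolding kvpos_def by blast
qed

text \<open>With \<open>s = p (a + Y)\<close>, the element \<open>s - a\<close> is the sum of
  \<open>s - (a + Y)\<close> and \<open>Y\<close>, so as a polynomial in \<open>a\<close> it has
  negligible negative part, and so has \<open>a\<close>. Hence \<open>|x| \<le> s\<close> up to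
  negligible terms, and \<open>N_mono\<close> yields \<open>||a|| \<le> s\<close>.\<close>

lemma p_mono:
  assumes a: "positive st a" and Y: "kvpos Y"
  shows "p a \<le> p (a + Y)"
proof -
  obtain b where b: "a = st b * b" using a by (auto simp: positive_def)
  have sta: "st a = a" by (simp add: b)
  interpret selfadjoint_operator sm "(*) a" p "\<lambda>v w. st v * w" p "p a"
    by (rule selfadjoint_mult_left[OF sta])
  define r where "r = p a + 1"
  have r: "opnorm [:0, 1:] < r" using opnorm_X_le by (simp add: r_def)
  define s where "s = p (a + Y)"
  obtain t2 where t2: "\<And>t. t \<ge> t2 \<Longrightarrow> left_bound t Y t" using Y by (auto simp: kvpos_def)
  \<comment> \<open>The summand \<open>1\<close> guarantees \<open>T > 0\<close>; it is matched by
    the \<open>d\<close> in the splitting of the operator below.\<close>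
  define T where "T = s + 1 + max 0 t2"
  have "0 \<le> s" by (simp add: s_def)
  then have T: "T > 0" by (simp add: T_def)
  have n1: "opnorm ([:T:] - [:s, -1:]) \<le> T"
  proof (rule opnorm_le)
    fix d
    have "ev ([:T:] - [:s, -1:]) d = (d + (a + Y) * d) + (sm (of_real (max 0 t2)) d - Y * d)"
      by (simp add: ev_pCons T_def scale_left_distrib distrib_right)
    then have "p (ev ([:T:] - [:s, -1:]) d) \<le> p (d + (a + Y) * d) + p (sm (of_real (max 0 t2)) d - Y * d)"
      using p_add by metis
    also have "p (d + (a + Y) * d) \<le> p d + s * p d"
      using p_add[of d "(a + Y) * d"] p_mult[of "a + Y" d] by (simp add: s_def)
    also have "p (sm (of_real (max 0 t2)) d - Y * d) \<le> max 0 t2 * p d"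
      using t2[of "max 0 t2"] by (auto simp: left_bound_def)
    finally show "p (ev ([:T:] - [:s, -1:]) d) \<le> T * p d" by (simp add: T_def algebra_simps)
  qed (use T in simp)
  have n2: "opnorm ([:r:] - [:0, 1:]) \<le> r"
    using left_bound_positive[of b r] unfolding left_bound_def b[symmetric]
    by (intro opnorm_le) (auto simp: r_def ev_pCons)
  have main: "opnorm [:0, 1:] \<le> s + 2 * \<delta>" if \<delta>: "\<delta> > 0" for \<delta>
  proof -
    obtain s1 where s1: "opnorm s1 \<le> \<delta>" "\<And>x. max 0 (- poly [:s, -1:] x) \<le> poly s1 x"
      using negative_part_negligible[OF T n1 \<delta>] by metis
    have "r > 0" by (simp add: r_def add_nonneg_pos)
    then obtain s2 where s2: "opnorm s2 \<le> \<delta>" "\<And>x. max 0 (- poly [:0, 1:] x) \<le> poly s2 x"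
      using negative_part_negligible[OF _ n2 \<delta>] by metis
    have "opnorm [:0, 1:] \<le> opnorm ([:s:] + s1 + s2)"
    proof (rule N_mono[OF r])
      fix x :: real
      have "0 \<le> s" by (simp add: s_def)
      then show "\<bar>poly [:0, 1:] x\<bar> \<le> \<bar>poly ([:s:] + s1 + s2) x\<bar>"
        using s1(2)[of x] s2(2)[of x] by auto
    qed
    also have "\<dots> \<le> s + 2 * \<delta>"
      using N_add[of "[:s:] + s1" s2] N_add[of "[:s:]" s1] N_const[of s] s1(1) s2(1) by (simp add: s_def)
    finally show ?thesis .
  qed
  have "opnorm [:0, 1:] \<le> s + \<delta>" if "\<delta> > 0" for \<delta> using main[of "\<delta> / 2"] that by simp
  then have le: "opnorm [:0, 1:] \<le> s" by (rule field_le_epsilon)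
  have "(p a)\<^sup>2 = p (ev [:0, 1:] a)" using p_cstar[of a] sta by simp
  also have "\<dots> \<le> s * p a"
    using opnorm_bound[of "[:0, 1:]" a] mult_right_mono[OF le p_nonneg[of a]] by linarith
  finally have "p a * p a \<le> s * p a" by (simp add: power2_eq_square)
  then show ?thesis
    using p_nonneg[of a] p_nonneg[of "a + Y"] unfolding s_def
    by (metis less_eq_real_def mult_le_cancel_right_pos)
qed

end

section \<open>Pro-C*-algebras\<close>

text \<open>Approximate solutions are available for one seminorm at a time. Directedness makes the
  sets \<open>U (p, e)\<close> of such solutions a filter base, and the bound from below makes the
  filter Cauchy. A filter replaces a sequence because \<open>Q\<close> may be uncountable.\<close>

lemma sn_solve:
  fixes Q :: "('v::ab_group_add \<Rightarrow> real) set" and L :: "'v \<Rightarrow> 'v"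
  assumes complete: "sn_complete Q"
    and dir: "\<And>p q. p \<in> Q \<Longrightarrow> q \<in> Q \<Longrightarrow> \<exists>r\<in>Q. \<forall>v. p v \<le> r v \<and> q v \<le> r v"
    and haus: "\<And>v. v \<noteq> 0 \<Longrightarrow> \<exists>p\<in>Q. p v \<noteq> 0"
    and nonneg: "\<And>p v. p \<in> Q \<Longrightarrow> 0 \<le> p v"
    and tri: "\<And>p v w. p \<in> Q \<Longrightarrow> p (v - w) \<le> p v + p w"
    and L: "\<And>v w. L (v - w) = L v - L w"
    and bounded: "\<And>p. p \<in> Q \<Longrightarrow> \<exists>C. \<forall>v. p (L v) \<le> C * p v"
    and below: "\<And>p. p \<in> Q \<Longrightarrow> \<exists>C. \<forall>v. p v \<le> C * p (L v)"
    and approx: "\<And>p e. p \<in> Q \<Longrightarrow> 0 < e \<Longrightarrow> \<exists>x. p (L x - y) < e"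
  shows "\<exists>x. L x = y"
proof (cases "Q = {}")
  case True
  then have "L y - y = 0" using haus by fastforce
  then show ?thesis by auto
next
  case False
  define U where "U = (\<lambda>(p, e). {x. p (L x - y) < (e::real)})"
  define I where "I = Q \<times> {0::real<..}"
  define F where "F = (INF i\<in>I. principal (U i))"
  have "I \<noteq> {}" using False by (auto simp: I_def)
  have sub: "\<exists>k\<in>I. principal (U k) \<le> inf (principal (U i)) (principal (U j))" if kk: "i \<in> I" "j \<in> I" for i j
  proof -
    obtain p d q e where ij: "i = (p, d)" "j = (q, e)" "p \<in> Q" "q \<in> Q" "d > 0" "e > 0"
      using kk unfolding I_def by (cases i; cases j) auto
    obtain r where r: "r \<in> Q" "\<And>v. p v \<le> r v \<and> q v \<le> r v" using dir ij by blast
    have "U (r, min d e) \<subseteq> U i \<inter> U j"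
      using r(2) by (auto simp: U_def ij intro: order_le_less_trans)
    moreover have "(r, min d e) \<in> I" using r ij by (auto simp: I_def)
    ultimately show ?thesis by (intro bexI[of _ "(r, min d e)"]) (auto simp: inf_principal)
  qed
  have "F \<noteq> bot"
    unfolding F_def using \<open>I \<noteq> {}\<close> sub approx
    by (subst INF_filter_bot_base) (auto simp: I_def U_def principal_eq_bot_iff)
  have evU: "eventually (\<lambda>x. p (L x - y) < e) F" if "p \<in> Q" "e > 0" for p e
    unfolding F_def using that
    by (intro eventually_INF1[of "(p, e)"]) (auto simp: I_def U_def eventually_principal)
  have "sn_cauchy Q F"
    unfolding sn_cauchy_def
  proof (intro ballI allI impI)
    fix p and e :: real assume p: "p \<in> Q" and e: "e > 0"
    obtain C0 where "\<And>v. p v \<le> C0 * p (L v)" using below[OF p] by blast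
    then have C: "p v \<le> (\<bar>C0\<bar> + 1) * p (L v)" for v
      using mult_right_mono[OF _ nonneg[OF p, of "L v"], of C0 "\<bar>C0\<bar> + 1"] by (smt (verit))
    define d where "d = e / (2 * (\<bar>C0\<bar> + 1))"
    have d: "d > 0" "(\<bar>C0\<bar> + 1) * (2 * d) = e" using e by (auto simp: d_def field_simps add_nonneg_pos)
    have "p (x - x') < e" if "p (L x - y) < d" "p (L x' - y) < d" for x x'
    proof -
      have "p (L (x - x')) \<le> p (L x - y) + p (L x' - y)"
        using tri[OF p, of "L x - y" "L x' - y"] by (simp add: L)
      then have "p (L (x - x')) < 2 * d" using that by linarith
      then have "(\<bar>C0\<bar> + 1) * p (L (x - x')) < (\<bar>C0\<bar> + 1) * (2 * d)" by (intro mult_strict_left_mono) auto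
      then show ?thesis using C[of "x - x'"] d by linarith
    qed
    then show "eventually (\<lambda>(x, y). p (x - y) < e) (F \<times>\<^sub>F F)"
      unfolding eventually_prod_filter using evU[OF p d(1)] by blast
  qed
  then obtain l where l: "sn_converges Q F l"
    using complete \<open>F \<noteq> bot\<close> unfolding sn_complete_def by blast
  have "p (L l - y) = 0" if p: "p \<in> Q" for p
  proof -
    obtain C0 where "\<And>v. p (L v) \<le> C0 * p v" using bounded[OF p] by blast
    then have C: "p (L v) \<le> \<bar>C0\<bar> * p v" for v
      using mult_right_mono[OF _ nonneg[OF p, of v], of C0 "\<bar>C0\<bar>"] by (smt (verit))
    have "p (L l - y) \<le> 0 + e" if e: "e > 0" for e
    proof -
      define d where "d = e / (\<bar>C0\<bar> + 1)"
      have C0: "\<bar>C0\<bar> + 1 > 0" by linarith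
      have "(\<bar>C0\<bar> + 1) * d = e" using C0 by (simp add: d_def)
      moreover have "d > 0" using e C0 by (simp add: d_def)
      ultimately have d: "d > 0" "\<bar>C0\<bar> * d + d = e" by (simp_all add: distrib_right)
      have "eventually (\<lambda>x. p (x - l) < d \<and> p (L x - y) < d) F"
        using l p d(1) unfolding sn_converges_def by (intro eventually_conj evU) blast+
      then obtain x where x: "p (x - l) < d" "p (L x - y) < d"
        using \<open>F \<noteq> bot\<close> eventually_happens' by blast
      have "p (L l - y) \<le> p (L x - y) + p (L (x - l))"
        using tri[OF p, of "L x - y" "L (x - l)"] by (simp add: L)
      also have "\<dots> \<le> d + \<bar>C0\<bar> * d"
        using x C[of "x - l"] mult_left_mono[of "p (x - l)" d "\<bar>C0\<bar>"] by linarith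
      finally show ?thesis using d by linarith
    qed
    then have "p (L l - y) \<le> 0" by (rule field_le_epsilon)
    then show ?thesis using nonneg[OF p, of "L l - y"] by simp
  qed
  then have "L l - y = 0" using haus by blast
  then show ?thesis by auto
qed

lemma sn_complete_sequence:
  fixes Q :: "('v::ab_group_add \<Rightarrow> real) set" and v :: "nat \<Rightarrow> 'v"
  assumes complete: "sn_complete Q"
    and cauchy: "\<And>p e. p \<in> Q \<Longrightarrow> 0 < e \<Longrightarrow> \<exists>n0. \<forall>m\<ge>n0. \<forall>n\<ge>n0. p (v m - v n) < e"
  shows "\<exists>l. \<forall>p\<in>Q. \<forall>e>0. \<exists>n0. \<forall>n\<ge>n0. p (v n - l) < e"
proof -
  let ?F = "filtermap v sequentially"
  have "sn_cauchy Q ?F"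
    unfolding sn_cauchy_def
  proof (intro ballI allI impI)
    fix p and e :: real assume "p \<in> Q" "e > 0"
    then obtain n0 where n0: "\<And>m n. m \<ge> n0 \<Longrightarrow> n \<ge> n0 \<Longrightarrow> p (v m - v n) < e" using cauchy by blast
    have ev: "eventually (\<lambda>x. x \<in> v ` {n0..}) ?F"
      unfolding eventually_filtermap by (rule eventually_sequentiallyI[of n0]) auto
    show "eventually (\<lambda>(x, y). p (x - y) < e) (?F \<times>\<^sub>F ?F)"
      unfolding eventually_prod_filter using ev n0
      by (intro exI[of _ "\<lambda>x. x \<in> v ` {n0..}"]) auto
  qed
  moreover have "?F \<noteq> bot" by (simp add: filtermap_bot_iff)
  ultimately obtain l where "sn_converges Q ?F l"
    using complete unfolding sn_complete_def by blast
  then show ?thesis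
    unfolding sn_converges_def eventually_filtermap eventually_sequentially by blast
qed

locale pro_cstar = star_alg sm st
  for sm :: "complex \<Rightarrow> 'a::ring \<Rightarrow> 'a" and st +
  fixes S :: "('a \<Rightarrow> real) set"
  assumes pro: "pro_cstar_algebra sm st S"
begin

lemma cstar_sn: "p \<in> S \<Longrightarrow> cstar_sn sm st p"
  using pro unfolding pro_cstar_algebra_def by unfold_locales blast

lemma eq_0_iff: "a = 0 \<longleftrightarrow> (\<forall>p\<in>S. p a = 0)"
proof
  show "a = 0 \<Longrightarrow> \<forall>p\<in>S. p a = 0" using cstar_sn cstar_sn.p_0 by blast
  show "\<forall>p\<in>S. p a = 0 \<Longrightarrow> a = 0" using pro unfolding pro_cstar_algebra_def by blast
qed

text \<open>This makes \<open>S\<close> directed: unlike the sum in general, the maximum satisfies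
  the C*-identity again, and \<open>S\<close> contains all continuous C*-seminorms.\<close>

lemma max_in_S:
  assumes "p \<in> S" "q \<in> S"
  shows "(\<lambda>a. max (p a) (q a)) \<in> S"
proof -
  interpret p: cstar_sn sm st p by (rule cstar_sn) fact
  interpret q: cstar_sn sm st q by (rule cstar_sn) fact
  have "cstar_seminorm sm st (\<lambda>a. max (p a) (q a))"
    unfolding cstar_seminorm_def
  proof (intro conjI allI)
    fix a b c
    show "0 \<le> max (p a) (q a)" by (simp add: le_max_iff_disj)
    show "max (p (a + b)) (q (a + b)) \<le> max (p a) (q a) + max (p b) (q b)"
      using p.p_add[of a b] q.p_add[of a b] by linarith
    show "max (p (sm c a)) (q (sm c a)) = cmod c * max (p a) (q a)"
      by (simp add: max_mult_distrib_left)
    have "p a * p b \<le> max (p a) (q a) * max (p b) (q b)" "q a * q b \<le> max (p a) (q a) * max (p b) (q b)"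
      by (intro mult_mono; simp add: le_max_iff_disj)+
    then show "max (p (a * b)) (q (a * b)) \<le> max (p a) (q a) * max (p b) (q b)"
      using p.p_mult[of a b] q.p_mult[of a b] by simp
    show "max (p (st a)) (q (st a)) = max (p a) (q a)" by simp
    show "max (p (st a * a)) (q (st a * a)) = (max (p a) (q a))\<^sup>2"
      unfolding p.p_cstar q.p_cstar
      by (metis max_absorb1 max_absorb2 nle_le p.p_nonneg power_mono q.p_nonneg)
  qed
  moreover have "seminorm_continuous S (\<lambda>a. max (p a) (q a))"
    unfolding seminorm_continuous_def
  proof (intro exI[of _ "{p, q}"] exI[of _ 1] conjI allI)
    fix a
    show "max (p a) (q a) \<le> 1 * (\<Sum>p\<in>{p, q}. p a)" by (cases "p = q") auto
  qed (use assms in auto)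
  ultimately show ?thesis using pro unfolding pro_cstar_algebra_def by blast
qed

text \<open>With positivity defined by \<open>b\<^sup>* b\<close>, antisymmetry of the order is not
  formal; it rests on Kaplansky's argument through \<open>kvpos_positive\<close>.\<close>

lemma positive_antisym:
  assumes "positive st a" "positive st b" "a + b = 0"
  shows "a = 0"
  unfolding eq_0_iff
proof
  fix p assume "p \<in> S"
  then interpret cstar_sn sm st p by (rule cstar_sn)
  show "p a = 0"
    using p_mono[OF assms(1) kvpos_positive[OF assms(2)]] assms(3) p_nonneg[of a] by simp
qed

lemma positive_scale:
  assumes "positive st a" "0 \<le> t"
  shows "positive st (sm (of_real t) a)"
proof -
  obtain b where "a = st b * b" using assms by (auto simp: positive_def)
  then have "sm (of_real t) a = st (sm (of_real (sqrt t)) b) * sm (of_real (sqrt t)) b"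
    using assms(2) by (simp add: of_real_mult[symmetric] del: of_real_mult)
  then show ?thesis unfolding positive_def by blast
qed

text \<open>\<open>c = a (1 + a)\<^sup>-\<^sup>1\<close>; in the absence of a unit, \<open>1 - c\<close> plays the role of \<open>(1 + a)\<^sup>-\<^sup>1\<close>.\<close>
lemma quasi_inverse:
  assumes a: "positive st a"
  obtains c where "c + a * c = a" "st c = c" "c * a = a * c"
    "\<And>p d. p \<in> S \<Longrightarrow> p (d - c * d) \<le> p d" "\<And>p. p \<in> S \<Longrightarrow> p c \<le> p a"
proof -
  have sta: "st a = a" using a by (auto simp: positive_def)
  have below: "p d \<le> p (d + a * d)" if "p \<in> S" for p d
  proof -
    interpret cstar_sn sm st p by (rule cstar_sn) fact
    obtain t where t: "t \<ge> 0" "left_bound t a t"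
      using kvpos_positive[OF a] unfolding kvpos_def by (meson max.cobounded1 max.cobounded2)
    \<comment> \<open>Writing \<open>1 + t\<close> as \<open>(1 + a) + (t - a)\<close>, with the
      second part of norm at most \<open>t\<close>, leaves the lower bound \<open>1\<close> for
      \<open>1 + a\<close>.\<close>
    have "sm (of_real (1 + t)) d = (d + a * d) + (sm (of_real t) d - a * d)"
      by (simp add: scale_left_distrib)
    then have "p (sm (of_real (1 + t)) d) \<le> p (d + a * d) + p (sm (of_real t) d - a * d)"
      using p_add by metis
    also have "\<dots> \<le> p (d + a * d) + t * p d" using t by (simp add: left_bound_def)
    finally show ?thesis using t(1) unfolding p_scale norm_of_real by (simp add: algebra_simps)
  qed
  have uniq: "d = 0" if "d + a * d = 0" for d
    unfolding eq_0_iff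
  proof
    fix p assume p: "p \<in> S"
    then interpret cstar_sn sm st p by (rule cstar_sn)
    show "p d = 0" using below[OF p, of d] that p_nonneg[of d] by simp
  qed
  have "\<exists>c. c + a * c = a"
  proof (rule sn_solve[where Q = S and L = "\<lambda>c. c + a * c"])
    show "sn_complete S" using pro by (simp add: pro_cstar_algebra_def)
    show "\<exists>r\<in>S. \<forall>v. p v \<le> r v \<and> q v \<le> r v" if "p \<in> S" "q \<in> S" for p q
      by (rule bexI[OF _ max_in_S[OF that]]) auto
    show "\<And>v. v \<noteq> 0 \<Longrightarrow> \<exists>p\<in>S. p v \<noteq> 0" using eq_0_iff by blast
    fix p assume p: "p \<in> S"
    then interpret cstar_sn sm st p by (rule cstar_sn)
    show "0 \<le> p v" for v by simp
    show "p (v - w) \<le> p v + p w" for v w by (rule p_diff)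
    have "p (v + a * v) \<le> (1 + p a) * p v" for v
      using p_add[of v "a * v"] p_mult[of a v] by (simp add: algebra_simps)
    then show "\<exists>C. \<forall>v. p (v + a * v) \<le> C * p v" by blast
    show "\<exists>C. \<forall>v. p v \<le> C * p (v + a * v)" using below[OF p] by (intro exI[of _ 1]) simp
    fix e :: real assume e: "0 < e"
    obtain t where t: "t \<ge> 0" "left_bound t a t"
      using kvpos_positive[OF a] unfolding kvpos_def by (meson max.cobounded1 max.cobounded2)
    let ?s = "complex_of_real (1 / (1 + t))"
    have "\<exists>c. p (c + a * c - a) \<le> (t / (1 + t)) ^ n * p a" for n
    proof (induction n)
      case 0
      show ?case by (intro exI[of _ 0]) simp
    next
      case (Suc n)
      then obtain c where c: "p (c + a * c - a) \<le> (t / (1 + t)) ^ n * p a" by blast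
      define r where "r = c + a * c - a"
      \<comment> \<open>Relaxed iteration: the residual is multiplied by
        \<open>(t - a) / (1 + t)\<close>, of norm at most \<open>t / (1 + t) < 1\<close>. The step
        size depends on \<open>t\<close> and thereby on \<open>p\<close>.\<close>
      define c' where "c' = c - sm ?s r"
      have "c' + a * c' - a = r - sm ?s (r + a * r)"
        by (simp add: c'_def r_def algebra_simps scale_right_distrib scale_right_diff_distrib)
      also have "\<dots> = sm ?s (sm (of_real (1 + t)) r) - sm ?s (r + a * r)"
        using t(1) by (simp add: of_real_mult[symmetric] del: of_real_mult of_real_add of_real_divide)
      also have "\<dots> = sm ?s (sm (of_real (1 + t)) r - (r + a * r))"
        by (simp only: scale_right_diff_distrib)
      also have "sm (of_real (1 + t)) r - (r + a * r) = sm (of_real t) r - a * r"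
        by (simp add: scale_left_distrib)
      finally have "p (c' + a * c' - a) = 1 / (1 + t) * p (sm (of_real t) r - a * r)"
        using t(1) by (simp add: norm_divide flip: of_real_add)
      also have "\<dots> \<le> 1 / (1 + t) * (t * p r)"
        using t by (intro mult_left_mono) (auto simp: left_bound_def)
      also have "\<dots> \<le> 1 / (1 + t) * (t * ((t / (1 + t)) ^ n * p a))"
        using c t by (intro mult_left_mono) (auto simp: r_def)
      finally show ?case by (intro exI[of _ c']) simp
    qed
    moreover have "(\<lambda>n. (t / (1 + t)) ^ n * p a) \<longlonglongrightarrow> 0 * p a"
      using t by (intro tendsto_intros LIMSEQ_power_zero) auto
    then have "eventually (\<lambda>n. (t / (1 + t)) ^ n * p a < e) sequentially"
      using e by (intro order_tendstoD) auto
    then obtain n where "(t / (1 + t)) ^ n * p a < e" by (auto simp: eventually_sequentially)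
    ultimately show "\<exists>x. p (x + a * x - a) < e" by (meson order_le_less_trans)
  qed (simp add: algebra_simps)
  then obtain c where c: "c + a * c = a" by blast
  have comm: "c * a = a * c"
  proof -
    have "(c * a - a * c) + a * (c * a - a * c) = (c + a * c) * a - a * (c + a * c)"
      by (simp add: algebra_simps)
    also have "\<dots> = 0" by (simp add: c)
    finally show ?thesis using uniq[of "c * a - a * c"] by simp
  qed
  have stc: "st c = c"
  proof -
    have "st (c + c * a) = a" using c comm sta by simp
    then have "st c + a * st c = a" by (simp add: sta)
    then have "(st c - c) + a * (st c - c) = 0" using c by (simp add: algebra_simps)
    then show ?thesis using uniq[of "st c - c"] by simp
  qed
  have b: "p (d - c * d) \<le> p d" if "p \<in> S" for p d
  proof -
    have "(d - c * d) + a * (d - c * d) = d + a * d - (c + a * c) * d" by (simp add: algebra_simps)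
    then have "(d - c * d) + a * (d - c * d) = d" by (simp add: c)
    then show ?thesis using below[OF that, of "d - c * d"] by simp
  qed
  have "p c \<le> p a" if "p \<in> S" for p using below[OF that, of c] c by simp
  then show ?thesis using that[OF c stc comm b] by blast
qed

end

section \<open>Hilbert modules\<close>

locale hilbert_mod = pro_cstar sm st S + M: vector_space smx
  for sm :: "complex \<Rightarrow> 'a::ring \<Rightarrow> 'a" and st S
    and smx :: "complex \<Rightarrow> 'x::ab_group_add \<Rightarrow> 'x" +
  fixes act :: "'a \<Rightarrow> 'x \<Rightarrow> 'x" and ip :: "'x \<Rightarrow> 'x \<Rightarrow> 'a"
  assumes hilbert_module: "hilbert_module sm st S smx act ip"
begin

lemma ip_add_left: "ip (x + y) z = ip x z + ip y z"
  and ip_scale_left: "ip (smx c x) y = sm c (ip x y)"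
  and ip_act_left: "ip (act a x) y = a * ip x y"
  and st_ip [simp]: "st (ip x y) = ip y x"
  and ip_positive: "positive st (ip x x)"
  and ip_definite: "ip x x = 0 \<Longrightarrow> x = 0"
  and complete: "sn_complete (hnorms S ip)"
  using hilbert_module unfolding hilbert_module_def by metis+

lemma ip_add_right: "ip x (y + z) = ip x y + ip x z"
  using arg_cong[OF ip_add_left[of y z x], of st] by simp

lemma ip_scale_right: "ip x (smx c y) = sm (cnj c) (ip x y)"
  using arg_cong[OF ip_scale_left[of c y x], of st] by simp

lemma ip_act_right: "ip x (act a y) = ip x y * st a"
  using arg_cong[OF ip_act_left[of a y x], of st] by simp

lemma ip_zero [simp]: "ip 0 y = 0" "ip x 0 = 0"
  using ip_add_left[of 0 0 y] ip_add_right[of x 0 0] by simp_all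

lemma ip_minus_left: "ip (- x) y = - ip x y"
  using ip_add_left[of x "- x" y] by (simp add: eq_neg_iff_add_eq_0 add.commute)

lemma ip_minus_right: "ip x (- y) = - ip x y"
  using ip_add_right[of x y "- y"] by (simp add: eq_neg_iff_add_eq_0 add.commute)

lemma ip_diff_left: "ip (x - y) z = ip x z - ip y z"
  using ip_add_left[of x "- y" z] by (simp add: ip_minus_left)

lemma ip_diff_right: "ip z (x - y) = ip z x - ip z y"
  using ip_add_right[of z x "- y"] by (simp add: ip_minus_right)

lemma ip_ext:
  assumes "\<And>z. ip z u = ip z v"
  shows "u = v"
  using ip_definite[of "u - v"] assms by (simp add: ip_diff_right)

abbreviation hn :: "('a \<Rightarrow> real) \<Rightarrow> 'x \<Rightarrow> real" where
  "hn p \<equiv> hnorm p ip"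

lemma hn_nonneg: "p \<in> S \<Longrightarrow> 0 \<le> hn p x"
  using cstar_sn.p_nonneg[OF cstar_sn] by (simp add: hnorm_def)

lemma hn_square: "p \<in> S \<Longrightarrow> (hn p x)\<^sup>2 = p (ip x x)"
  using cstar_sn.p_nonneg[OF cstar_sn] by (simp add: hnorm_def)

text \<open>Expanding \<open>D = \<langle>x - a y, x - a y\<rangle>\<close> with
  \<open>a = \<langle>x, y\<rangle> / s\<close> writes \<open>\<langle>x, x\<rangle>\<close> as
  \<open>s a (st a) + D + a (s - Z) (st a)\<close>. For \<open>s > p Z\<close> the last term is
  nearly \<open>st E * E\<close> by polynomial calculus in \<open>Z\<close>, so
  \<open>p_mono\<close> discards it together with \<open>D\<close>. The strict inequality serves the
  calculus and keeps \<open>s\<close> positive when \<open>Z = 0\<close>; finally \<open>s\<close>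
  tends to \<open>p Z\<close>.\<close>

lemma cauchy_schwarz:
  assumes p: "p \<in> S"
  shows "p (ip x y) \<le> hn p x * hn p y"
proof -
  interpret cstar_sn sm st p by (rule cstar_sn) fact
  define Z where "Z = ip y y"
  have stZ: "st Z = Z" by (simp add: Z_def)
  interpret Z: selfadjoint_operator sm "(*) Z" p "\<lambda>v w. st v * w" p "p Z"
    by (rule selfadjoint_mult_left[OF stZ])
  have main: "(p (ip x y))\<^sup>2 \<le> p (ip x x) * s" if s: "s > p Z" for s
  proof -
    have s0: "s > 0" using s p_nonneg[of Z] by linarith
    define a where "a = sm (of_real (1 / s)) (ip x y)"
    have xy: "ip x y = sm (of_real s) a" using s0 by (simp add: a_def)
    have yx: "ip y x = sm (of_real s) (st a)" using arg_cong[OF xy, of st] by simp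
    define D where "D = ip (x - act a y) (x - act a y)"
    have D: "ip x x = sm (of_real s) (a * st a) + D + a * Z.ev [:s, -1:] (st a)"
    proof -
      have "Z.ev [:s, -1:] (st a) = sm (of_real s) (st a) - Z * st a" by (simp add: Z.ev_pCons)
      then show ?thesis
        by (simp add: D_def ip_diff_left ip_diff_right ip_act_left ip_act_right xy yx Z_def[symmetric]
            left_diff_distrib right_diff_distrib mult.assoc)
    qed
    have "s * (p a)\<^sup>2 \<le> p (ip x x) + e" if e: "e > 0" for e
    proof -
      define \<epsilon> where "\<epsilon> = e / ((p a)\<^sup>2 + 1)"
      have pos: "(p a)\<^sup>2 + 1 > 0" by (simp add: add_nonneg_pos)
      have \<epsilon>: "\<epsilon> > 0" using e pos by (simp add: \<epsilon>_def)
      have "\<epsilon> * (p a)\<^sup>2 \<le> \<epsilon> * ((p a)\<^sup>2 + 1)" using \<epsilon> by (intro mult_left_mono) auto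
      also have "\<dots> = e" using pos by (simp add: \<epsilon>_def)
      finally have \<epsilon>a: "\<epsilon> * (p a)\<^sup>2 \<le> e" .
      have "0 \<le> poly [:s, -1:] x" if "\<bar>x\<bar> \<le> s" for x using that by auto
      from poly_sqrt_approx[OF this \<epsilon>] obtain g where g: "\<And>x. \<bar>x\<bar> \<le> s \<Longrightarrow> \<bar>(poly g x)\<^sup>2 - poly [:s, -1:] x\<bar> \<le> \<epsilon>"
        by blast
      define E where "E = Z.ev g (st a)"
      have "st E * E = st (st a) * Z.ev g E" unfolding E_def by (rule Z.B_ev)
      then have EE: "st E * E = a * Z.ev (g\<^sup>2) (st a)"
        unfolding power2_eq_square Z.ev_mult st_st by (simp only: E_def)
      have eq: "sm (of_real s) (a * st a) + (D + st E * E) = ip x x + a * Z.ev (g\<^sup>2 - [:s, -1:]) (st a)"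
        unfolding D EE Z.ev_minus right_diff_distrib by (simp only: algebra_simps add_diff_cancel)
      have "positive st (a * st a)" unfolding positive_def by (intro exI[of _ "st a"]) simp
      then have "positive st (sm (of_real s) (a * st a))" using s0 by (intro positive_scale) auto
      moreover have "kvpos (D + st E * E)"
        by (intro kvpos_add kvpos_positive) (auto simp: D_def ip_positive, auto simp: positive_def)
      ultimately have "p (sm (of_real s) (a * st a)) \<le> p (ip x x + a * Z.ev (g\<^sup>2 - [:s, -1:]) (st a))"
        unfolding eq[symmetric] by (rule p_mono)
      also have "\<dots> \<le> p (ip x x) + p a * p (Z.ev (g\<^sup>2 - [:s, -1:]) (st a))"
        by (meson add_left_mono order_trans p_add p_mult)
      also have "p (Z.ev (g\<^sup>2 - [:s, -1:]) (st a)) \<le> \<epsilon> * p (st a)"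
        using g by (intro Z.ev_le_sup[OF s]) auto
      then have "p a * p (Z.ev (g\<^sup>2 - [:s, -1:]) (st a)) \<le> p a * (\<epsilon> * p a)"
        by (intro mult_left_mono) auto
      also have "\<dots> \<le> e" using \<epsilon>a by (simp add: power2_eq_square mult_ac)
      finally show ?thesis using s0 by (simp add: p_cstar')
    qed
    then have "s * (p a)\<^sup>2 \<le> p (ip x x)" by (rule field_le_epsilon)
    then have "s * (s * (p a)\<^sup>2) \<le> s * p (ip x x)" using s0 by (intro mult_left_mono) auto
    moreover have "p (ip x y) = s * p a" unfolding xy using s0 by simp
    ultimately show ?thesis by (simp add: power_mult_distrib power2_eq_square mult_ac)
  qed
  have "(p (ip x y))\<^sup>2 \<le> p (ip x x) * p Z"
  proof (rule tendsto_lowerbound)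
    show "((\<lambda>s. p (ip x x) * s) \<longlongrightarrow> p (ip x x) * p Z) (at_right (p Z))" by (intro tendsto_intros)
    show "eventually (\<lambda>s. (p (ip x y))\<^sup>2 \<le> p (ip x x) * s) (at_right (p Z))"
      using main by (rule eventually_mono[OF eventually_at_right_less])
  qed (simp add: trivial_limit_at_right_real)
  then have "(p (ip x y))\<^sup>2 \<le> (hn p x * hn p y)\<^sup>2"
    by (simp add: power_mult_distrib hn_square[OF p] Z_def)
  then show ?thesis using hn_nonneg[OF p] by (meson mult_nonneg_nonneg power2_le_imp_le)
qed

lemma hn_add:
  assumes p: "p \<in> S"
  shows "hn p (x + y) \<le> hn p x + hn p y"
proof -
  interpret cstar_sn sm st p by (rule cstar_sn) fact
  have "(hn p (x + y))\<^sup>2 = p ((ip x x + ip x y) + (ip y x + ip y y))"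
    by (simp add: hn_square[OF p] ip_add_left ip_add_right algebra_simps)
  also have "\<dots> \<le> (p (ip x x) + p (ip x y)) + (p (ip y x) + p (ip y y))"
    by (meson add_mono order_trans p_add)
  also have "\<dots> \<le> ((hn p x)\<^sup>2 + hn p x * hn p y) + (hn p y * hn p x + (hn p y)\<^sup>2)"
    by (intro add_mono cauchy_schwarz p) (simp_all add: hn_square[OF p])
  also have "\<dots> = (hn p x + hn p y)\<^sup>2" by (simp add: power2_eq_square algebra_simps)
  finally show ?thesis using hn_nonneg[OF p] by (meson add_nonneg_nonneg power2_le_imp_le)
qed

lemma hn_scale:
  assumes p: "p \<in> S"
  shows "hn p (smx c x) = cmod c * hn p x"
proof -
  interpret cstar_sn sm st p by (rule cstar_sn) fact
  show ?thesis
    by (simp add: hnorm_def ip_scale_left ip_scale_right norm_mult real_sqrt_mult)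
qed

lemma hn_zero [simp]: "p \<in> S \<Longrightarrow> hn p 0 = 0"
  using hn_scale[of p 0 0] by simp

lemma hn_minus: "p \<in> S \<Longrightarrow> hn p (- x) = hn p x"
  using hn_scale[of p "-1" x] by simp

lemma hn_diff: "p \<in> S \<Longrightarrow> hn p (x - y) \<le> hn p x + hn p y"
  using hn_add[of p x "- y"] by (simp add: hn_minus)

lemma hn_sum: "p \<in> S \<Longrightarrow> hn p (sum f A) \<le> (\<Sum>i\<in>A. hn p (f i))"
proof (induction A rule: infinite_finite_induct)
  case (insert x F)
  then show ?case using hn_add[of p "f x" "sum f F"] by simp
qed auto

lemma hn_act:
  assumes p: "p \<in> S"
  shows "hn p (act a x) \<le> p a * hn p x"
proof -
  interpret cstar_sn sm st p by (rule cstar_sn) fact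
  have "(hn p (act a x))\<^sup>2 = p (a * (ip x x * st a))"
    by (simp add: hn_square[OF p] ip_act_left ip_act_right mult.assoc)
  also have "\<dots> \<le> p a * (p (ip x x) * p (st a))"
    by (meson mult_left_mono order_trans p_mult p_nonneg)
  also have "\<dots> = (p a * hn p x)\<^sup>2" by (simp add: power_mult_distrib hn_square[OF p] power2_eq_square[of "p a"])
  finally show ?thesis using hn_nonneg[OF p] by (meson mult_nonneg_nonneg p_nonneg power2_le_imp_le)
qed

lemma hn_eq_0: "x = 0" if "\<And>p. p \<in> S \<Longrightarrow> hn p x = 0"
proof -
  have "p (ip x x) = 0" if "p \<in> S" for p
    using hn_square[OF that, of x] \<open>\<And>p. p \<in> S \<Longrightarrow> hn p x = 0\<close>[OF that] by simp
  then show ?thesis using ip_definite eq_0_iff by blast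
qed

lemma selfadjoint_on_module:
  assumes p: "p \<in> S"
    and H: "\<And>v w. H (v + w) = H v + H w" "\<And>c v. H (smx c v) = smx c (H v)"
      "\<And>v w. ip (H v) w = ip v (H w)" "\<And>v. hn p (H v) \<le> r * hn p v" "0 \<le> r"
  shows "selfadjoint_operator smx H (hn p) ip p r"
  using H by unfold_locales
    (auto simp: hn_nonneg[OF p] hn_add[OF p] hn_scale[OF p] ip_add_left ip_add_right ip_scale_left
      ip_scale_right hn_square[OF p] cauchy_schwarz[OF p])

text \<open>With \<open>c = a (1 + a)\<^sup>-\<^sup>1\<close> and \<open>a = \<delta> \<langle>x, x\<rangle>\<close>, the vector \<open>(1 - c) x\<close> is bounded in all seminorms at
  once, and it is close to \<open>x\<close> in every seminorm in which \<open>x\<close> is small.\<close>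
lemma truncation:
  assumes \<delta>: "\<delta> > 0"
  obtains c where "\<And>q. q \<in> S \<Longrightarrow> hn q (x - act c x) \<le> sqrt (2 / \<delta>)"
    "\<And>q z. q \<in> S \<Longrightarrow> hn q (z - act c z) \<le> hn q z"
    "\<And>q. q \<in> S \<Longrightarrow> q c \<le> \<delta> * (hn q x)\<^sup>2"
proof -
  define a where "a = sm (of_real \<delta>) (ip x x)"
  have "positive st a" unfolding a_def using \<delta> ip_positive by (intro positive_scale) auto
  then obtain c where c: "c + a * c = a" "st c = c" "c * a = a * c"
    "\<And>p d. p \<in> S \<Longrightarrow> p (d - c * d) \<le> p d" "\<And>p. p \<in> S \<Longrightarrow> p c \<le> p a"
    using quasi_inverse by metis
  have xx: "ip x x = sm (of_real (1 / \<delta>)) a" using \<delta> by (simp add: a_def)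
  have ac: "a * c = a - c" using c(1) by (simp add: algebra_simps)
  \<comment> \<open>Formally \<open>(1 - c) a = c\<close>, so
    \<open>(1 - c) a (1 - c) = c (1 - c)\<close>. Since \<open>c\<close> is selfadjoint and
    \<open>1 - c\<close> contractive, \<open>q c \<le> 2\<close> in every seminorm, which is the
    origin of \<open>2 / \<delta>\<close>.\<close>
  have "ip (x - act c x) (x - act c x) = sm (of_real (1 / \<delta>)) (a - a * c - c * a + c * (a * c))"
    by (simp add: ip_diff_left ip_diff_right ip_act_left ip_act_right c(2) xx scale_right_diff_distrib
        scale_right_distrib left_diff_distrib mult.assoc)
  also have "a - a * c - c * a + c * (a * c) = c - c * c"
    unfolding c(3) ac right_diff_distrib by simp
  finally have x': "ip (x - act c x) (x - act c x) = sm (of_real (1 / \<delta>)) (c - c * c)" .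
  have b1: "hn q (x - act c x) \<le> sqrt (2 / \<delta>)" if q: "q \<in> S" for q
  proof -
    interpret cstar_sn sm st q by (rule cstar_sn) fact
    have "(q c)\<^sup>2 = q (c - (c - c * c))" using p_cstar[of c] c(2) by simp
    also have "\<dots> \<le> q c + q c" using p_diff[of c "c - c * c"] c(4)[OF q, of c] by linarith
    finally have "q c * q c \<le> 2 * q c" by (simp add: power2_eq_square)
    then have "q c \<le> 2" using p_nonneg[of c] by (metis less_eq_real_def mult_le_cancel_right_pos zero_le_numeral)
    then have "q (c - c * c) \<le> 2" using c(4)[OF q, of c] by linarith
    then have "q (ip (x - act c x) (x - act c x)) \<le> 2 / \<delta>"
      unfolding x' using \<delta> by (simp add: norm_divide divide_right_mono)
    then show ?thesis by (simp add: hnorm_def)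
  qed
  have b2: "hn q (z - act c z) \<le> hn q z" if q: "q \<in> S" for q z
  proof -
    interpret cstar_sn sm st q by (rule cstar_sn) fact
    \<comment> \<open>\<open>1 - c\<close> is known to be contractive as a left factor; the right
      factor is reached by passing to \<open>st w\<close>.\<close>
    define w where "w = ip z (z - act c z)"
    have "ip (z - act c z) (z - act c z) = w - c * w" by (simp add: w_def ip_diff_left ip_act_left)
    then have "q (ip (z - act c z) (z - act c z)) \<le> q (st w)" using c(4)[OF q, of w] by simp
    also have "st w = ip z z - c * ip z z" by (simp add: w_def ip_diff_left ip_act_left)
    also have "q \<dots> \<le> q (ip z z)" by (rule c(4)[OF q])
    finally show ?thesis by (simp add: hnorm_def)
  qed
  have b3: "q c \<le> \<delta> * (hn q x)\<^sup>2" if q: "q \<in> S" for q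
  proof -
    interpret cstar_sn sm st q by (rule cstar_sn) fact
    show ?thesis using c(5)[OF q] \<delta> by (simp add: a_def hn_square[OF q])
  qed
  show ?thesis using that[OF b1 b2 b3] .
qed

lemma module_solve:
  assumes L: "\<And>v w. L (v - w) = L v - L w"
    and bounded: "\<And>p. p \<in> S \<Longrightarrow> \<exists>C. \<forall>v. hn p (L v) \<le> C * hn p v"
    and below: "\<And>p. p \<in> S \<Longrightarrow> \<exists>C. \<forall>v. hn p v \<le> C * hn p (L v)"
    and approx: "\<And>p e. p \<in> S \<Longrightarrow> 0 < e \<Longrightarrow> \<exists>x. hn p (L x - y) < e"
  shows "\<exists>x. L x = y"
proof (rule sn_solve[OF complete])
  show "\<exists>r\<in>hnorms S ip. \<forall>v. p v \<le> r v \<and> q v \<le> r v" if pq: "p \<in> hnorms S ip" "q \<in> hnorms S ip" for p q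
  proof -
    obtain p' q' where p': "p' \<in> S" "p = hn p'" and q': "q' \<in> S" "q = hn q'"
      using pq by (auto simp: hnorms_def)
    have "hn (\<lambda>a. max (p' a) (q' a)) \<in> hnorms S ip"
      unfolding hnorms_def using max_in_S[OF p'(1) q'(1)] by blast
    then show ?thesis
      by (rule bexI[rotated]) (auto simp: p' q' hnorm_def)
  qed
  show "\<exists>p\<in>hnorms S ip. p v \<noteq> 0" if "v \<noteq> 0" for v
    using hn_eq_0[of v] that unfolding hnorms_def by blast
qed (use assms in \<open>auto simp: hnorms_def hn_nonneg hn_diff\<close>)

lemma module_sequence_complete:
  fixes v :: "nat \<Rightarrow> 'x"
  assumes "\<And>p e. p \<in> S \<Longrightarrow> 0 < e \<Longrightarrow> \<exists>n0. \<forall>m\<ge>n0. \<forall>n\<ge>n0. hn p (v m - v n) < e"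
  shows "\<exists>l. \<forall>p\<in>S. \<forall>e>0. \<exists>n0. \<forall>n\<ge>n0. hn p (v n - l) < e"
proof -
  have "\<exists>l. \<forall>p\<in>hnorms S ip. \<forall>e>0. \<exists>n0. \<forall>n\<ge>n0. p (v n - l) < e"
    using assms by (intro sn_complete_sequence[OF complete]) (auto simp: hnorms_def)
  then show ?thesis by (simp add: hnorms_def)
qed

end

section \<open>Injective operators with closed range\<close>

locale closed_range_operator = hilbert_mod +
  fixes T T' :: "'b \<Rightarrow> 'b" and C :: real
  assumes T_add: "T (x + y) = T x + T y"
    and T_scale: "T (smx c x) = smx c (T x)"
    and T_act: "T (act a x) = act a (T x)"
    and T_adj: "ip (T x) y = ip x (T' y)"
    and C: "C > 0"
    and T_bound: "p \<in> S \<Longrightarrow> hnorm p ip (T x) \<le> C * hnorm p ip x"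
    and T_inj: "T x = 0 \<Longrightarrow> x = 0"
    and T_closed: "sn_closure (hnorms S ip) (range T) \<subseteq> range T"
begin

lemma T'_adj: "ip (T' x) y = ip x (T y)"
  using arg_cong[OF T_adj[of y x], of st] by simp

lemma T'_add: "T' (x + y) = T' x + T' y"
  by (rule ip_ext) (simp add: T_adj[symmetric] ip_add_right)

lemma T'_scale: "T' (smx c x) = smx c (T' x)"
  by (rule ip_ext) (simp add: T_adj[symmetric] ip_scale_right)

lemma T'_act: "T' (act a x) = act a (T' x)"
  by (rule ip_ext) (simp add: T_adj[symmetric] ip_act_right)

lemma T_diff: "T (x - y) = T x - T y"
  using T_add[of "x - y" y] by (simp add: algebra_simps)

lemma T'_diff: "T' (x - y) = T' x - T' y"
  using T'_add[of "x - y" y] by (simp add: algebra_simps)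

lemma T'_bound:
  assumes p: "p \<in> S"
  shows "hn p (T' x) \<le> C * hn p x"
proof -
  have "hn p (T' x) * hn p (T' x) = p (ip x (T (T' x)))"
    by (simp add: hn_square[OF p, symmetric] power2_eq_square[symmetric] T'_adj[symmetric])
  also have "\<dots> \<le> hn p x * (C * hn p (T' x))"
    using cauchy_schwarz[OF p, of x "T (T' x)"] mult_left_mono[OF T_bound[OF p, of "T' x"] hn_nonneg[OF p, of x]]
    by linarith
  finally have "hn p (T' x) * hn p (T' x) \<le> (C * hn p x) * hn p (T' x)" by (simp add: mult_ac)
  then show ?thesis using hn_nonneg[OF p] C
    by (metis less_eq_real_def mult_le_cancel_right_pos mult_nonneg_nonneg)
qed

definition h :: "'b \<Rightarrow> 'b" where "h x = T' (T x)"

sublocale H: linear_operator smx h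
  by unfold_locales (simp_all add: h_def T_add T'_add T_scale T'_scale)

lemma h_act: "h (act a x) = act a (h x)"
  by (simp add: h_def T_act T'_act)

lemma h_inj: "h x = 0 \<Longrightarrow> x = 0"
proof (rule T_inj, rule ip_definite)
  assume "h x = 0"
  then show "ip (T x) (T x) = 0" by (simp add: T_adj h_def[symmetric])
qed

text \<open>One number strictly above the bound \<open>C^2\<close> of \<open>h\<close>, valid in all
  seminorms, so that the polynomials built from it do not depend on the seminorm.\<close>

definition r :: real where "r = C\<^sup>2 + 1"

lemma r_pos: "r > 0" by (simp add: r_def add_nonneg_pos)

lemma h_bound:
  assumes p: "p \<in> S"
  shows "hn p (h x) \<le> C\<^sup>2 * hn p x"
proof -
  have "hn p (h x) \<le> C * hn p (T x)" unfolding h_def by (rule T'_bound[OF p])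
  also have "\<dots> \<le> C * (C * hn p x)" using C by (intro mult_left_mono T_bound p) auto
  finally show ?thesis by (simp add: power2_eq_square)
qed

lemma h_ev_bound:
  assumes p: "p \<in> S" and M: "\<And>x. \<bar>x\<bar> \<le> r \<Longrightarrow> \<bar>poly f x\<bar> \<le> M"
  shows "hn p (H.ev f v) \<le> M * hn p v"
proof -
  interpret selfadjoint_operator smx h "hn p" ip p "C\<^sup>2"
    by (rule selfadjoint_on_module[OF p])
      (simp_all add: H.H_add H.H_scale h_bound[OF p], simp add: h_def T_adj T'_adj)
  show ?thesis using M by (intro ev_le_sup[of r]) (auto simp: r_def)
qed

text \<open>On \<open>[-r, r]\<close>, \<open>cut m\<close> is \<open>1\<close> at \<open>0\<close> and tends to \<open>0\<close> elsewhere; \<open>1 - cut m\<close> is divisible by \<open>x\<close>.\<close>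
definition cut :: "nat \<Rightarrow> real poly" where
  "cut m = [:1, 0, - (1 / r\<^sup>2):] ^ m"

definition cut_quot :: "nat \<Rightarrow> real poly" where
  "cut_quot m = [:0, 1 / r\<^sup>2:] * (\<Sum>j<m. cut j)"

lemma poly_cut: "poly (cut m) x = (1 - (x / r)\<^sup>2) ^ m"
  by (simp add: cut_def power2_eq_square)

lemma poly_cut_bounds:
  assumes "\<bar>x\<bar> \<le> r"
  shows "0 \<le> poly (cut m) x" "poly (cut m) x \<le> 1"
proof -
  have "\<bar>x / r\<bar> \<le> 1" using assms r_pos by simp
  then have "(x / r)\<^sup>2 \<le> 1" by (simp add: abs_square_le_1)
  then show "0 \<le> poly (cut m) x" "poly (cut m) x \<le> 1"
    unfolding poly_cut by (auto intro!: power_le_one)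
qed

lemma one_minus_cut: "1 - cut m = [:0, 1:] * cut_quot m"
proof -
  have "1 - cut m = (1 - [:1, 0, - (1 / r\<^sup>2):]) * (\<Sum>j<m. cut j)"
    unfolding cut_def by (rule one_diff_power_eq)
  also have "1 - [:1, 0, - (1 / r\<^sup>2):] = [:0, 1:] * [:0, 1 / r\<^sup>2:]" by (simp add: one_pCons)
  finally show ?thesis by (simp only: cut_quot_def mult.assoc)
qed

lemma ev_one_minus_cut: "v - H.ev (cut m) v = H.ev (cut_quot m) (h v)"
proof -
  have "v - H.ev (cut m) v = H.ev (1 - cut m) v" by (simp add: H.ev_minus)
  also have "\<dots> = H.ev (cut_quot m * [:0, 1:]) v" unfolding one_minus_cut by (simp only: mult.commute)
  finally show ?thesis by (simp only: H.ev_mult H.ev_X)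
qed

text \<open>As \<open>1 - cut m\<close> is \<open>x\<close> times \<open>cut_quot m\<close>, this
  bounds \<open>v - cut m v\<close> by \<open>m / r\<close> times \<open>h v\<close>: the complement
  of the cut hardly sees vectors on which \<open>h\<close> is small.\<close>

lemma hn_cut_quot:
  assumes p: "p \<in> S"
  shows "hn p (H.ev (cut_quot m) v) \<le> real m / r * hn p v"
proof (rule h_ev_bound[OF p])
  fix x :: real assume x: "\<bar>x\<bar> \<le> r"
  have "\<bar>poly (\<Sum>j<m. cut j) x\<bar> \<le> (\<Sum>j<m. \<bar>poly (cut j) x\<bar>)" by (simp add: poly_sum)
  also have "\<dots> \<le> (\<Sum>j<m. 1)" using poly_cut_bounds[OF x] by (intro sum_mono) auto
  finally have "\<bar>poly (\<Sum>j<m. cut j) x\<bar> \<le> real m" by simp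
  moreover have "\<bar>x / r\<^sup>2\<bar> \<le> r / r\<^sup>2" using x r_pos by (simp add: divide_right_mono)
  ultimately have "\<bar>x / r\<^sup>2\<bar> * \<bar>poly (\<Sum>j<m. cut j) x\<bar> \<le> r / r\<^sup>2 * real m"
    using r_pos by (intro mult_mono) auto
  then show "\<bar>poly (cut_quot m) x\<bar> \<le> real m / r"
    using r_pos by (simp add: cut_quot_def abs_mult power2_eq_square)
qed

lemma hn_one_minus_cut:
  assumes p: "p \<in> S"
  shows "hn p (v - H.ev (cut m) v) \<le> hn p v"
proof -
  have "hn p (H.ev (1 - cut m) v) \<le> 1 * hn p v"
    using poly_cut_bounds by (intro h_ev_bound[OF p]) (auto simp: abs_le_iff algebra_simps intro: order_trans)
  then show ?thesis by (simp add: H.ev_minus)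
qed

text \<open>The counterpart: \<open>cut m\<close> nearly annihilates the range of \<open>h\<close>,
  since \<open>y (1 - y)^(2 m) \<le> 1 / (2 m)\<close> for \<open>y = (x / r)^2\<close>.\<close>

lemma hn_h_cut:
  assumes p: "p \<in> S" and m: "m > 0"
  shows "hn p (H.ev (cut m) (h v)) \<le> r / sqrt (real m) * hn p v"
proof -
  have "hn p (H.ev (cut m * [:0, 1:]) v) \<le> r / sqrt (real m) * hn p v"
  proof (rule h_ev_bound[OF p])
    fix x :: real assume x: "\<bar>x\<bar> \<le> r"
    define y where "y = (x / r)\<^sup>2"
    have "\<bar>x / r\<bar> \<le> 1" using x r_pos by simp
    then have y: "0 \<le> y" "y \<le> 1" by (simp_all add: y_def abs_square_le_1)
    have "y * ((1 - y) ^ m)\<^sup>2 = y * (1 - y) ^ (2 * m)" by (simp add: power_mult[symmetric] mult.commute)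
    also have "\<dots> \<le> 1 / real (2 * m)" using y m by (intro mult_power_one_minus_le) auto
    also have "\<dots> \<le> 1 / real m" using m by (simp add: field_simps)
    finally have "(x / r * (1 - y) ^ m)\<^sup>2 \<le> 1 / real m" by (simp only: y_def power_mult_distrib)
    then have "sqrt ((x / r * (1 - y) ^ m)\<^sup>2) \<le> sqrt (1 / real m)" by (rule real_sqrt_le_mono)
    then have "\<bar>x / r * (1 - y) ^ m\<bar> \<le> sqrt (1 / real m)" by (simp only: real_sqrt_abs)
    then have "\<bar>x * (1 - y) ^ m\<bar> \<le> r * sqrt (1 / real m)"
      using r_pos by (simp add: abs_mult field_simps)
    then show "\<bar>poly (cut m * [:0, 1:]) x\<bar> \<le> r / sqrt (real m)"
      by (simp add: poly_cut y_def real_sqrt_divide mult.commute)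
  qed
  then show ?thesis by (simp only: H.ev_mult H.ev_X)
qed

section \<open>Construction of the humps\<close>

lemma small_inverse_sqrt:
  assumes "e > 0"
  shows "\<exists>m0>0. \<forall>m\<ge>m0. K / sqrt (real m) < (e::real)"
proof -
  have "(\<lambda>m. K / sqrt (real m)) \<longlonglongrightarrow> 0" by real_asymp
  then have "eventually (\<lambda>m. K / sqrt (real m) < e) sequentially"
    using assms by (rule order_tendstoD)
  then obtain m0 where "\<And>m. m \<ge> m0 \<Longrightarrow> K / sqrt (real m) < e" by (auto simp: eventually_sequentially)
  then show ?thesis by (intro exI[of _ "Suc m0"]) auto
qed

text \<open>Without a gap there is \<open>u0\<close> in the range of \<open>h\<close> with norm
  \<open>1\<close> and \<open>h u0\<close> tiny, but only in \<open>p\<close>. Truncating with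
  respect to \<open>u0\<close> bounds the vector in all seminorms, and truncating with respect to
  \<open>h u1\<close> makes its image under \<open>h\<close> small in all of them. Each truncation
  costs at most \<open>1/8\<close> in \<open>p\<close>.\<close>

lemma hump:
  assumes p: "p \<in> S" and nogap: "\<And>K. \<exists>x. hn p (h x) > K * hn p (h (h x))" and \<epsilon>: "\<epsilon> > 0"
  shows "\<exists>u m. m0 \<le> m \<and> 0 < m \<and> (\<forall>q\<in>S. hn q u \<le> 4) \<and> (\<forall>q\<in>S. hn q (h u) \<le> \<epsilon>)
    \<and> 1 / 2 \<le> hn p (u - H.ev (cut m) u)"
proof -
  define \<eta> where "\<eta> = \<epsilon> / 4"
  have \<eta>: "\<eta> > 0" using \<epsilon> by (simp add: \<eta>_def)
  obtain x' where x': "hn p (h x') > (1 / \<eta>) * hn p (h (h x'))" using nogap by blast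
  define s where "s = hn p (h x')"
  have "0 \<le> (1 / \<eta>) * hn p (h (h x'))" using \<eta> hn_nonneg[OF p] by (intro mult_nonneg_nonneg) auto
  then have s: "s > 0" using x' by (simp add: s_def)
  define x where "x = smx (of_real (1 / s)) x'"
  define u0 where "u0 = h x"
  have u0: "hn p u0 = 1" using s by (simp add: u0_def x_def H.H_scale hn_scale[OF p] norm_divide s_def[symmetric])
  have hu0: "hn p (h u0) \<le> \<eta>"
  proof -
    have "hn p (h u0) = 1 / s * hn p (h (h x'))"
      using s by (simp add: u0_def x_def H.H_scale hn_scale[OF p] norm_divide)
    also have "\<dots> \<le> \<eta>" using x' s \<eta> by (simp add: s_def[symmetric] field_simps)
    finally show ?thesis .
  qed
  obtain c where c: "\<And>q. q \<in> S \<Longrightarrow> hn q (u0 - act c u0) \<le> sqrt (2 / (1/8))"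
    "\<And>q z. q \<in> S \<Longrightarrow> hn q (z - act c z) \<le> hn q z"
    "\<And>q. q \<in> S \<Longrightarrow> q c \<le> 1/8 * (hn q u0)\<^sup>2"
    using truncation[of "1/8" u0] by (metis zero_less_divide_1_iff zero_less_numeral)
  define u1 where "u1 = u0 - act c u0"
  have hu1: "h u1 = h u0 - act c (h u0)" by (simp add: u1_def H.H_diff h_act)
  have hu1': "hn p (h u1) \<le> \<eta>" unfolding hu1 using c(2)[OF p, of "h u0"] hu0 by linarith
  \<comment> \<open>Chosen so that \<open>\<delta> \<eta>^2 = 1/8\<close>, the admissible loss in
    \<open>p\<close>, while \<open>sqrt (2 / \<delta>) = 4 \<eta> = \<epsilon>\<close>.\<close>
  define \<delta> where "\<delta> = 1 / (8 * \<eta>\<^sup>2)"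
  have \<delta>: "\<delta> > 0" using \<eta> by (simp add: \<delta>_def)
  obtain c' where c': "\<And>q. q \<in> S \<Longrightarrow> hn q (h u1 - act c' (h u1)) \<le> sqrt (2 / \<delta>)"
    "\<And>q z. q \<in> S \<Longrightarrow> hn q (z - act c' z) \<le> hn q z"
    "\<And>q. q \<in> S \<Longrightarrow> q c' \<le> \<delta> * (hn q (h u1))\<^sup>2"
    using truncation[OF \<delta>, of "h u1"] by metis
  define u where "u = u1 - act c' u1"
  have hu: "h u = h u1 - act c' (h u1)" by (simp add: u_def H.H_diff h_act)
  have "sqrt 16 = (4::real)" by (rule real_sqrt_unique) auto
  then have b1: "hn q u \<le> 4" if "q \<in> S" for q
    unfolding u_def using c'(2)[OF that, of u1] c(1)[OF that] by (simp add: u1_def)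
  have "2 / \<delta> = (4 * \<eta>)\<^sup>2" by (simp add: \<delta>_def power2_eq_square)
  then have "sqrt (2 / \<delta>) = \<epsilon>" using \<eta> by (simp add: \<eta>_def)
  then have b2: "hn q (h u) \<le> \<epsilon>" if "q \<in> S" for q unfolding hu using c'(1)[OF that] by simp
  have pc: "p c \<le> 1/8" using c(3)[OF p] u0 by simp
  have pc': "p c' \<le> 1/8"
  proof -
    have "\<delta> * (hn p (h u1))\<^sup>2 \<le> \<delta> * \<eta>\<^sup>2"
      using \<delta> hu1' hn_nonneg[OF p] by (intro mult_left_mono power_mono) auto
    also have "\<dots> = 1/8" using \<eta> by (simp add: \<delta>_def)
    finally show ?thesis using c'(3)[OF p] by linarith
  qed
  have u1': "hn p u1 \<le> 1" using c(2)[OF p, of u0] u0 by (simp add: u1_def)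
  have "u0 = u + act c' u1 + act c u0" by (simp add: u_def u1_def)
  then have "hn p u0 \<le> hn p u + hn p (act c' u1) + hn p (act c u0)"
    using hn_add[OF p, of "u + act c' u1" "act c u0"] hn_add[OF p, of u "act c' u1"] by simp
  moreover have "hn p (act c' u1) \<le> 1/8 * 1"
    using hn_act[OF p, of c' u1] mult_mono[OF pc' u1' _ hn_nonneg[OF p]] by simp
  moreover have "hn p (act c u0) \<le> 1/8" using hn_act[OF p, of c u0] pc u0 by simp
  ultimately have u34: "hn p u \<ge> 3/4" using u0 by linarith
  \<comment> \<open>Truncation commutes with \<open>h\<close>, so \<open>u\<close> remains in the
    range of \<open>h\<close>, where large cuts are small.\<close>
  define x2 where "x2 = (x - act c x) - act c' (x - act c x)"
  have ux2: "u = h x2" by (simp add: x2_def u_def u1_def u0_def H.H_diff h_act)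
  obtain m1 where m1: "m1 > 0" "\<And>m. m \<ge> m1 \<Longrightarrow> (r * hn p x2) / sqrt (real m) < 1/4"
    using small_inverse_sqrt[of "1/4" "r * hn p x2"] by auto
  define m where "m = max m0 m1"
  have m: "m0 \<le> m" "0 < m" using m1 by (auto simp: m_def)
  have "r / sqrt (real m) * hn p x2 < 1/4"
    using m1(2)[of m] unfolding times_divide_eq_left by (simp add: m_def)
  then have "hn p (H.ev (cut m) u) \<le> 1/4"
    unfolding ux2 using hn_h_cut[OF p m(2), of x2] by linarith
  moreover have "hn p u \<le> hn p (u - H.ev (cut m) u) + hn p (H.ev (cut m) u)"
    using hn_add[OF p, of "u - H.ev (cut m) u" "H.ev (cut m) u"] by simp
  ultimately have "1/2 \<le> hn p (u - H.ev (cut m) u)" using u34 by linarith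
  with b1 b2 m show ?thesis by blast
qed

lemma limit_in_range:
  assumes lim: "\<And>p e. p \<in> S \<Longrightarrow> e > 0 \<Longrightarrow> \<exists>n0::nat. \<forall>n\<ge>n0. hn p (T (v n) - y) < e"
  shows "y \<in> range T"
proof -
  have "y \<in> sn_closure (hnorms S ip) (range T)"
    unfolding sn_closure_def
  proof (intro CollectI allI impI)
    fix F :: "('b \<Rightarrow> real) set" and e :: real
    assume F: "finite F \<and> F \<subseteq> hnorms S ip" and e: "e > 0"
    have "eventually (\<lambda>n. \<forall>q\<in>F. q (y - T (v n)) < e) sequentially"
    proof (rule eventually_ball_finite)
      show "finite F" using F by blast
      show "\<forall>q\<in>F. eventually (\<lambda>n. q (y - T (v n)) < e) sequentially"
      proof
        fix q assume "q \<in> F"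
        then obtain p where p: "p \<in> S" "q = hn p" using F by (auto simp: hnorms_def)
        have "hn p (y - T (v n)) = hn p (T (v n) - y)" for n
          using hn_minus[OF p(1), of "T (v n) - y"] by simp
        then show "eventually (\<lambda>n. q (y - T (v n)) < e) sequentially"
          using lim[OF p(1) e] unfolding p(2) eventually_sequentially by simp
      qed
    qed
    then obtain n where "\<forall>q\<in>F. q (y - T (v n)) < e" by (auto simp: eventually_sequentially)
    then show "\<exists>y'\<in>range T. \<forall>q\<in>F. q (y - y') < e" by blast
  qed
  then show ?thesis using T_closed by blast
qed

end

context hilbert_mod
begin

lemma geometric_series_converges:
  fixes w :: "nat \<Rightarrow> 'x"
  assumes w: "\<And>p k. p \<in> S \<Longrightarrow> hn p (w k) \<le> (1/2) ^ k"
  shows "\<exists>l. \<forall>p\<in>S. \<forall>e>0. \<exists>n0. \<forall>n\<ge>n0. hn p ((\<Sum>k<n. w k) - l) < e"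
proof (rule module_sequence_complete)
  fix p and e :: real assume p: "p \<in> S" and e: "e > 0"
  have le: "hn p ((\<Sum>k<N + j. w k) - (\<Sum>k<N. w k)) \<le> 2 * (1/2) ^ N - 2 * (1/2) ^ (N + j)" for N j
  proof (induction j)
    case 0
    show ?case using p by simp
  next
    case (Suc j)
    have "(\<Sum>k<N + Suc j. w k) - (\<Sum>k<N. w k) = ((\<Sum>k<N + j. w k) - (\<Sum>k<N. w k)) + w (N + j)"
      by simp
    then have "hn p ((\<Sum>k<N + Suc j. w k) - (\<Sum>k<N. w k)) \<le> hn p ((\<Sum>k<N + j. w k) - (\<Sum>k<N. w k)) + hn p (w (N + j))"
      using hn_add[OF p] by metis
    also have "\<dots> \<le> (2 * (1/2) ^ N - 2 * (1/2) ^ (N + j)) + (1/2) ^ (N + j)"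
      by (intro add_mono Suc w p)
    finally show ?case by simp
  qed
  have le': "hn p ((\<Sum>k<m. w k) - (\<Sum>k<n. w k)) \<le> 2 * (1/2) ^ n" if "n \<le> m" for m n
  proof -
    define j where "j = m - n"
    have j: "m = n + j" using that by (simp add: j_def)
    have "0 \<le> (1/2 :: real) ^ (n + j)" by simp
    then show ?thesis using le[of n j] unfolding j by linarith
  qed
  have "(\<lambda>n. 2 * (1/2 :: real) ^ n) \<longlonglongrightarrow> 0" by real_asymp
  then have "eventually (\<lambda>n. 2 * (1/2 :: real) ^ n < e) sequentially" using e by (rule order_tendstoD)
  then obtain n0 where n0: "\<And>n. n \<ge> n0 \<Longrightarrow> 2 * (1/2 :: real) ^ n < e" by (auto simp: eventually_sequentially)
  have "hn p ((\<Sum>k<m. w k) - (\<Sum>k<n. w k)) < e" if "m \<ge> n0" "n \<ge> n0" for m n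
  proof (cases "n \<le> m")
    case True
    then show ?thesis using le'[of n m] n0[of n] that by linarith
  next
    case False
    then have "hn p ((\<Sum>k<n. w k) - (\<Sum>k<m. w k)) < e" using le'[of m n] n0[of m] that by linarith
    then show ?thesis using hn_minus[OF p, of "(\<Sum>k<n. w k) - (\<Sum>k<m. w k)"] by simp
  qed
  then show "\<exists>n0. \<forall>m\<ge>n0. \<forall>n\<ge>n0. hn p ((\<Sum>k<m. w k) - (\<Sum>k<n. w k)) < e" by blast
qed

end

section \<open>Spectral gap and inversion of \<open>h\<close>\<close>

context closed_range_operator
begin

lemma T_sum: "T (sum f A) = (\<Sum>i\<in>A. T (f i))"
proof (induction A rule: infinite_finite_induct)
  case empty
  show ?case using T_diff[of 0 0] by simp
qed (use T_diff[of 0 0] T_add in auto)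

text \<open>Gliding hump: if the spectrum of \<open>h = T\<^sup>* T\<close> accumulated at \<open>0\<close> in the seminorm \<open>p\<close>, then a convergent
  series of elements \<open>33\<^sup>k T u\<^sub>k\<close>, with \<open>u\<^sub>k\<close> living ever closer to \<open>0\<close>, would have its sum in the
  range of \<open>T\<close>, and the preimage would have infinite \<open>p\<close>-norm.\<close>
lemma spectral_gap:
  assumes p: "p \<in> S"
  shows "\<exists>K. \<forall>x. hn p (h x) \<le> K * hn p (h (h x))"
proof (rule ccontr)
  assume "\<nexists>K. \<forall>x. hn p (h x) \<le> K * hn p (h (h x))"
  then have nogap: "\<exists>x. hn p (h x) > K * hn p (h (h x))" for K by (simp add: not_le)
  \<comment> \<open>\<open>4356 = 66^2\<close>: since
    \<open>||T u||^2 \<le> ||u|| ||h u|| \<le> 4 \<kappa>\<close>, the vector \<open>T (u k)\<close>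
    has size at most \<open>66^-k\<close> and its multiple by \<open>33^k\<close> at most
    \<open>2^-k\<close>. The ratio \<open>33\<close> lets a hump of weight \<open>33^n / 2\<close>
    beat all earlier ones, whose total is at most \<open>33^n / 8\<close>. The
    \<open>min 1 r\<close> absorbs a later division by \<open>r\<close>.\<close>
  define \<kappa> where "\<kappa> n = min 1 r / (4 * 4356 ^ n)" for n :: nat
  have \<kappa>: "\<kappa> n > 0" for n using r_pos by (simp add: \<kappa>_def)
  define P where "P n z = (case z of (u, m) \<Rightarrow> 0 < m \<and> (\<forall>q\<in>S. hn q u \<le> 4) \<and> (\<forall>q\<in>S. hn q (h u) \<le> \<kappa> n)
     \<and> 1 / 2 \<le> hn p (u - H.ev (cut m) u))" for n :: nat and z :: "'b \<times> nat"
  \<comment> \<open>Filtering with \<open>1 - cut m\<close> costs a factor \<open>m / r\<close> on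
    \<open>h u\<close>, so each hump must be small relative to the \<open>m\<close> of its
    predecessor.\<close>
  define Q where "Q n z z' = (snd z \<le> snd z' \<and> (\<forall>q\<in>S. hn q (h (fst z')) \<le> \<kappa> (Suc n) / real (snd z)))"
    for n :: nat and z z' :: "'b \<times> nat"
  have "\<exists>F. \<forall>n. P n (F n) \<and> Q n (F n) (F (Suc n))"
  proof (rule dependent_nat_choice)
    show "\<exists>z. P 0 z" using hump[OF p nogap \<kappa>[of 0], of 0] by (auto simp: P_def)
    fix z n assume z: "P n z"
    obtain u m where zum: "z = (u, m)" by (cases z)
    have m: "m > 0" using z by (simp add: P_def zum)
    have pos: "\<kappa> (Suc n) / real m > 0" using \<kappa> m by simp
    obtain u' m' where um: "m \<le> m'" "0 < m'" "\<forall>q\<in>S. hn q u' \<le> 4" "\<forall>q\<in>S. hn q (h u') \<le> \<kappa> (Suc n) / real m"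
      "1 / 2 \<le> hn p (u' - H.ev (cut m') u')"
      using hump[OF p nogap pos, of m] by blast
    have "\<kappa> (Suc n) / real m \<le> \<kappa> (Suc n)" using \<kappa>[of "Suc n"] m by (simp add: divide_le_eq)
    then have "P (Suc n) (u', m')" using um by (force simp: P_def)
    moreover have "Q n z (u', m')" using um by (simp add: Q_def zum)
    ultimately show "\<exists>z'. P (Suc n) z' \<and> Q n z z'" by blast
  qed
  then obtain F where F: "\<And>n. P n (F n)" "\<And>n. Q n (F n) (F (Suc n))" by blast
  define u where "u n = fst (F n)" for n
  define m where "m n = snd (F n)" for n
  have m0: "0 < m n" and u4: "q \<in> S \<Longrightarrow> hn q (u n) \<le> 4" and hu: "q \<in> S \<Longrightarrow> hn q (h (u n)) \<le> \<kappa> n"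
    and half: "1 / 2 \<le> hn p (u n - H.ev (cut (m n)) (u n))" for n q
    using F(1)[of n] by (auto simp: P_def u_def m_def split: prod.splits)
  have "incseq m" using F(2) by (auto simp: Q_def m_def intro: incseq_SucI)
  have hu': "hn q (h (u k)) \<le> \<kappa> k / real (m n)" if "q \<in> S" "n < k" for q n k
  proof -
    obtain k' where k': "k = Suc k'" "n \<le> k'" using \<open>n < k\<close> by (cases k) auto
    have "hn q (h (u k)) \<le> \<kappa> k / real (m k')" using F(2)[of k'] that by (simp add: Q_def u_def m_def k')
    also have "\<dots> \<le> \<kappa> k / real (m n)"
      using \<open>incseq m\<close> k' m0[of n] m0[of k'] \<kappa>[of k] by (intro divide_left_mono) (auto simp: incseq_def)
    finally show ?thesis .
  qed
  define w where "w k = smx (of_real (33 ^ k)) (u k)" for k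
  have Tw: "hn q (T (w k)) \<le> (1/2) ^ k" if q: "q \<in> S" for q k
  proof -
    have "(hn q (T (u k)))\<^sup>2 = q (ip (u k) (h (u k)))" by (simp add: hn_square[OF q] T_adj h_def)
    also have "\<dots> \<le> hn q (u k) * hn q (h (u k))" by (rule cauchy_schwarz[OF q])
    also have "\<dots> \<le> 4 * \<kappa> k" using u4[OF q] hu[OF q] hn_nonneg[OF q] by (intro mult_mono) auto
    also have "\<dots> \<le> 1 / 4356 ^ k" by (simp add: \<kappa>_def divide_right_mono)
    finally have *: "(hn q (T (u k)))\<^sup>2 \<le> 1 / 4356 ^ k" .
    have "(hn q (T (w k)))\<^sup>2 = (33 ^ k)\<^sup>2 * (hn q (T (u k)))\<^sup>2"
      by (simp add: w_def T_scale hn_scale[OF q] power_mult_distrib norm_power)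
    also have "\<dots> \<le> (33 ^ k)\<^sup>2 * (1 / 4356 ^ k)" by (intro mult_left_mono *) auto
    also have "(33 ^ k)\<^sup>2 = (1089::real) ^ k" by (simp add: power_mult[symmetric] mult.commute[of k] power_mult)
    also have "1089 ^ k * (1 / 4356 ^ k) = ((1/2 :: real) ^ k)\<^sup>2"
    proof -
      have "(1089::real) ^ k * (1 / 4356 ^ k) = (1089 / 4356) ^ k"
        by (simp only: power_divide times_divide_eq_right mult_1_right)
      also have "\<dots> = ((1/2)\<^sup>2) ^ k" by (simp add: power2_eq_square)
      finally show ?thesis by (simp only: power_mult[symmetric] mult.commute)
    qed
    finally show ?thesis by (rule power2_le_imp_le) simp
  qed
  have "\<exists>l. \<forall>p\<in>S. \<forall>e>0. \<exists>n0. \<forall>n\<ge>n0. hn p ((\<Sum>k<n. T (w k)) - l) < e"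
    using Tw by (rule geometric_series_converges)
  then obtain y where y: "\<And>q e. q \<in> S \<Longrightarrow> e > 0 \<Longrightarrow> \<exists>n0. \<forall>n\<ge>n0. hn q ((\<Sum>k<n. T (w k)) - y) < e"
    by blast
  define s where "s n = (\<Sum>k<n. w k)" for n
  have "y \<in> range T"
    using y by (intro limit_in_range[of s]) (simp add: s_def T_sum)
  then obtain x where x: "y = T x" by blast
  have Ts: "\<exists>n0. \<forall>n\<ge>n0. hn p (T (s n - x)) < e" if "e > 0" for e
    using y[OF p that] by (simp add: s_def T_diff T_sum x)
  have lower: "3/8 * 33 ^ n \<le> hn p x + 3" for n
  proof -
    \<comment> \<open>\<open>\<psi>\<close> isolates the \<open>n\<close>-th hump: it is
      contractive, keeps at least \<open>1/2\<close> of \<open>u n\<close> in \<open>p\<close>, and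
      is at most \<open>m n / r\<close> times \<open>h\<close>. The last bound makes it small on
      later humps and at most \<open>1\<close> on \<open>s N - x\<close>, where
      \<open>T (s N - x)\<close> is small.\<close>
    define \<psi> where "\<psi> v = v - H.ev (cut (m n)) v" for v
    have \<psi>_sum: "\<psi> (sum f A) = (\<Sum>i\<in>A. \<psi> (f i))" for f and A :: "nat set"
    proof (induction A rule: infinite_finite_induct)
      case (insert a A)
      then show ?case by (simp add: \<psi>_def H.ev_vadd)
    qed (simp_all add: \<psi>_def)
    have \<psi>_diff: "\<psi> (a - b) = \<psi> a - \<psi> b" for a b by (simp add: \<psi>_def H.ev_vdiff)
    have \<psi>_scale: "\<psi> (smx c v) = smx c (\<psi> v)" for c v
      by (simp add: \<psi>_def H.ev_vscale M.scale_right_diff_distrib)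
    have \<psi>1: "hn p (\<psi> v) \<le> hn p v" for v unfolding \<psi>_def by (rule hn_one_minus_cut[OF p])
    have \<psi>2: "hn p (\<psi> v) \<le> real (m n) / r * hn p (h v)" for v
      unfolding \<psi>_def ev_one_minus_cut by (rule hn_cut_quot[OF p])
    define d where "d = r / (real (m n) * C)"
    have d: "d > 0" using r_pos m0[of n] C by (simp add: d_def)
    obtain n0 where n0: "\<And>N. N \<ge> n0 \<Longrightarrow> hn p (T (s N - x)) < d" using Ts[OF d] by blast
    define N where "N = max n0 (Suc n)"
    have "hn p (\<psi> (s N - x)) \<le> real (m n) / r * hn p (h (s N - x))" by (rule \<psi>2)
    also have "\<dots> \<le> real (m n) / r * (C * hn p (T (s N - x)))"
      unfolding h_def using r_pos by (intro mult_left_mono T'_bound p) auto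
    also have "\<dots> \<le> real (m n) / r * (C * d)"
      using r_pos C n0[of N] by (intro mult_left_mono) (auto simp: N_def)
    also have "\<dots> = 1" using r_pos m0[of n] C by (simp add: d_def)
    finally have 1: "hn p (\<psi> (s N)) \<le> hn p x + 1"
      using hn_add[OF p, of "\<psi> (s N - x)" "\<psi> x"] \<psi>1[of x] by (simp add: \<psi>_diff)
    \<comment> \<open>These bounds are claimed for \<open>k \<noteq> n\<close>. The value
      \<open>b n\<close>, from the second case, only enlarges the sum when the missing index is put
      back.\<close>
    define b where "b k = (if k < n then 4 * 33 ^ k else (1/2) ^ k :: real)" for k
    have bk: "hn p (\<psi> (w k)) \<le> b k" if "k \<noteq> n" for k
    proof (cases "k < n")
      case True
      have "hn p (\<psi> (w k)) \<le> 33 ^ k * hn p (u k)"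
        using \<psi>1[of "w k"] by (simp add: w_def hn_scale[OF p] norm_power)
      also have "\<dots> \<le> 33 ^ k * 4" by (intro mult_left_mono u4 p) auto
      finally show ?thesis using True by (simp add: b_def)
    next
      case False
      then have "n < k" using that by simp
      have "hn p (\<psi> (w k)) = 33 ^ k * hn p (\<psi> (u k))"
        by (simp add: w_def \<psi>_scale hn_scale[OF p] norm_power)
      also have "\<dots> \<le> 33 ^ k * (real (m n) / r * (\<kappa> k / real (m n)))"
        using \<psi>2[of "u k"] hu'[OF p \<open>n < k\<close>] r_pos
        by (intro mult_left_mono order_trans[OF \<psi>2] mult_left_mono) auto
      also have "\<dots> = 33 ^ k * (min 1 r / r / (4 * 4356 ^ k))"
        using m0[of n] by (simp add: \<kappa>_def)
      also have "\<dots> \<le> 33 ^ k * (1 / (4 * 4356 ^ k))"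
        using r_pos by (intro mult_left_mono divide_right_mono) auto
      also have "\<dots> \<le> 33 ^ k / 66 ^ k"
      proof -
        have "(66::real) ^ k \<le> 4356 ^ k" by (intro power_mono) auto
        moreover have "(0::real) \<le> 4356 ^ k" by simp
        ultimately have "(66::real) ^ k \<le> 4 * 4356 ^ k" by linarith
        then have "(33::real) ^ k / (4 * 4356 ^ k) \<le> 33 ^ k / 66 ^ k" by (intro divide_left_mono) auto
        then show ?thesis by simp
      qed
      also have "\<dots> = (1/2) ^ k" by (simp add: power_divide[symmetric])
      finally show ?thesis using False by (simp add: b_def)
    qed
    have "\<psi> (s N) = \<psi> (w n) + (\<Sum>k\<in>{..<N} - {n}. \<psi> (w k))"
      unfolding s_def \<psi>_sum by (rule sum.remove) (auto simp: N_def)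
    then have "\<psi> (w n) = \<psi> (s N) - (\<Sum>k\<in>{..<N} - {n}. \<psi> (w k))" by simp
    then have "hn p (\<psi> (w n)) \<le> hn p (\<psi> (s N)) + hn p (\<Sum>k\<in>{..<N} - {n}. \<psi> (w k))"
      using hn_diff[OF p] by metis
    also have "hn p (\<Sum>k\<in>{..<N} - {n}. \<psi> (w k)) \<le> (\<Sum>k\<in>{..<N} - {n}. hn p (\<psi> (w k)))"
      by (rule hn_sum[OF p])
    also have "\<dots> \<le> (\<Sum>k\<in>{..<N} - {n}. b k)" using bk by (intro sum_mono) auto
    also have "\<dots> \<le> (\<Sum>k<N. b k)" by (intro sum_mono2) (auto simp: b_def)
    also have "(\<Sum>k<N. b k) \<le> 1/8 * 33 ^ n + 2"
    proof -
      have pow: "(0::real) \<le> (1/2) ^ N" for N :: nat by simp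
      have sb: "(\<Sum>k<N. b k) \<le> 1/8 * 33 ^ min N n + (2 - 2 * (1/2) ^ N)" for N
      proof (induction N)
        case (Suc N)
        show ?case
        proof (cases "N < n")
          case True
          then have "b N = 4 * 33 ^ N" "min N n = N" "min (Suc N) n = Suc N" by (auto simp: b_def)
          with Suc have "sum b {..<N} + b N \<le> 1/8 * (33 * 33 ^ N) + (2 - 2 * ((1/2) * (1/2) ^ N))"
            using pow[of N] by linarith
          then show ?thesis using \<open>min (Suc N) n = Suc N\<close> by simp
        next
          case False
          then have "b N = (1/2) ^ N" "min N n = n" "min (Suc N) n = n" by (auto simp: b_def)
          then show ?thesis using Suc by simp
        qed
      qed simp
      have "(33::real) ^ min N n \<le> 33 ^ n" by (intro power_increasing) auto
      then show ?thesis using sb[of N] pow[of N] by linarith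
    qed
    finally have "hn p (\<psi> (w n)) \<le> hn p x + 3 + 1/8 * 33 ^ n" using 1 by linarith
    moreover have "hn p (\<psi> (w n)) = 33 ^ n * hn p (\<psi> (u n))"
      by (simp add: w_def \<psi>_scale hn_scale[OF p] norm_power)
    moreover have "33 ^ n * (1/2) \<le> 33 ^ n * hn p (\<psi> (u n))"
      using half[of n] by (intro mult_left_mono) (auto simp: \<psi>_def)
    ultimately show ?thesis by linarith
  qed
  obtain n where "8 / 3 * (hn p x + 3) < 33 ^ n"
    using real_arch_pow[of 33 "8 / 3 * (hn p x + 3)"] by auto
  then have "3 / 8 * (8 / 3 * (hn p x + 3)) < 3 / 8 * 33 ^ n" by (rule mult_strict_left_mono) simp
  then show False using lower[of n] by simp
qed

text \<open>The gap concerns vectors of the form \<open>h w\<close>, and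
  \<open>cut n y - cut m y\<close> is one, because \<open>1 - cut n\<close> and
  \<open>1 - cut m\<close> are divisible by \<open>x\<close>. Its image under \<open>h\<close>
  decays like \<open>1 / sqrt n + 1 / sqrt m\<close>. Once the limit is known to be
  \<open>0\<close>, letting \<open>m\<close> grow leaves the stated rate.\<close>

lemma cut_tendsto_0:
  assumes p: "p \<in> S"
  obtains K where "K \<ge> 0" "\<And>n y. n > 0 \<Longrightarrow> hn p (H.ev (cut n) y) \<le> K / sqrt (real n) * hn p y"
proof -
  have est: "\<exists>K\<ge>0. \<forall>n m y. n > 0 \<longrightarrow> m > 0 \<longrightarrow> hn q (H.ev (cut n) y - H.ev (cut m) y)
      \<le> (K / sqrt (real n) + K / sqrt (real m)) * hn q y" if q: "q \<in> S" for q
  proof -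
    obtain K0 where K0: "\<And>x. hn q (h x) \<le> K0 * hn q (h (h x))" using spectral_gap[OF q] by blast
    define K where "K = \<bar>K0\<bar>"
    have K: "hn q (h x) \<le> K * hn q (h (h x))" for x
      using K0[of x] mult_right_mono[OF abs_ge_self[of K0] hn_nonneg[OF q, of "h (h x)"]] by (simp add: K_def)
    have "hn q (H.ev (cut n) y - H.ev (cut m) y) \<le> (K * r / sqrt (real n) + K * r / sqrt (real m)) * hn q y"
      if nm: "n > 0" "m > 0" for n m y
    proof -
      define w where "w = H.ev (cut_quot m) y - H.ev (cut_quot n) y"
      have e: "h (H.ev (cut_quot k) y) = y - H.ev (cut k) y" for k
        by (simp add: ev_one_minus_cut H.ev_H)
      have hw: "h w = H.ev (cut n) y - H.ev (cut m) y" by (simp add: w_def H.H_diff e)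
      have "hn q (h (h w)) \<le> hn q (H.ev (cut n) (h y)) + hn q (H.ev (cut m) (h y))"
        unfolding hw H.H_diff H.ev_H[symmetric] by (rule hn_diff[OF q])
      also have "\<dots> \<le> r / sqrt (real n) * hn q y + r / sqrt (real m) * hn q y"
        by (intro add_mono hn_h_cut q nm)
      finally have "K * hn q (h (h w)) \<le> K * (r / sqrt (real n) * hn q y + r / sqrt (real m) * hn q y)"
        by (intro mult_left_mono) (auto simp: K_def)
      then show ?thesis using K[of w] by (simp add: hw algebra_simps)
    qed
    moreover have "0 \<le> K * r" using r_pos by (simp add: K_def)
    ultimately show ?thesis by blast
  qed
  have zero: "\<exists>n0. \<forall>n\<ge>n0. hn q (H.ev (cut n) y) < e" if q: "q \<in> S" and e: "e > 0" for q e y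
  proof -
    have "\<exists>l. \<forall>p\<in>S. \<forall>e>0. \<exists>n0. \<forall>n\<ge>n0. hn p (H.ev (cut n) y - l) < e"
    proof (rule module_sequence_complete)
      fix q and e :: real assume q: "q \<in> S" and e: "e > 0"
      obtain K where K: "K \<ge> 0" "\<And>n m. n > 0 \<Longrightarrow> m > 0 \<Longrightarrow> hn q (H.ev (cut n) y - H.ev (cut m) y)
        \<le> (K / sqrt (real n) + K / sqrt (real m)) * hn q y" using est[OF q] by blast
      obtain n0 where n0: "n0 > 0" "\<And>n. n \<ge> n0 \<Longrightarrow> K * hn q y / sqrt (real n) < e / 2"
        using small_inverse_sqrt[of "e / 2" "K * hn q y"] e by auto
      have "hn q (H.ev (cut m) y - H.ev (cut n) y) < e" if "m \<ge> n0" "n \<ge> n0" for m n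
      proof -
        have "(K / sqrt (real m) + K / sqrt (real n)) * hn q y = K * hn q y / sqrt (real m) + K * hn q y / sqrt (real n)"
          by (simp add: distrib_right)
        then show ?thesis
          using K(2)[of m n] n0(1) n0(2)[OF that(1)] n0(2)[OF that(2)] that by linarith
      qed
      then show "\<exists>n0. \<forall>m\<ge>n0. \<forall>n\<ge>n0. hn q (H.ev (cut m) y - H.ev (cut n) y) < e" by blast
    qed
    then obtain l where l: "\<And>p e. p \<in> S \<Longrightarrow> e > 0 \<Longrightarrow> \<exists>n0. \<forall>n\<ge>n0. hn p (H.ev (cut n) y - l) < e"
      by blast
    \<comment> \<open>\<open>h (cut n y)\<close> is of order \<open>1 / sqrt n\<close>, so
      \<open>h\<close> kills the limit. The limit is taken in all seminorms jointly, which is why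
      the gap is used for each of them even though the claim is about \<open>p\<close>.\<close>
    have "h l = 0"
    proof (rule hn_eq_0)
      fix p assume p: "p \<in> S"
      have "hn p (h l) \<le> 0 + e" if e: "e > 0" for e
      proof -
        have pos: "e / (2 * r) > 0" using e r_pos by simp
        obtain n1 where n1: "\<And>n. n \<ge> n1 \<Longrightarrow> hn p (H.ev (cut n) y - l) < e / (2 * r)" using l[OF p pos] by blast
        obtain n2 where n2: "n2 > 0" "\<And>n. n \<ge> n2 \<Longrightarrow> r * hn p y / sqrt (real n) < e / 2"
          using small_inverse_sqrt[of "e / 2" "r * hn p y"] e by auto
        define n where "n = max n1 n2"
        have n: "n \<ge> n1" "n \<ge> n2" "n > 0" using n2 by (auto simp: n_def)
        have "h l = h (H.ev (cut n) y) - h (H.ev (cut n) y - l)" by (simp add: H.H_diff)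
        then have "hn p (h l) \<le> hn p (H.ev (cut n) (h y)) + hn p (h (H.ev (cut n) y - l))"
          using hn_diff[OF p] by (metis H.ev_H)
        also have "hn p (H.ev (cut n) (h y)) \<le> e / 2"
        proof -
          have "r / sqrt (real n) * hn p y = r * hn p y / sqrt (real n)" by simp
          then show ?thesis using hn_h_cut[OF p n(3), of y] n2(2)[OF n(2)] by linarith
        qed
        also have "hn p (h (H.ev (cut n) y - l)) \<le> r * (e / (2 * r))"
        proof -
          have "hn p (h (H.ev (cut n) y - l)) \<le> C\<^sup>2 * hn p (H.ev (cut n) y - l)" by (rule h_bound[OF p])
          also have "\<dots> \<le> r * (e / (2 * r))"
            using n1[OF n(1)] hn_nonneg[OF p] r_pos by (intro mult_mono) (auto simp: r_def less_imp_le)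
          finally show ?thesis .
        qed
        finally show ?thesis using r_pos by simp
      qed
      then have "hn p (h l) \<le> 0" by (rule field_le_epsilon)
      then show "hn p (h l) = 0" using hn_nonneg[OF p, of "h l"] by simp
    qed
    then have "l = 0" by (rule h_inj)
    then show ?thesis using l[OF q e] by simp
  qed
  obtain K where K: "K \<ge> 0" "\<And>n m y. n > 0 \<Longrightarrow> m > 0 \<Longrightarrow> hn p (H.ev (cut n) y - H.ev (cut m) y)
        \<le> (K / sqrt (real n) + K / sqrt (real m)) * hn p y" using est[OF p] by blast
  have "hn p (H.ev (cut n) y) \<le> K / sqrt (real n) * hn p y" if n: "n > 0" for n y
  proof (rule field_le_epsilon)
    fix e :: real assume e: "e > 0"
    obtain n1 where n1: "\<And>n. n \<ge> n1 \<Longrightarrow> hn p (H.ev (cut n) y) < e / 2" using zero[OF p, of "e / 2" y] e by auto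
    obtain n2 where n2: "n2 > 0" "\<And>n. n \<ge> n2 \<Longrightarrow> K * hn p y / sqrt (real n) < e / 2"
      using small_inverse_sqrt[of "e / 2" "K * hn p y"] e by auto
    define m where "m = max n1 n2"
    have m: "m \<ge> n1" "m \<ge> n2" "m > 0" using n2 by (auto simp: m_def)
    have "hn p (H.ev (cut n) y) \<le> hn p (H.ev (cut n) y - H.ev (cut m) y) + hn p (H.ev (cut m) y)"
      using hn_add[OF p, of "H.ev (cut n) y - H.ev (cut m) y" "H.ev (cut m) y"] by simp
    moreover have "(K / sqrt (real n) + K / sqrt (real m)) * hn p y = K / sqrt (real n) * hn p y + K * hn p y / sqrt (real m)"
      by (simp add: distrib_right)
    ultimately show "hn p (H.ev (cut n) y) \<le> K / sqrt (real n) * hn p y + e"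
      using K(2)[OF n m(3), of y] n1[OF m(1)] n2(2)[OF m(2)] by linarith
  qed
  then show ?thesis using that[OF K(1)] by blast
qed

text \<open>For one fixed large \<open>n\<close> the part \<open>cut n x\<close> has at most half
  the norm of \<open>x\<close>, and the rest is at most \<open>n / r\<close> times
  \<open>h x\<close>.\<close>

lemma h_below:
  assumes p: "p \<in> S"
  shows "\<exists>K\<ge>0. \<forall>x. hn p x \<le> K * hn p (h x)"
proof -
  obtain K where K: "K \<ge> 0" "\<And>n y. n > 0 \<Longrightarrow> hn p (H.ev (cut n) y) \<le> K / sqrt (real n) * hn p y"
    using cut_tendsto_0[OF p] by metis
  obtain n where n: "n > 0" "K / sqrt (real n) < 1/2" using small_inverse_sqrt[of "1/2" K] by auto
  have "hn p x \<le> 2 * (real n / r) * hn p (h x)" for x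
  proof -
    have "hn p x \<le> hn p (x - H.ev (cut n) x) + hn p (H.ev (cut n) x)"
      using hn_add[OF p, of "x - H.ev (cut n) x" "H.ev (cut n) x"] by simp
    also have "\<dots> \<le> real n / r * hn p (h x) + 1/2 * hn p x"
    proof (rule add_mono)
      show "hn p (x - H.ev (cut n) x) \<le> real n / r * hn p (h x)"
        unfolding ev_one_minus_cut by (rule hn_cut_quot[OF p])
      show "hn p (H.ev (cut n) x) \<le> 1/2 * hn p x"
        using K(2)[OF n(1), of x] mult_right_mono[OF less_imp_le[OF n(2)] hn_nonneg[OF p, of x]] by linarith
    qed
    finally show ?thesis by simp
  qed
  moreover have "0 \<le> 2 * (real n / r)" using r_pos by simp
  ultimately show ?thesis by blast
qed

text \<open>\<open>cut_quot n y\<close> solves the equation up to \<open>cut n y\<close>. How large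
  \<open>n\<close> has to be depends on the seminorm, and \<open>module_solve\<close> passes from
  these approximations to an exact solution.\<close>

lemma h_surj: "\<exists>x. h x = y"
proof (rule module_solve)
  show "h (v - w) = h v - h w" for v w by (rule H.H_diff)
  fix p assume p: "p \<in> S"
  show "\<exists>C. \<forall>v. hn p (h v) \<le> C * hn p v" using h_bound[OF p] by blast
  show "\<exists>C. \<forall>v. hn p v \<le> C * hn p (h v)" using h_below[OF p] by blast
  fix e :: real assume e: "0 < e"
  obtain K where K: "K \<ge> 0" "\<And>n y. n > 0 \<Longrightarrow> hn p (H.ev (cut n) y) \<le> K / sqrt (real n) * hn p y"
    using cut_tendsto_0[OF p] by metis
  obtain n where n: "n > 0" "K * hn p y / sqrt (real n) < e" using small_inverse_sqrt[OF e, of "K * hn p y"] by auto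
  have "h (H.ev (cut_quot n) y) = y - H.ev (cut n) y"
    by (simp add: ev_one_minus_cut H.ev_H)
  then have "h (H.ev (cut_quot n) y) - y = - H.ev (cut n) y" by simp
  then have "hn p (h (H.ev (cut_quot n) y) - y) = hn p (H.ev (cut n) y)" by (simp add: hn_minus[OF p])
  also have "\<dots> < e" using K(2)[OF n(1), of y] n(2) by simp
  finally show "\<exists>x. hn p (h x - y) < e" by blast
qed

lemma T_invertible:
  assumes T'_inj: "\<And>x. T' x = 0 \<Longrightarrow> x = 0"
  shows "invertible_hom S smx act ip T"
proof -
  have "\<exists>x. T x = y" for y
  proof -
    obtain x where "h x = T' y" using h_surj by blast
    then have "T' (T x - y) = 0" by (simp add: h_def T'_diff)
    then show ?thesis using T'_inj by force
  qed
  then obtain R where R: "\<And>y. T (R y) = y" by metis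
  have inj: "x = x'" if "T x = T x'" for x x' using T_inj[of "x - x'"] that by (simp add: T_diff)
  have RT: "R (T x) = x" for x by (rule inj) (simp add: R)
  have "module_map smx act R"
    unfolding module_map_def by (intro conjI allI; rule inj) (simp_all add: R T_add T_scale T_act)
  moreover have "bounded_op S ip R"
    unfolding bounded_op_def
  proof
    fix p assume p: "p \<in> S"
    obtain K where K: "K \<ge> 0" "\<And>x. hn p x \<le> K * hn p (h x)" using h_below[OF p] by blast
    have "hn p (R y) \<le> K * C * hn p y" for y
    proof -
      have "hn p (R y) \<le> K * hn p (T' y)" using K(2)[of "R y"] by (simp add: h_def R)
      also have "\<dots> \<le> K * (C * hn p y)" by (intro mult_left_mono T'_bound p K)
      finally show ?thesis by (simp add: mult.assoc)
    qed
    then show "\<exists>C. \<forall>x. hn p (R x) \<le> C * hn p x" by blast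
  qed
  \<comment> \<open>Surjectivity of \<open>h\<close> makes \<open>T'\<close> onto, and a right
    inverse of \<open>T'\<close> is an adjoint of \<open>R\<close>.\<close>
  moreover have "adjointable ip R"
  proof -
    have "\<exists>w. T' w = z" for z using h_surj[of z] by (auto simp: h_def)
    then obtain R' where R': "\<And>z. T' (R' z) = z" by metis
    have "ip (R y) z = ip y (R' z)" for y z
      using T_adj[of "R y" "R' z"] by (simp add: R R')
    then show ?thesis unfolding adjointable_def by blast
  qed
  ultimately show ?thesis unfolding invertible_hom_def hom_star_def using R RT by blast
qed

end

section \<open>Separation of points by K-frames\<close>

context hilbert_mod
begin

lemma adj_works:
  assumes "adjointable ip T"
  shows "ip (T x) y = ip x (adj ip T y)"
proof -
  obtain T' where T': "\<forall>x y. ip (T x) y = ip x (T' y)" using assms by (auto simp: adjointable_def)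
  have "\<forall>x y. ip (T x) y = ip x (adj ip T y)"
    unfolding adj_def
  proof (rule theI[where a = T' and P = "\<lambda>U. \<forall>x y. ip (T x) y = ip x (U y)"])
    show "\<forall>x y. ip (T x) y = ip x (T' y)" by (rule T')
    fix U assume U: "\<forall>x y. ip (T x) y = ip x (U y)"
    have "U y = T' y" for y by (rule ip_ext) (use T' U in simp)
    then show "U = T'" by blast
  qed
  then show ?thesis by blast
qed

text \<open>Such an \<open>x\<close> is orthogonal to \<open>range K\<close>, and density puts
  elements of \<open>range K\<close> arbitrarily close to \<open>x\<close> itself; Cauchy-Schwarz
  then gives \<open>||x||^2 \<le> e ||x||\<close>.\<close>

lemma dense_range_adj_inj:
  assumes K: "adjointable ip K" and dense: "sn_closure (hnorms S ip) (range K) = UNIV"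
    and x: "adj ip K x = 0"
  shows "x = 0"
proof (rule hn_eq_0)
  fix p assume p: "p \<in> S"
  have "(hn p x)\<^sup>2 \<le> 0 + e * hn p x" if e: "e > 0" for e
  proof -
    have "x \<in> sn_closure (hnorms S ip) (range K)" using dense by simp
    then have "\<forall>e>0. \<exists>y\<in>range K. \<forall>q\<in>{hn p}. q (x - y) < e"
      unfolding sn_closure_def mem_Collect_eq using p
      by (elim allE[of _ "{hn p}"]) (auto simp: hnorms_def)
    then obtain z where z: "hn p (x - K z) < e" using e by blast
    have "ip (K z) x = 0" using adj_works[OF K, of z x] x by simp
    then have "(hn p x)\<^sup>2 = p (ip (x - K z) x)" by (simp add: hn_square[OF p] ip_diff_left)
    also have "\<dots> \<le> hn p (x - K z) * hn p x" by (rule cauchy_schwarz[OF p])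
    also have "\<dots> \<le> e * hn p x" using z hn_nonneg[OF p] by (intro mult_right_mono) auto
    finally show ?thesis by simp
  qed
  then have "hn p x * hn p x \<le> e * hn p x" if "e > 0" for e using that by (simp add: power2_eq_square)
  then have "hn p x \<le> e" if "e > 0" for e
    using that hn_nonneg[OF p, of x] by (metis less_eq_real_def mult_le_cancel_right_pos order_less_imp_le)
  then have "hn p x \<le> 0" by (metis dense_le_bounded field_le_epsilon add_0)
  then show "hn p x = 0" using hn_nonneg[OF p, of x] by simp
qed

text \<open>All terms of the frame sum vanish, so the lower frame bound makes \<open>- A k\<close>
  positive along with \<open>A k\<close>, and antisymmetry of the order gives
  \<open>k = 0\<close>.\<close>

lemma kframe_separates:
  assumes K: "adjointable ip K" and dense: "sn_closure (hnorms S ip) (range K) = UNIV"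
    and frame: "kframe sm st S ip K I g" and zero: "\<And>i. ip (g i) x = 0"
  shows "x = 0"
proof -
  obtain A s where A: "A > 0" and s: "sn_has_sum S (\<lambda>i. ip x (g i) * ip (g i) x) I s"
    "cle st (sm (complex_of_real A) (ip (adj ip K x) (adj ip K x))) s"
    using frame unfolding kframe_def by blast
  have "s = 0"
    unfolding eq_0_iff
  proof
    fix p assume p: "p \<in> S"
    interpret cstar_sn sm st p by (rule cstar_sn) fact
    have "p s \<le> 0 + e" if "e > 0" for e
    proof -
      have "eventually (\<lambda>F. p (sum (\<lambda>i. ip x (g i) * ip (g i) x) F - s) < e) (finite_subsets_at_top I)"
        using s(1) p that by (simp add: sn_has_sum_def)
      then have "eventually (\<lambda>F. p s < e) (finite_subsets_at_top I)" by (simp add: zero)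
      then show ?thesis by (simp add: eventually_const)
    qed
    then have "p s \<le> 0" by (rule field_le_epsilon)
    then show "p s = 0" using p_nonneg[of s] by linarith
  qed
  define k where "k = ip (adj ip K x) (adj ip K x)"
  have "positive st (- sm (complex_of_real A) k)" using s(2) \<open>s = 0\<close> by (simp add: cle_def k_def)
  moreover have "positive st (sm (complex_of_real A) k)"
    unfolding k_def using A by (intro positive_scale ip_positive) auto
  ultimately have "sm (complex_of_real A) k = 0" using positive_antisym[of "sm (complex_of_real A) k" "- sm (complex_of_real A) k"] by simp
  then have "k = 0" using A by simp
  then have "adj ip K x = 0" unfolding k_def by (rule ip_definite)
  then show ?thesis by (rule dense_range_adj_inj[OF K dense])
qed

end

theorem theorem4p12:
  fixes sm :: "complex \<Rightarrow> 'a::ring \<Rightarrow> 'a"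
    and st :: "'a \<Rightarrow> 'a"
    and S :: "('a \<Rightarrow> real) set"
    and smx :: "complex \<Rightarrow> 'x::ab_group_add \<Rightarrow> 'x"
    and act :: "'a \<Rightarrow> 'x \<Rightarrow> 'x"
    and ip :: "'x \<Rightarrow> 'x \<Rightarrow> 'a"
    and K T :: "'x \<Rightarrow> 'x"
    and I :: "'i set"
    and f :: "'i \<Rightarrow> 'x"
  assumes X: "hilbert_module sm st S smx act ip"
    and K: "hom_star S smx act ip K" "unif_bounded S ip K"
    and K_dense: "sn_closure (hnorms S ip) (range K) = UNIV"
    and frame: "kframe sm st S ip K I f"
    and T: "hom_star S smx act ip T" "unif_bounded S ip T"
    and T_closed: "sn_closure (hnorms S ip) (range T) \<subseteq> range T"
    and Tframe: "kframe sm st S ip K I (\<lambda>i. T (f i))"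
    and Tadj_frame: "kframe sm st S ip K I (\<lambda>i. adj ip T (f i))"
  shows "invertible_hom S smx act ip T"
proof -
  have pro: "pro_cstar_algebra sm st S" "vector_space smx" using X by (auto simp: hilbert_module_def)
  then have alg: "star_algebra sm st" by (simp add: pro_cstar_algebra_def)
  then have vs: "vector_space sm" by (simp add: star_algebra_def)
  interpret hilbert_mod sm st S smx act ip
    unfolding hilbert_mod_def hilbert_mod_axioms_def pro_cstar_def pro_cstar_axioms_def
      star_alg_def star_alg_axioms_def using pro alg vs X by blast
  have adjK: "adjointable ip K" and adjT: "adjointable ip T" using K T by (auto simp: hom_star_def)
  note TT' = adj_works[OF adjT]
  have T'T: "ip (adj ip T x) y = ip x (T y)" for x y
    using arg_cong[OF TT'[of y x], of st] by simp
  \<comment> \<open>The roles cross: moving the adjoint off \<open>f i\<close> produces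
    \<open>T x\<close>, so the frame of the \<open>adj ip T (f i)\<close> controls the kernel of
    \<open>T\<close>, and the frame of the \<open>T (f i)\<close> that of the adjoint.\<close>
  have T_inj: "x = 0" if "T x = 0" for x
    by (rule kframe_separates[OF adjK K_dense Tadj_frame]) (simp add: T'T that)
  have T'_inj: "x = 0" if "adj ip T x = 0" for x
    by (rule kframe_separates[OF adjK K_dense Tframe]) (simp add: TT' that)
  obtain C where C: "C > 0" "\<And>p x. p \<in> S \<Longrightarrow> hnorm p ip (T x) \<le> C * hnorm p ip x"
    using T(2) unfolding unif_bounded_def by blast
  have "module_map smx act T" using T(1) by (simp add: hom_star_def)
  then interpret closed_range_operator sm st S smx act ip T "adj ip T" C
    by unfold_locales (use C T_inj T_closed in \<open>auto simp: module_map_def TT'\<close>)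
  show ?thesis using T'_inj by (rule T_invertible)
qed

end
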